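(* Let $\theta$ be an irrational Pisot number, and let $\mu_\theta$ be the Bernoulli convolution parameterized by $\theta$. Then the set of limit points of the sequence $\{\widehat{\mu_\theta}(n) : n\in\mathbb{Z}\}$ is countable (of cardinality $\aleph_0$). Consequently, regarding $\mu_\theta$ as a probability measure $\nu$ on the circle $S^1=\mathbb{R}/\mathbb{Z}$ (via the projection $\mathbb{R}\to\mathbb{R}/\mathbb{Z}$) and letting $T_\nu f=\nu*f$, one has, for all $1<p<+\infty$, $$\mathrm{sp}(T_\nu,L^p(S^1))=\mathrm{sp}(T_\nu,L^2(S^1))=\overline{\{\widehat{\nu}(n): n\in\mathbb{Z}\}}.$$
   Context: A Pisot number is an algebraic integer greater than $1$ whose other conjugates are all less than $1$ in modulus. For $\theta>1$, the Bernoulli convolution $\mu_\theta$ is the Borel probability measure on $\mathbb{R}$ given by the infinite convolution product over $k\ge 0$ of the measures $\frac12\delta_{-\theta^{-k}}+\frac12\delta_{\theta^{-k}}$, where $\delta_x$ is the Dirac measure at $x$. Its Fourier transform is $\widehat{\mu_\theta}(t)=\prod_{k=0}^\infty\cos(2\pi\theta^{-k}t)$, $t\in\mathbb{R}$. The measure induced on $S^1=\mathbb{R}/\mathbb{Z}$ has Fourier coefficients $\widehat{\mu_\theta}(n)$, $n\in\mathbb{Z}$. For a Borel probability measure $\nu$ on $S^1$, $T_\nu:L^p(S^1)\to L^p(S^1)$ is the convolution operator $T_\nu f=\nu*f$, and $\mathrm{sp}(T_\nu,L^p(S^1))$ denotes its spectrum as a bounded operator on $L^p(S^1)$. *)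

theory Defs
  imports "HOL-Probability.Probability"
begin

section \<open>Pisot numbers\<close>

text \<open>Two algebraic numbers are conjugate over the rationals if they are roots of the same minimal
  polynomial, i.e. of the same monic irreducible rational polynomial.\<close>

definition conjugate_over_rat :: "complex \<Rightarrow> complex \<Rightarrow> bool" where
  "conjugate_over_rat z w \<longleftrightarrow>
     (\<exists>q :: rat poly. lead_coeff q = 1 \<and> irreducible q \<and>
        poly (map_poly of_rat q) z = 0 \<and> poly (map_poly of_rat q) w = 0)"

definition pisot :: "real \<Rightarrow> bool" where
  "pisot \<theta> \<longleftrightarrow> \<theta> > 1 \<and> algebraic_int \<theta> \<and>
     (\<forall>z. conjugate_over_rat (of_real \<theta>) z \<and> z \<noteq> of_real \<theta> \<longrightarrow> norm z < 1)"


section \<open>Bernoulli convolutions\<close>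

definition two_point :: "real \<Rightarrow> real measure" where
  "two_point a = distr (measure_pmf (bernoulli_pmf (1/2))) borel (\<lambda>b. if b then a else - a)"

lemma emeasure_two_point:
  assumes "A \<in> sets borel"
  shows "emeasure (two_point a) A =
    (1/2) * emeasure (return borel (- a)) A + (1/2) * emeasure (return borel a) A"
proof -
  let ?f = "\<lambda>b. if b then a else - a"
  have "emeasure (two_point a) A = (\<integral>\<^sup>+b. indicator A (?f b) \<partial>measure_pmf (bernoulli_pmf (1/2)))"
    unfolding two_point_def using assms
    by (subst nn_integral_indicator[symmetric], simp, subst nn_integral_distr) simp_all
  also have "\<dots> = (1/2) * emeasure (return borel (- a)) A + (1/2) * emeasure (return borel a) A"
    using assms by (simp add: add.commute mult.commute divide_ennreal_def)
  finally show ?thesis .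
qed

primrec bernoulli_partial :: "real \<Rightarrow> nat \<Rightarrow> real measure" where
  "bernoulli_partial \<theta> 0 = return borel 0"
| "bernoulli_partial \<theta> (Suc n) = convolution (bernoulli_partial \<theta> n) (two_point (inverse \<theta> ^ n))"

text \<open>The infinite convolution product is the weak limit of the finite ones; the limit law is
  unique because a distribution on the line is determined by its distribution function.\<close>

definition bernoulli_convolution :: "real \<Rightarrow> real measure" where
  "bernoulli_convolution \<theta> =
     (THE M. real_distribution M \<and> weak_conv_m (bernoulli_partial \<theta>) M)"

lemma bernoulli_convolution_welldef:
  assumes "\<theta> > 1"
  shows "real_distribution (bernoulli_convolution \<theta>)"
    and "weak_conv_m (bernoulli_partial \<theta>) (bernoulli_convolution \<theta>)"
proof -
  let ?B = "measure_pmf (bernoulli_pmf (1/2))"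
  let ?X = "\<lambda>(n::nat) (\<omega>::nat \<Rightarrow> bool). (if \<omega> n then inverse \<theta> ^ n else - (inverse \<theta> ^ n))"
  define P where "P = PiM (UNIV :: nat set) (\<lambda>_. ?B)"
  interpret prod: product_prob_space "\<lambda>_::nat. ?B" UNIV ..
  interpret P: prob_space P unfolding P_def by (rule prob_space_PiM) (rule prob_space_measure_pmf)
  have compm: "(\<lambda>\<omega>. \<omega> n) \<in> measurable P ?B" for n
    unfolding P_def by (rule measurable_component_singleton) simp
  have X_comp: "?X n = (\<lambda>b. if b then inverse \<theta> ^ n else - (inverse \<theta> ^ n)) \<circ> (\<lambda>\<omega>. \<omega> n)" for n
    by auto
  have Xm [measurable]: "?X n \<in> borel_measurable P" for n
    unfolding X_comp by (rule measurable_comp[OF compm]) simp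
  have distr_component: "distr P ?B (\<lambda>\<omega>. \<omega> n) = ?B" for n
    unfolding P_def by (rule prod.PiM_component) simp
  have dX: "distr P borel (?X n) = two_point (inverse \<theta> ^ n)" for n
  proof -
    have "distr P borel (?X n) = distr (distr P ?B (\<lambda>\<omega>. \<omega> n)) borel
        (\<lambda>b. if b then inverse \<theta> ^ n else - (inverse \<theta> ^ n))"
      unfolding X_comp by (rule distr_distr[symmetric, OF _ compm]) simp
    then show ?thesis by (simp only: distr_component two_point_def)
  qed
  have "distr P (PiM UNIV (\<lambda>_. ?B)) (\<lambda>\<omega>. \<omega>) = PiM UNIV (\<lambda>n. distr P ?B (\<lambda>\<omega>. \<omega> n))"
    unfolding distr_component by (simp add: P_def)
  then have "P.indep_vars (\<lambda>_. ?B) (\<lambda>n \<omega>. \<omega> n) UNIV"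
    by (subst P.indep_vars_iff_distr_eq_PiM'[OF _ compm]) (simp_all only: restrict_UNIV UNIV_not_empty not_False_eq_True)
  then have ind: "P.indep_vars (\<lambda>_. borel) ?X UNIV"
    by (rule P.indep_vars_compose2[where Y = "\<lambda>n b. if b then inverse \<theta> ^ n else - (inverse \<theta> ^ n)"]) simp
  define S where "S n \<omega> = (\<Sum>k<n. ?X k \<omega>)" for n \<omega>
  have Sm [measurable]: "S n \<in> borel_measurable P" for n
    unfolding S_def by measurable
  have dS: "distr P borel (S n) = bernoulli_partial \<theta> n" for n
  proof (induction n)
    case 0
    have "distr P borel (\<lambda>_. 0 :: real) = return borel 0"
      by (rule P.distr_const) simp
    then show ?case by (simp add: S_def)
  next
    case (Suc n)
    have "P.indep_var borel (?X n) borel (\<lambda>\<omega>. \<Sum>k<n. ?X k \<omega>)"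
      by (rule P.indep_vars_sum) (auto intro: P.indep_vars_subset[OF ind])
    then have "P.indep_var borel (?X n) borel (S n)"
      by (simp add: S_def[abs_def])
    then have "distr P borel (\<lambda>\<omega>. ?X n \<omega> + S n \<omega>)
        = convolution (distr P borel (?X n)) (distr P borel (S n))"
      by (rule P.sum_indep_random_variable) measurable
    also have "\<dots> = convolution (distr P borel (S n)) (distr P borel (?X n))"
      by (rule convolution_commutative) (auto intro!: prob_space.finite_measure P.prob_space_distr)
    finally show ?case by (simp add: Suc.IH dX) (simp add: S_def[abs_def] add.commute)
  qed
  have summ: "summable (\<lambda>k. ?X k \<omega>)" for \<omega>
    by (rule summable_comparison_test'[where g = "\<lambda>k. inverse \<theta> ^ k" and N = 0])
      (use assms in \<open>auto simp: inverse_less_1_iff intro!: summable_geometric\<close>)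
  define L where "L \<omega> = (\<Sum>k. ?X k \<omega>)" for \<omega>
  have lim: "(\<lambda>n. S n \<omega>) \<longlonglongrightarrow> L \<omega>" for \<omega>
    unfolding S_def L_def by (rule summable_LIMSEQ[OF summ])
  have Lm [measurable]: "L \<in> borel_measurable P"
    by (rule borel_measurable_LIMSEQ_metric[OF Sm lim])
  have rd: "real_distribution (distr P borel L)" "\<And>n. real_distribution (distr P borel (S n))"
    by simp_all
  have wc: "weak_conv_m (\<lambda>n. distr P borel (S n)) (distr P borel L)"
  proof (rule integral_bdd_continuous_conv_imp_weak_conv)
    fix f :: "real \<Rightarrow> real"
    assume f: "\<And>x. isCont f x" "\<And>x. \<bar>f x\<bar> \<le> 1"
    have fm [measurable]: "f \<in> borel_measurable borel"
      by (intro borel_measurable_continuous_onI) (simp add: f(1) continuous_at_imp_continuous_on)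
    have "(\<lambda>n. \<integral>\<omega>. f (S n \<omega>) \<partial>P) \<longlonglongrightarrow> (\<integral>\<omega>. f (L \<omega>) \<partial>P)"
      by (rule integral_dominated_convergence[where w = "\<lambda>_. 1"])
        (auto simp: f(2) intro!: isCont_tendsto_compose[OF f(1) lim])
    then show "(\<lambda>n. integral\<^sup>L (distr P borel (S n)) f) \<longlonglongrightarrow> integral\<^sup>L (distr P borel L) f"
      by (simp add: integral_distr)
  qed (rule rd)+
  have uniq: "N = N'"
    if "real_distribution N" "weak_conv_m (bernoulli_partial \<theta>) N"
      "real_distribution N'" "weak_conv_m (bernoulli_partial \<theta>) N'" for N N'
  proof (rule Levy_uniqueness[OF that(1,3)], rule ext)
    fix t
    have rdp: "\<And>n. real_distribution (bernoulli_partial \<theta> n)"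
      using rd(2) unfolding dS .
    show "char N t = char N' t"
      using levy_continuity1[OF rdp that(1,2)] levy_continuity1[OF rdp that(3,4)]
      by (rule LIMSEQ_unique)
  qed
  have "\<exists>!M. real_distribution M \<and> weak_conv_m (bernoulli_partial \<theta>) M"
    using rd(1) wc uniq unfolding dS by blast
  from theI'[OF this] show "real_distribution (bernoulli_convolution \<theta>)"
    and "weak_conv_m (bernoulli_partial \<theta>) (bernoulli_convolution \<theta>)"
    unfolding bernoulli_convolution_def by blast+
qed

text \<open>The library's \<^const>\<open>char\<close> integrates \<open>exp (i t x)\<close>; here the frequency normalisation is
  \<open>exp (- 2 \<pi> i t x)\<close>.\<close>

definition fourier_transform :: "real measure \<Rightarrow> real \<Rightarrow> complex" where
  "fourier_transform M t = char M (- 2 * pi * t)"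

section \<open>The circle\<close>

quotient_type circle = real / "\<lambda>x y :: real. x - y \<in> \<int>"
proof (rule equivpI)
  show "reflp (\<lambda>x y :: real. x - y \<in> \<int>)" by (simp add: reflp_def)
  show "symp (\<lambda>x y :: real. x - y \<in> \<int>)"
  proof (rule sympI)
    fix x y :: real
    assume "x - y \<in> \<int>"
    then have "- (x - y) \<in> \<int>" by (rule Ints_minus)
    then show "y - x \<in> \<int>" by simp
  qed
  show "transp (\<lambda>x y :: real. x - y \<in> \<int>)"
  proof (rule transpI)
    fix x y z :: real
    assume "x - y \<in> \<int>" "y - z \<in> \<int>"
    then have "(x - y) + (y - z) \<in> \<int>" by (rule Ints_add)
    then show "x - z \<in> \<int>" by simp
  qed
qed

lift_definition circle_of :: "real \<Rightarrow> circle" is "\<lambda>x. x" .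

lemma surj_circle_of: "surj circle_of"
  unfolding surj_def by transfer (metis Ints_0 diff_self)

instantiation circle :: ab_group_add
begin

lift_definition zero_circle :: circle is "0 :: real" .

lift_definition plus_circle :: "circle \<Rightarrow> circle \<Rightarrow> circle" is "\<lambda>x y :: real. x + y"
  by (simp add: add_diff_add)

lift_definition uminus_circle :: "circle \<Rightarrow> circle" is "\<lambda>x :: real. - x"
  by (simp only: minus_diff_minus Ints_minus)

lift_definition minus_circle :: "circle \<Rightarrow> circle \<Rightarrow> circle" is "\<lambda>x y :: real. x - y"
proof -
  fix x x' y y' :: real
  assume "x - x' \<in> \<int>" "y - y' \<in> \<int>"
  then have "(x - x') - (y - y') \<in> \<int>" by (rule Ints_diff)
  then show "x - y - (x' - y') \<in> \<int>" by (simp add: algebra_simps)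
qed

instance
  by standard (transfer; simp)+

end

text \<open>The quotient topology; \<^term>\<open>borel\<close> on the circle is generated by it.\<close>

instantiation circle :: topological_space
begin

definition open_circle :: "circle set \<Rightarrow> bool" where
  "open_circle U \<longleftrightarrow> open (circle_of -` U)"

instance
proof
  show "open (UNIV :: circle set)" by (simp add: open_circle_def)
  show "open (S \<inter> T)" if "open S" "open T" for S T :: "circle set"
    using that by (simp add: open_circle_def vimage_Int open_Int)
  show "open (\<Union>K)" if "\<forall>S\<in>K. open S" for K :: "circle set set"
    using that by (simp add: open_circle_def vimage_Union open_UN)
qed

end

lemma continuous_on_circle_of: "continuous_on UNIV circle_of"
  by (auto simp: continuous_on_open_vimage open_circle_def)

lemma measurable_circle_of [measurable]: "circle_of \<in> borel_measurable borel"
  using continuous_on_circle_of by (rule borel_measurable_continuous_onI)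

definition haar_circle :: "circle measure" where
  "haar_circle = distr (restrict_space lborel {0..<1}) borel circle_of"

lift_definition circle_char :: "int \<Rightarrow> circle \<Rightarrow> complex" is "\<lambda>n x. cis (2 * pi * of_int n * x)"
proof -
  fix n :: int and x y :: real
  assume "x - y \<in> \<int>"
  then obtain k where "x - y = of_int k" by (elim Ints_cases)
  then have "x = y + of_int k" by simp
  then have "2 * pi * of_int n * x = 2 * pi * of_int n * y + 2 * pi * of_int (n * k)"
    by (simp add: distrib_left)
  then have "cis (2 * pi * of_int n * x) = cis (2 * pi * of_int n * y) * cis (2 * pi * of_int (n * k))"
    by (simp only: cis_mult)
  then show "cis (2 * pi * of_int n * x) = cis (2 * pi * of_int n * y)"
    by (simp only: cis_multiple_2pi Ints_of_int mult_1_right)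
qed

lemma circle_char_circle_of: "circle_char n (circle_of x) = cis (2 * pi * of_int n * x)"
  by transfer simp

definition fourier_coeff :: "circle measure \<Rightarrow> int \<Rightarrow> complex" where
  "fourier_coeff N n = (\<integral>x. cnj (circle_char n x) \<partial>N)"

lemma fourier_coeff_projection:
  assumes "sets M = sets borel"
  shows "fourier_coeff (distr M borel circle_of) n = fourier_transform M (of_int n)"
proof -
  have [measurable_cong]: "sets M = sets borel" by fact
  have comp: "circle_of -` (circle_char n -` U) = (\<lambda>x. cis (2 * pi * of_int n * x)) -` U" for U
    by (auto simp: circle_char_circle_of)
  have "continuous_on UNIV (\<lambda>x. cis (2 * pi * of_int n * x))"
    by (intro continuous_intros)
  then have cont: "continuous_on UNIV (circle_char n)"
    by (simp add: continuous_on_open_vimage open_circle_def comp)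
  have [measurable]: "(\<lambda>x. cnj (circle_char n x)) \<in> borel_measurable borel"
    by (intro borel_measurable_continuous_onI continuous_on_cnj cont)
  have "fourier_coeff (distr M borel circle_of) n
      = (\<integral>x. cnj (circle_char n (circle_of x)) \<partial>M)"
    unfolding fourier_coeff_def by (rule integral_distr) measurable
  moreover have "cnj (circle_char n (circle_of x)) = iexp (- 2 * pi * of_int n * x)" for x
    by (simp add: circle_char_circle_of cis_conv_exp exp_cnj)
  ultimately show ?thesis by (simp only: fourier_transform_def char_def)
qed

definition conv_op :: "circle measure \<Rightarrow> (circle \<Rightarrow> complex) \<Rightarrow> circle \<Rightarrow> complex" where
  "conv_op N f = (\<lambda>x. \<integral>y. f (x - y) \<partial>N)"

section \<open>Bounded operators on \<open>L\<^sup>p\<close> and their spectrum\<close>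

text \<open>Elements of \<open>L\<^sup>p(M)\<close> are represented by functions, with equality almost everywhere in
  place of equality.  An operator is a map on representatives which is linear up to null sets
  and bounded; applied to \<open>f - g\<close> this forces it to respect almost-everywhere equality, so it
  is the same thing as a bounded linear operator on the quotient space.\<close>

definition Lp_space :: "real \<Rightarrow> 'a measure \<Rightarrow> ('a \<Rightarrow> complex) set" where
  "Lp_space p M = {f \<in> borel_measurable M. integrable M (\<lambda>x. norm (f x) powr p)}"

definition Lp_norm :: "real \<Rightarrow> 'a measure \<Rightarrow> ('a \<Rightarrow> complex) \<Rightarrow> real" where
  "Lp_norm p M f = (\<integral>x. norm (f x) powr p \<partial>M) powr (1 / p)"

definition Lp_bounded_operator ::
    "real \<Rightarrow> 'a measure \<Rightarrow> (('a \<Rightarrow> complex) \<Rightarrow> 'a \<Rightarrow> complex) \<Rightarrow> bool" where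
  "Lp_bounded_operator p M T \<longleftrightarrow>
     (\<forall>f \<in> Lp_space p M. T f \<in> Lp_space p M) \<and>
     (\<forall>f \<in> Lp_space p M. \<forall>g \<in> Lp_space p M. AE x in M. T (\<lambda>x. f x + g x) x = T f x + T g x) \<and>
     (\<forall>c. \<forall>f \<in> Lp_space p M. AE x in M. T (\<lambda>x. c * f x) x = c * T f x) \<and>
     (\<exists>C. \<forall>f \<in> Lp_space p M. Lp_norm p M (T f) \<le> C * Lp_norm p M f)"

text \<open>A scalar \<open>z\<close> lies in the spectrum iff \<open>T - z I\<close> has no two-sided bounded inverse \<open>S\<close>.\<close>

definition Lp_spectrum ::
    "real \<Rightarrow> 'a measure \<Rightarrow> (('a \<Rightarrow> complex) \<Rightarrow> 'a \<Rightarrow> complex) \<Rightarrow> complex set" where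
  "Lp_spectrum p M T =
     {z. \<not> (\<exists>S. Lp_bounded_operator p M S \<and>
        (\<forall>f \<in> Lp_space p M. AE x in M. S (\<lambda>x. T f x - z * f x) x = f x) \<and>
        (\<forall>f \<in> Lp_space p M. AE x in M. T (S f) x - z * S f x = f x))}"

section \<open>Limit points of a sequence\<close>

text \<open>Values are counted with multiplicity: a value attained at infinitely many indices is a
  limit point.\<close>

definition limit_points :: "('i \<Rightarrow> 'b :: topological_space) \<Rightarrow> 'b set" where
  "limit_points a = {z. \<forall>U. open U \<and> z \<in> U \<longrightarrow> infinite {n. a n \<in> U}}"

end

theory Submission
  imports Defs "HOL-Complex_Analysis.Cauchy_Integral_Formula" "HOL-Computational_Algebra.Fundamental_Theorem_Algebra"
begin

text \<open>
  Let \<open>c\<close> be the power series inverse of \<open>B\<close>, where \<open>(1 - \<theta> x) B\<close> is the reciprocal of the minimal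
  polynomial; the Pisot property makes \<open>c\<close> decay geometrically.  Write \<open>2 n / \<theta>\<^sup>k\<close> as an integer plus an
  error. Up to sign, the transform at \<open>n\<close> is the product of the cosines of \<open>\<pi>\<close> times the errors, and the
  errors are the response of an exponentially localized linear filter to a finitely supported sequence of
  bounded integers.  If the product is not small then this sequence has boundedly many nonzero digits.  Digits
  that are far apart contribute nearly independent factors, and a common shift of the digits hardly changes the
  product, so by induction on the number of digits the closure of the set of values is countable.  Multiples of
  the integers \<open>u\<^sub>m \<approx> \<beta> \<theta>\<^sup>m\<close>, the coefficients of \<open>1 / ((1 - \<theta> x) B)\<close>, give nonzero limit points that can be
  made arbitrarily small by Kronecker's theorem, hence infinitely many.

  For the spectrum, a countable compact set \<open>K\<close> has capacity zero: there are nodes \<open>x\<^sub>k\<close> in \<open>K\<close> such that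
  \<open>N\<^sub>k(w) = \<Prod>i<k. (w - x\<^sub>i)\<close> is smaller on \<open>K\<close> than any geometric rate.  By Plancherel, \<open>N\<^sub>k(T)\<close> is that
  small on \<open>L\<^sup>2\<close>; on \<open>L\<^sup>1\<close> and \<open>L\<^sup>\<infinity>\<close> it grows at most geometrically, so interpolation makes it smaller
  than any geometric rate on \<open>L\<^sup>p\<close>.  For \<open>z\<close> outside \<open>K\<close> the Newton interpolation series
  \<open>- (\<Sum>k. N\<^sub>k(T) / N\<^sub>k\<^sub>+\<^sub>1(z))\<close> of \<open>1 / (w - z)\<close> therefore converges on \<open>L\<^sup>p\<close> to the resolvent.
\<close>

section \<open>Fourier transforms of Bernoulli convolutions\<close>

text \<open>Bounding the number of digits does not bound their positions, so infinitely many
  configurations remain. What saves the induction is a dichotomy: digits without a long gap leave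
  finitely many configurations up to a shift, and a long gap puts the value close to a product of
  values with fewer digits. So away from a countable closed set only finitely many values survive.
  Shifts are harmless only far from position 0; hence the induction is run for the shift-invariant
  \<open>Psi\<close> before the true product \<open>Phi\<close>. The filter is localized because
  each factor of the reciprocal polynomial is inverted in its stable direction: 1 - \<theta> x
  forwards in time, \<open>B\<close> backwards through the later digits. Irrationality enters twice:
  it excludes degree 1, and since no positive power of \<theta> is rational, one multiplier
  \<open>b\<close> keeps every cosine of the limiting products nonzero. Interpolation of
  Marcinkiewicz type is enough for the spectrum: its constants depend on the exponent only, and
  decay below every geometric rate on \<open>L^2\<close> absorbs both them and the growth at the
  other endpoint.\<close>

lemma char_convolution:
  assumes "real_distribution M" "real_distribution N"
  shows "char (convolution M N) t = char M t * char N t"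
proof -
  interpret M: real_distribution M by fact
  interpret N: real_distribution N by fact
  interpret pair_prob_space M N ..
  have sets [measurable_cong]: "sets M = sets borel" "sets N = sets borel" by simp_all
  have "char (convolution M N) t = (\<integral>z. iexp (t * (case z of (x, y) \<Rightarrow> x + y)) \<partial>(M \<Otimes>\<^sub>M N))"
    unfolding char_def convolution_def by (rule integral_distr) measurable
  also have "\<dots> = (\<integral>(x, y). iexp (t * x) * iexp (t * y) \<partial>(M \<Otimes>\<^sub>M N))"
    by (intro Bochner_Integration.integral_cong) (auto simp: distrib_left exp_add)
  also have "\<dots> = (\<integral>x. \<integral>y. iexp (t * x) * iexp (t * y) \<partial>N \<partial>M)"
    by (subst integral_fst'[symmetric])
      (auto intro!: integrable_const_bound[where B = 1] simp: norm_mult case_prod_unfold)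
  also have "\<dots> = char M t * char N t"
    by (simp add: char_def)
  finally show ?thesis .
qed

lemma char_two_point: "char (two_point a) t = of_real (cos (t * a))"
proof -
  have "char (two_point a) t
      = (\<integral>b. iexp (t * (if b then a else - a)) \<partial>measure_pmf (bernoulli_pmf (1/2)))"
    unfolding char_def two_point_def by (rule integral_distr) auto
  also have "\<dots> = iexp (t * a) / 2 + iexp (- (t * a)) / 2"
    by (subst integral_measure_pmf[of UNIV]) (auto simp: UNIV_bool scaleR_conv_of_real)
  also have "\<dots> = of_real (cos (t * a))"
    using Euler[of "\<i> * of_real (t * a)"] by (simp add: cos_of_real[symmetric] cos_exp_eq)
  finally show ?thesis .
qed

lemma real_distribution_two_point: "real_distribution (two_point a)"
  unfolding two_point_def by (intro prob_space.real_distribution_distr) (auto simp: measure_pmf.prob_space_axioms)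

lemma real_distribution_convolution:
  assumes "real_distribution M" "real_distribution N"
  shows "real_distribution (convolution M N)"
proof -
  interpret M: real_distribution M by fact
  interpret N: real_distribution N by fact
  interpret pair_prob_space M N ..
  have [measurable_cong]: "sets M = sets borel" "sets N = sets borel" by simp_all
  show ?thesis unfolding convolution_def by (rule real_distribution_distr) measurable
qed

lemma real_distribution_bernoulli_partial: "real_distribution (bernoulli_partial \<theta> n)"
proof (induction n)
  case 0
  show ?case
    by (auto simp: real_distribution_def real_distribution_axioms_def prob_space_return)
next
  case (Suc n)
  then show ?case
    by (simp add: real_distribution_convolution real_distribution_two_point)
qed

lemma char_bernoulli_partial:
  "char (bernoulli_partial \<theta> n) t = of_real (\<Prod>k<n. cos (t / \<theta> ^ k))"
proof (induction n)
  case 0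
  have "char (return borel 0) t = iexp (t * 0)"
    unfolding char_def by (rule integral_return) auto
  then show ?case by simp
next
  case (Suc n)
  then show ?case
    by (simp add: char_convolution real_distribution_bernoulli_partial real_distribution_two_point
        char_two_point divide_inverse power_inverse)
qed

text \<open>Levy's continuity theorem turns weak convergence of the finite convolutions into
  convergence of the cosine products; the sign of the frequency disappears because cosine is even. A
  limit of real numbers is real, so the arithmetic part can work with a real-valued
  \<open>\<phi>\<close>.\<close>

lemma fourier_transform_bernoulli_convolution:
  assumes "\<theta> > 1"
  obtains \<phi> where "\<And>t. fourier_transform (bernoulli_convolution \<theta>) t = of_real (\<phi> t)"
    and "\<And>t. (\<lambda>n. \<Prod>k<n. cos (2 * pi * t / \<theta> ^ k)) \<longlonglongrightarrow> \<phi> t"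
proof -
  define F where "F t = fourier_transform (bernoulli_convolution \<theta>) t" for t
  have lim: "(\<lambda>n. complex_of_real (\<Prod>k<n. cos (2 * pi * t / \<theta> ^ k))) \<longlonglongrightarrow> F t" for t
    using levy_continuity1[OF real_distribution_bernoulli_partial
        bernoulli_convolution_welldef[OF assms], of "- 2 * pi * t"]
    by (simp add: char_bernoulli_partial F_def fourier_transform_def)
  have "F t = of_real (Re (F t))" for t
  proof -
    have "(\<lambda>n. Im (complex_of_real (\<Prod>k<n. cos (2 * pi * t / \<theta> ^ k)))) \<longlonglongrightarrow> Im (F t)"
      using lim by (rule tendsto_Im)
    then have "Im (F t) = 0"
      by (simp add: LIMSEQ_const_iff del: of_real_prod)
    then show ?thesis by (simp add: complex_eq_iff)
  qed
  moreover have "(\<lambda>n. \<Prod>k<n. cos (2 * pi * t / \<theta> ^ k)) \<longlonglongrightarrow> Re (F t)" for t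
    using tendsto_Re[OF lim[of t]] by (simp del: of_real_prod)
  ultimately show thesis
    using that[of "\<lambda>t. Re (F t)"] by (simp add: F_def)
qed

section \<open>Minimal polynomials of Pisot numbers\<close>

text \<open>Gauss's lemma for monic factors: making \<open>q\<close> and \<open>r\<close> primitive
  integer polynomials costs positive integers \<open>m1\<close> and \<open>m2\<close>, and
  multiplicativity of the content forces their product to divide 1.\<close>

lemma monic_rat_int_poly:
  fixes q r :: "rat poly" and P :: "int poly"
  assumes "lead_coeff q = 1" "lead_coeff r = 1" "lead_coeff P = 1"
    and eq: "q * r = map_poly of_int P"
  obtains Q :: "int poly" where "q = map_poly of_int Q" "lead_coeff Q = 1"
proof -
  have clear: "\<exists>m::int. m > 0 \<and> (\<exists>Q. map_poly of_int Q = smult (of_int m) p \<and> content Q = 1)"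
    if lp: "lead_coeff p = 1" for p :: "rat poly"
  proof -
    define S where "S = (\<lambda>i. snd (quotient_of (coeff p i))) ` {..degree p}"
    define m where "m = Lcm S"
    have fin: "finite S" by (simp add: S_def)
    have "s > 0" if "s \<in> S" for s using that quotient_of_denom_pos' by (auto simp: S_def)
    then have "m \<noteq> 0" unfolding m_def using fin by (subst Lcm_0_iff) fastforce+
    then have m0: "m > 0" using Lcm_int_greater_eq_0[of S] unfolding m_def by linarith
    have int: "of_int m * coeff p i \<in> \<int>" for i
    proof (cases "i \<le> degree p")
      case True
      obtain a b where ab: "quotient_of (coeff p i) = (a, b)" by force
      have "b dvd m" unfolding m_def using True ab by (intro dvd_Lcm) (auto simp: S_def image_iff intro!: bexI[of _ i])
      then obtain k where k: "m = b * k" by (elim dvdE)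
      have "coeff p i = of_int a / of_int b" using quotient_of_div[OF ab] .
      moreover have "b \<noteq> 0" using quotient_of_denom_pos[OF ab] by simp
      ultimately have "of_int m * coeff p i = of_int (k * a)" by (simp add: k)
      then show ?thesis by (metis Ints_of_int)
    next
      case False then show ?thesis by (simp add: coeff_eq_0)
    qed
    \<comment> \<open>The floor changes nothing, the scaled coefficients being integers already; it
      only moves them to type \<open>int\<close>.\<close>
    define Q0 where "Q0 = Poly (map (\<lambda>i. \<lfloor>of_int m * coeff p i\<rfloor>) [0..<Suc (degree p)])"
    have Q0: "map_poly of_int Q0 = smult (of_int m) p"
    proof (rule poly_eqI)
      fix i
      show "coeff (map_poly of_int Q0) i = coeff (smult (of_int m) p) i"
        using int[of i] by (auto simp: Q0_def coeff_map_poly nth_default_def coeff_eq_0 simp del: upt_Suc elim!: Ints_cases)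
    qed
    define Q where "Q = primitive_part Q0"
    have Q0Q: "Q0 = smult (content Q0) Q" by (simp add: Q_def)
    have Q0nz: "Q0 \<noteq> 0"
    proof
      assume "Q0 = 0" then have "smult (of_int m) p = 0" using Q0 by simp
      then show False using m0 lp by auto
    qed
    \<comment> \<open>Since \<open>p\<close> is monic, \<open>m\<close> is itself a coefficient of
      \<open>Q0\<close>; so dividing by the content leaves an integral scaling factor
      \<open>m'\<close>.\<close>
    have "coeff Q0 (degree p) = m"
      using arg_cong[OF Q0, of "\<lambda>x. coeff x (degree p)"] lp by (simp add: coeff_map_poly)
    then have "content Q0 dvd m" using content_dvd_coeff by metis
    then obtain m' where m': "m = content Q0 * m'" by (elim dvdE)
    have cp: "content Q0 > 0" using Q0nz
      by (metis content_eq_zero_iff less_le normalize_content abs_ge_zero normalize_int_def)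
    have "m' > 0" using m0 m' cp by (simp add: zero_less_mult_iff)
    moreover have "map_poly of_int Q = smult (of_int m') p"
    proof (rule poly_eqI)
      fix i
      have "of_int (content Q0) * of_int (coeff Q i) = of_int m * coeff p i"
        using arg_cong[OF Q0, of "\<lambda>x. coeff x i"] arg_cong[OF Q0Q, of "\<lambda>x. coeff x i"]
        by (simp add: coeff_map_poly flip: of_int_mult)
      then show "coeff (map_poly of_int Q) i = coeff (smult (of_int m') p) i"
        using m' cp Q0nz by (simp add: coeff_map_poly)
    qed
    moreover have "content Q = 1" unfolding Q_def using Q0nz by (rule content_primitive_part)
    ultimately show ?thesis by blast
  qed
  obtain m1 Q1 where 1: "m1 > 0" "map_poly of_int Q1 = smult (of_int m1) q" "content Q1 = 1"
    using clear[OF assms(1)] by blast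
  obtain m2 Q2 where 2: "m2 > 0" "map_poly of_int Q2 = smult (of_int m2) r" "content Q2 = 1"
    using clear[OF assms(2)] by blast
  have "map_poly of_int (Q1 * Q2) = (map_poly of_int (smult (m1 * m2) P) :: rat poly)"
  proof -
    have "map_poly of_int (Q1 * Q2) = (map_poly of_int Q1 * map_poly of_int Q2 :: rat poly)"
      by (rule poly_eqI) (simp add: coeff_map_poly coeff_mult)
    also have "\<dots> = smult (of_int (m1 * m2)) (map_poly of_int P)"
      by (simp add: 1 2 eq[symmetric] mult_ac)
    also have "\<dots> = map_poly of_int (smult (m1 * m2) P)"
      by (rule poly_eqI) (simp add: coeff_map_poly)
    finally show ?thesis .
  qed
  then have "Q1 * Q2 = smult (m1 * m2) P"
    by (simp add: poly_eq_iff coeff_map_poly flip: of_int_mult)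
  then have "content (smult (m1 * m2) P) = 1"
    using 1(3) 2(3) content_mult[of Q1 Q2] by simp
  then have "\<bar>m1 * m2\<bar> * content P = 1" by simp
  then have "m1 = 1" using 1(1) 2(1)
    by (metis abs_mult mult.assoc abs_of_pos dvd_triv_left zdvd1_eq)
  then have q: "q = map_poly of_int Q1" using 1(2) by simp
  moreover have "lead_coeff Q1 = 1"
    using assms(1) unfolding q by (simp add: degree_map_poly coeff_map_poly)
  ultimately show thesis by (rule that)
qed

lemma map_poly_of_rat_mult:
  "map_poly (of_rat :: rat \<Rightarrow> 'a :: field_char_0) (p * q) = map_poly of_rat p * map_poly of_rat q"
  by (rule poly_eqI) (simp add: coeff_map_poly coeff_mult of_rat_sum of_rat_mult)

lemma map_poly_of_rat_add:
  "map_poly (of_rat :: rat \<Rightarrow> 'a :: field_char_0) (p + q) = map_poly of_rat p + map_poly of_rat q"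
  by (rule poly_eqI) (simp add: coeff_map_poly of_rat_add)

lemma map_poly_of_rat_of_int:
  "map_poly (of_rat :: rat \<Rightarrow> 'a :: field_char_0) (map_poly of_int p) = map_poly of_int p"
  by (rule poly_eqI) (simp add: coeff_map_poly)

lemma of_real_of_rat: "(of_real (of_rat r) :: 'a :: real_field) = of_rat r"
proof -
  obtain a b where ab: "quotient_of r = (a, b)" by force
  show ?thesis unfolding quotient_of_div[OF ab] by (simp add: of_rat_divide)
qed

lemma poly_map_poly_of_rat_of_real:
  "poly (map_poly of_rat p) (of_real x :: 'a :: real_field) = of_real (poly (map_poly of_rat p) x)"
  by (simp add: poly_altdef degree_map_poly coeff_map_poly of_real_of_rat)

text \<open>An annihilating polynomial of least degree, made monic. Division with remainder shows
  that it divides every annihilator, and in a factorization one factor annihilates \<open>x\<close>,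
  so the other has degree 0.\<close>

lemma minimal_rat_poly:
  fixes x :: real
  assumes "algebraic_int x"
  obtains q :: "rat poly" where "lead_coeff q = 1" "irreducible q" "poly (map_poly of_rat q) x = 0"
    and "\<And>s. poly (map_poly of_rat s) x = 0 \<Longrightarrow> q dvd s"
proof -
  define Z where "Z s \<longleftrightarrow> s \<noteq> 0 \<and> poly (map_poly of_rat s) x = 0" for s :: "rat poly"
  obtain p :: "int poly" where p: "poly (map_poly of_int p) x = 0" "lead_coeff p = 1"
    using assms by (auto simp: algebraic_int_altdef_ipoly)
  have "map_poly of_int p \<noteq> (0 :: rat poly)"
    using p(2) by (subst map_poly_eq_0_iff) auto
  then have "Z (map_poly of_int p)" using p by (simp add: Z_def map_poly_of_rat_of_int)
  then obtain q0 where q0: "Z q0" "\<And>s. Z s \<Longrightarrow> degree q0 \<le> degree s"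
    using ex_has_least_nat[of Z "map_poly of_int p" degree] by blast
  define q where "q = smult (inverse (lead_coeff q0)) q0"
  have q0nz: "q0 \<noteq> 0" using q0(1) by (simp add: Z_def)
  have lq: "lead_coeff q = 1" using q0nz by (simp add: q_def)
  have dq: "degree q = degree q0" using q0nz by (simp add: q_def)
  have "map_poly of_rat q = smult (of_rat (inverse (lead_coeff q0))) (map_poly of_rat q0 :: real poly)"
    by (rule poly_eqI) (simp add: q_def coeff_map_poly of_rat_mult)
  then have qx: "poly (map_poly of_rat q) x = 0" using q0(1) by (simp add: Z_def)
  have qnz: "q \<noteq> 0" using lq by auto
  have min: "degree q \<le> degree s" if "s \<noteq> 0" "poly (map_poly of_rat s) x = 0" for s
    using q0(2)[of s] that dq by (simp add: Z_def)
  have dvd: "q dvd s" if "poly (map_poly of_rat s) x = 0" for s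
  proof (rule ccontr)
    assume "\<not> q dvd s"
    then have "s mod q \<noteq> 0" by (simp add: dvd_eq_mod_eq_0)
    moreover have "map_poly of_rat s = map_poly of_rat (s div q) * map_poly of_rat q + (map_poly of_rat (s mod q) :: real poly)"
      by (simp flip: map_poly_of_rat_mult map_poly_of_rat_add)
    then have "poly (map_poly of_rat (s mod q)) x = 0" using that qx by simp
    ultimately have "degree q \<le> degree (s mod q)" by (rule min)
    then show False using degree_mod_less[OF qnz, of s] \<open>s mod q \<noteq> 0\<close> by auto
  qed
  have "degree q \<noteq> 0"
  proof
    assume "degree q = 0"
    then obtain a where a: "q = [:a:]" by (rule degree_eq_zeroE)
    then have "a = 1" using lq by simp
    then show False using qx a by (simp add: map_poly_pCons)
  qed
  then have "\<not> is_unit q" using qnz by (auto simp: is_unit_iff_degree)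
  have irr: "irreducible q"
  proof (rule irreducibleI)
    fix a b assume ab: "q = a * b"
    then have nz: "a \<noteq> 0" "b \<noteq> 0" using qnz by auto
    then have deg: "degree q = degree a + degree b" by (simp add: ab degree_mult_eq)
    have "poly (map_poly of_rat a) x = 0 \<or> poly (map_poly of_rat b) x = 0"
      using qx by (simp add: ab map_poly_of_rat_mult)
    then have "degree q \<le> degree a \<or> degree q \<le> degree b" using min nz by blast
    then have "degree b = 0 \<or> degree a = 0" using deg by auto
    then show "is_unit a \<or> is_unit b" using nz by (auto simp: is_unit_iff_degree)
  qed fact+
  from lq irr qx dvd show thesis by (rule that)
qed

lemma pisot_int_poly:
  assumes "pisot \<theta>" and "\<theta> \<notin> \<rat>"
  obtains P :: "int poly"
  where "lead_coeff P = 1" and "poly (map_poly of_int P) \<theta> = 0"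
    and "poly (map_poly of_int (pderiv P)) \<theta> \<noteq> 0"
    and "\<And>z :: complex. poly (map_poly of_int P) z = 0 \<Longrightarrow> z = of_real \<theta> \<or> norm z < 1"
    and "\<And>j. j > 0 \<Longrightarrow> \<theta> ^ j \<notin> \<rat>"
proof -
  have th: "\<theta> > 1" "algebraic_int \<theta>" using assms by (auto simp: pisot_def)
  obtain q :: "rat poly" where q: "lead_coeff q = 1" "irreducible q" "poly (map_poly of_rat q) \<theta> = 0"
    and dvd: "\<And>s. poly (map_poly of_rat s) \<theta> = 0 \<Longrightarrow> q dvd s"
    using minimal_rat_poly[of \<theta>] th(2) by blast
  obtain P0 :: "int poly" where P0: "lead_coeff P0 = 1" "poly (map_poly of_int P0) \<theta> = 0"
    using th(2) by (auto simp: algebraic_int_altdef_ipoly)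
  have "q dvd map_poly of_int P0" using P0 by (intro dvd) (simp add: map_poly_of_rat_of_int)
  then obtain r where r: "map_poly of_int P0 = q * r" by (elim dvdE)
  have "lead_coeff (map_poly of_int P0 :: rat poly) = 1" using P0 by (simp add: degree_map_poly coeff_map_poly)
  then have "lead_coeff r = 1" using q(1) by (simp add: r lead_coeff_mult)
  then obtain P :: "int poly" where P: "q = map_poly of_int P" "lead_coeff P = 1"
    using monic_rat_int_poly[OF q(1) _ P0(1) r[symmetric]] by blast
  have conj: "z = of_real \<theta> \<or> norm z < 1" if "poly (map_poly of_rat q) z = 0" for z :: complex
  proof -
    have "poly (map_poly of_rat q) (complex_of_real \<theta>) = 0"
      by (simp add: poly_map_poly_of_rat_of_real q(3))
    then have "conjugate_over_rat (of_real \<theta>) z" using q that by (auto simp: conjugate_over_rat_def)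
    then show ?thesis using assms(1) by (auto simp: pisot_def)
  qed
  \<comment> \<open>A linear minimal polynomial would make \<theta> rational. The bound also
    supplies the second root used in \<open>irrat\<close>.\<close>
  have degq: "degree q \<ge> 2"
  proof (rule ccontr)
    assume "\<not> degree q \<ge> 2"
    moreover have "degree q \<noteq> 0" using q(2) by (metis is_unit_iff_degree irreducible_def)
    ultimately have "degree q = 1" by simp
    then have "q = [:coeff q 0, 1:]"
      using q(1) by (intro poly_eqI) (auto simp: coeff_pCons coeff_eq_0 split: nat.split)
    then obtain a where "q = [:a, 1:]" by blast
    then have "\<theta> = of_rat (- a)" using q(3) by (simp add: map_poly_pCons of_rat_minus)
    then show False using assms(2) by (simp add: Rats_def)
  qed
  have simple: "poly (map_poly of_rat (pderiv q)) \<theta> \<noteq> 0"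
  proof
    assume "poly (map_poly of_rat (pderiv q)) \<theta> = 0"
    then have "q dvd pderiv q" by (rule dvd)
    moreover have "pderiv q \<noteq> 0" using degq by (simp add: pderiv_eq_0_iff)
    ultimately have "degree q \<le> degree (pderiv q)" by (rule dvd_imp_degree_le)
    then show False using degq by (simp add: degree_pderiv)
  qed
  have pd: "pderiv q = map_poly of_int (pderiv P)"
    by (rule poly_eqI) (simp add: P(1) coeff_map_poly coeff_pderiv)
  \<comment> \<open>If \<theta>^j were a rational \<open>a\<close>, the minimal polynomial would
    divide X^j - a, so a further root \<open>z\<close> would have modulus \<theta> > 1. The Pisot
    property then forces z = \<theta>, a double root, against separability.\<close>
  have irrat: "\<theta> ^ j \<notin> \<rat>" if j: "j > 0" for j
  proof
    assume "\<theta> ^ j \<in> \<rat>"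
    then obtain a where a: "\<theta> ^ j = of_rat a" by (auto simp: Rats_def)
    define s :: "rat poly" where "s = monom 1 j - [:a:]"
    have ms: "map_poly of_rat s = (monom 1 j - [:of_rat a:] :: 'b :: field_char_0 poly)"
      by (rule poly_eqI) (auto simp: s_def coeff_map_poly of_rat_diff coeff_pCons split: nat.split)
    have "q dvd s" using a by (intro dvd) (simp add: ms poly_monom)
    then obtain u where u: "s = q * u" by (elim dvdE)
    obtain S where S: "map_poly of_rat q = [:- complex_of_real \<theta>, 1:] * S"
      using q(3) poly_map_poly_of_rat_of_real[of q \<theta>] by (metis dvdE of_real_0 poly_eq_0_iff_dvd)
    have "map_poly of_rat q \<noteq> (0 :: complex poly)"
      using degq by (subst map_poly_eq_0_iff) auto
    then have Snz: "S \<noteq> 0" unfolding S by auto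
    have "degree (map_poly of_rat q :: complex poly) = degree q" by (simp add: degree_map_poly)
    then have "degree S \<noteq> 0" using degq Snz unfolding S by (subst (asm) degree_mult_eq) auto
    then obtain z where z: "poly S z = 0" using alg_closed_imp_poly_has_root[of S] by auto
    have qz: "poly (map_poly of_rat q) z = 0" by (simp add: S z)
    then have "poly (map_poly of_rat s) z = 0" by (simp add: u map_poly_of_rat_mult)
    then have "z ^ j = of_rat a" by (simp add: ms poly_monom)
    then have "z ^ j = of_real (\<theta> ^ j)" unfolding a by (simp add: of_real_of_rat)
    then have "norm z ^ j = \<theta> ^ j" using th(1) by (metis norm_of_real norm_power abs_of_pos zero_less_power less_trans zero_less_one)
    then have "norm z = \<theta>" using j th(1) power_eq_imp_eq_base[of "norm z" j \<theta>] by simp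
    then have "z = of_real \<theta>" using conj[OF qz] th(1) by auto
    then have "poly S (of_real \<theta>) = 0" using z by simp
    moreover have "pderiv (map_poly of_rat q) = (map_poly of_rat (pderiv q) :: complex poly)"
      by (rule poly_eqI) (simp add: coeff_map_poly coeff_pderiv of_rat_mult of_rat_add)
    moreover have "pderiv [:- complex_of_real \<theta>, 1:] = 1" by (simp add: pderiv_pCons)
    then have "poly (pderiv ([:- complex_of_real \<theta>, 1:] * S)) (of_real \<theta>) = poly S (of_real \<theta>)"
      by (simp only: pderiv_mult) simp
    ultimately have "poly (map_poly of_rat (pderiv q)) (complex_of_real \<theta>) = 0"
      unfolding S by simp
    then show False using simple by (simp add: poly_map_poly_of_rat_of_real)
  qed
  show thesis
  proof (rule that[of P])
    show "poly (map_poly of_int P) \<theta> = 0" using q(3) by (simp add: P(1) map_poly_of_rat_of_int)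
    show "poly (map_poly of_int (pderiv P)) \<theta> \<noteq> 0" using simple by (simp add: pd map_poly_of_rat_of_int)
    show "z = of_real \<theta> \<or> norm z < 1" if "poly (map_poly of_int P) z = 0" for z :: complex
      using conj[of z] that by (simp add: P(1) map_poly_of_rat_of_int)
  qed (use P irrat in auto)
qed

text \<open>With all roots outside the closed unit disc, 1/B is analytic on a disc of radius
  \<open>R\<close> > 1; convergence of its series at some r between 1 and \<open>R\<close> bounds
  the coefficients by a multiple of r^(-n).\<close>

lemma inverse_poly_geometric_decay:
  fixes B :: "real poly"
  assumes B0: "coeff B 0 = 1" and roots: "\<And>z :: complex. poly (map_poly of_real B) z = 0 \<Longrightarrow> norm z > 1"
  obtains C \<rho> where "C > 0" "0 < \<rho>" "\<rho> < 1"
    and "\<And>n. \<bar>fps_nth (inverse (fps_of_poly B)) n\<bar> \<le> C * \<rho> ^ n"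
proof -
  define Bc :: "complex poly" where "Bc = map_poly of_real B"
  define Z where "Z = {z. poly Bc z = 0}"
  have "coeff Bc 0 = 1" by (simp add: Bc_def coeff_map_poly B0)
  then have "Bc \<noteq> 0" by auto
  then have finZ: "finite Z" unfolding Z_def by (rule poly_roots_finite)
  \<comment> \<open>The 2 caps the radius, so that the minimum exists also when there are no
    roots.\<close>
  define R where "R = Min (insert 2 (norm ` Z))"
  have R1: "R > 1" using finZ roots by (auto simp: R_def Z_def Bc_def)
  have noroot: "eval_fps (fps_of_poly Bc) z \<noteq> 0" if "ereal (norm z) < ereal R" for z
  proof
    assume "eval_fps (fps_of_poly Bc) z = 0"
    then have "z \<in> Z" by (simp add: Z_def)
    then have "R \<le> norm z" unfolding R_def using finZ by (intro Min_le) auto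
    then show False using that by simp
  qed
  have rad: "fps_conv_radius (inverse (fps_of_poly Bc)) \<ge> ereal R"
    using fps_conv_radius_inverse[of "ereal R" "fps_of_poly Bc"] noroot by simp
  obtain r where r: "1 < r" "r < R" using R1 dense by blast
  have "summable (\<lambda>n. fps_nth (inverse (fps_of_poly Bc)) n * of_real r ^ n)"
    by (rule summable_fps, rule less_le_trans[OF _ rad]) (use r in simp)
  then have "bounded (range (\<lambda>n. fps_nth (inverse (fps_of_poly Bc)) n * of_real r ^ n))"
    by (intro convergent_imp_bounded convergentI) (rule summable_LIMSEQ_zero)
  then obtain C where C: "C > 0" "\<And>n. norm (fps_nth (inverse (fps_of_poly Bc)) n * of_real r ^ n) \<le> C"
    unfolding bounded_pos by blast
  \<comment> \<open>Uniqueness of inverses identifies the complex inverse series with the real one,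
    coefficient by coefficient.\<close>
  define F where "F = Abs_fps (\<lambda>n. complex_of_real (fps_nth (inverse (fps_of_poly B)) n))"
  have inv: "inverse (fps_of_poly B) * fps_of_poly B = 1"
    by (rule inverse_mult_eq_1) (simp add: B0)
  have "F * fps_of_poly Bc = 1"
  proof (rule fps_ext)
    fix n
    have "fps_nth (F * fps_of_poly Bc) n = of_real (fps_nth (inverse (fps_of_poly B) * fps_of_poly B) n)"
      by (simp add: fps_mult_nth F_def Bc_def coeff_map_poly)
    then show "fps_nth (F * fps_of_poly Bc) n = fps_nth 1 n" by (simp add: inv)
  qed
  then have "F = inverse (fps_of_poly Bc)" by (metis fps_inverse_unique mult.commute)
  then have nF: "norm (fps_nth (inverse (fps_of_poly Bc)) n) = \<bar>fps_nth (inverse (fps_of_poly B)) n\<bar>" for n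
    by (metis F_def fps_nth_Abs_fps norm_of_real)
  show thesis
  proof (rule that[of C "1 / r"])
    fix n
    have "\<bar>fps_nth (inverse (fps_of_poly B)) n\<bar> * r ^ n \<le> C"
      using C(2)[of n] r by (simp add: norm_mult norm_power nF)
    then show "\<bar>fps_nth (inverse (fps_of_poly B)) n\<bar> \<le> C * (1 / r) ^ n"
      using r by (simp add: field_simps)
  qed (use C r in auto)
qed

text \<open>Reversing coefficients inverts the roots: conjugates inside the unit disc become roots
  of \<open>B\<close> outside it, \<theta> becomes the factor 1 - \<theta> x, and monicity becomes
  constant coefficient 1.\<close>

lemma pisot_reciprocal_data:
  assumes "pisot \<theta>" and "\<theta> \<notin> \<rat>"
  obtains A :: "int poly" and B :: "real poly" and c :: "nat \<Rightarrow> real" and C \<rho> :: real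
  where "coeff A 0 = 1" and "map_poly of_int A = [:1, - \<theta>:] * B"
    and "fps_of_poly B * Abs_fps c = 1"
    and "0 < \<rho>" "\<rho> < 1" "1 / \<theta> \<le> \<rho>" and "C > 0" and "\<And>n. \<bar>c n\<bar> \<le> C * \<rho> ^ n"
    and "\<And>j. j > 0 \<Longrightarrow> \<theta> ^ j \<notin> \<rat>"
proof -
  have th: "\<theta> > 1" using assms by (auto simp: pisot_def)
  obtain P :: "int poly"
    where P: "lead_coeff P = 1" "poly (map_poly of_int P) \<theta> = 0"
    and P': "poly (map_poly of_int (pderiv P)) \<theta> \<noteq> 0"
    and conj: "\<And>z :: complex. poly (map_poly of_int P) z = 0 \<Longrightarrow> z = of_real \<theta> \<or> norm z < 1"
    and irr: "\<And>j. j > 0 \<Longrightarrow> \<theta> ^ j \<notin> \<rat>"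
    using pisot_int_poly[OF assms] by blast
  obtain Q where Q: "map_poly real_of_int P = [:- \<theta>, 1:] * Q"
    using P(2) by (metis dvdE poly_eq_0_iff_dvd)
  have lQ: "lead_coeff Q = 1"
  proof -
    have "lead_coeff (map_poly real_of_int P) = 1" using P(1) by (simp add: degree_map_poly coeff_map_poly)
    then show ?thesis unfolding Q lead_coeff_mult by simp
  qed
  define B where "B = reflect_poly Q"
  have B0: "coeff B 0 = 1" using lQ by (simp add: B_def)
  have A: "map_poly of_int (reflect_poly P) = [:1, - \<theta>:] * B"
  proof -
    have "map_poly of_int (reflect_poly P) = reflect_poly (map_poly real_of_int P)"
      by (rule poly_eqI) (simp add: coeff_map_poly coeff_reflect_poly degree_map_poly)
    also have "\<dots> = reflect_poly [:- \<theta>, 1:] * B" by (simp only: Q reflect_poly_mult B_def)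
    also have "reflect_poly [:- \<theta>, 1:] = [:1, - \<theta>:]"
      using th by (simp add: reflect_poly_def cCons_def)
    finally show ?thesis .
  qed
  have Qth: "poly Q \<theta> \<noteq> 0"
  proof
    assume "poly Q \<theta> = 0"
    moreover have "pderiv (map_poly real_of_int P) = map_poly of_int (pderiv P)"
      by (rule poly_eqI) (simp add: coeff_map_poly coeff_pderiv)
    moreover have "pderiv [:- \<theta>, 1:] = 1" by (simp add: pderiv_pCons)
    then have "poly (pderiv ([:- \<theta>, 1:] * Q)) \<theta> = poly Q \<theta>"
      by (simp only: pderiv_mult) simp
    ultimately show False using P' unfolding Q by simp
  qed
  have roots: "norm z > 1" if "poly (map_poly of_real B) z = 0" for z :: complex
  proof -
    have B': "map_poly of_real B = reflect_poly (map_poly complex_of_real Q)"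
      by (rule poly_eqI) (simp add: B_def coeff_map_poly coeff_reflect_poly degree_map_poly)
    have z0: "z \<noteq> 0"
    proof
      assume "z = 0"
      then show False using that lQ by (simp add: B' degree_map_poly coeff_map_poly)
    qed
    then have Qz: "poly (map_poly complex_of_real Q) (inverse z) = 0"
      using that by (simp add: B' poly_reflect_poly_nz)
    have "map_poly complex_of_int P = [:- of_real \<theta>, 1:] * map_poly of_real Q"
    proof (rule poly_eqI)
      fix n
      have "complex_of_real (coeff (map_poly real_of_int P) n) = of_real (coeff ([:- \<theta>, 1:] * Q) n)"
        by (simp only: Q)
      then show "coeff (map_poly complex_of_int P) n = coeff ([:- of_real \<theta>, 1:] * map_poly of_real Q) n"
        by (cases n) (simp_all add: coeff_map_poly)
    qed
    then have "poly (map_poly complex_of_int P) (inverse z) = 0" using Qz by simp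
    then have "inverse z = of_real \<theta> \<or> norm (inverse z) < 1" by (rule conj)
    \<comment> \<open>\<open>Q\<close> does not vanish at \<theta>, a simple root of
      \<open>P\<close>; this excludes the only conjugate outside the disc.\<close>
    moreover have "inverse z \<noteq> of_real \<theta>"
    proof
      assume "inverse z = of_real \<theta>"
      moreover have "poly (map_poly complex_of_real Q) (of_real \<theta>) = of_real (poly Q \<theta>)"
        by (simp add: poly_altdef degree_map_poly coeff_map_poly)
      ultimately show False using Qz Qth by simp
    qed
    ultimately have "inverse (norm z) < 1" by (simp add: norm_inverse)
    then show ?thesis using z0 by (simp add: inverse_less_1_iff)
  qed
  obtain C \<rho> where C: "C > 0" "0 < \<rho>" "\<rho> < 1"
    "\<And>n. \<bar>fps_nth (inverse (fps_of_poly B)) n\<bar> \<le> C * \<rho> ^ n"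
    using inverse_poly_geometric_decay[OF B0 roots] by blast
  define c where "c = fps_nth (inverse (fps_of_poly B))"
  show thesis
  \<comment> \<open>The rate is raised to at least 1/\<theta> so that one \<open>\<rho>\<close>
    governs the decay on both sides of a digit.\<close>
  proof (rule that[of "reflect_poly P" B c "max \<rho> (1 / \<theta>)" C])
    show "coeff (reflect_poly P) 0 = 1" using P(1) by simp
    show "map_poly of_int (reflect_poly P) = [:1, - \<theta>:] * B" by fact
    have "Abs_fps c = inverse (fps_of_poly B)" by (simp add: c_def fps_eq_iff)
    then show "fps_of_poly B * Abs_fps c = 1"
      using inverse_mult_eq_1[of "fps_of_poly B"] B0 by (simp add: mult.commute)
    show "\<bar>c n\<bar> \<le> C * max \<rho> (1 / \<theta>) ^ n" for n
    proof -
      have "\<bar>c n\<bar> \<le> C * \<rho> ^ n" using C(4) by (simp add: c_def)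
      also have "\<dots> \<le> C * max \<rho> (1 / \<theta>) ^ n"
        using C(1,2) by (intro mult_left_mono power_mono) auto
      finally show ?thesis .
    qed
  qed (use C th irr in auto)
qed

section \<open>Cosine products over finitely supported digit sequences\<close>

lemma sum_power_le:
  fixes x :: real
  assumes "0 \<le> x" "x < 1"
  shows "(\<Sum>i<n. x ^ i) \<le> 1 / (1 - x)"
  using one_diff_power_eq[of x n] assms by (simp add: field_simps)

lemma abs_cos_diff_le: "\<bar>cos x - cos y\<bar> \<le> \<bar>x - y\<bar>" for x y :: real
proof -
  have "\<bar>cos x - cos y\<bar> = 2 * \<bar>sin ((x + y) / 2)\<bar> * \<bar>sin ((y - x) / 2)\<bar>"
    by (simp add: cos_diff_cos abs_mult)
  also have "\<dots> \<le> 2 * 1 * \<bar>(y - x) / 2\<bar>"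
    by (intro mult_mono abs_sin_x_le_abs_x) auto
  also have "\<dots> = \<bar>x - y\<bar>" by (simp add: abs_minus_commute)
  finally show ?thesis .
qed

lemma abs_abs_cos_diff_le: "\<bar>\<bar>cos x\<bar> - \<bar>cos y\<bar>\<bar> \<le> \<bar>x - y\<bar>" for x y :: real
  using abs_cos_diff_le[of x y] by linarith

text \<open>By the addition formula the defect is sin x sin y, of second order in the two
  perturbations; this is what makes distant groups of digits nearly independent.\<close>

lemma abs_cos_add_le: "\<bar>\<bar>cos (x + y)\<bar> - \<bar>cos x\<bar> * \<bar>cos y\<bar>\<bar> \<le> \<bar>x\<bar> * \<bar>y\<bar>" for x y :: real
proof -
  have "\<bar>\<bar>cos (x + y)\<bar> - \<bar>cos x\<bar> * \<bar>cos y\<bar>\<bar> \<le> \<bar>cos (x + y) - cos x * cos y\<bar>"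
    by (simp flip: abs_mult)
  also have "\<dots> = \<bar>sin x\<bar> * \<bar>sin y\<bar>" by (simp add: cos_add abs_mult)
  also have "\<dots> \<le> \<bar>x\<bar> * \<bar>y\<bar>" by (intro mult_mono abs_sin_x_le_abs_x) auto
  finally show ?thesis .
qed

text \<open>Off \<open>Q\<close> the set \<open>A\<close> is a countable union of finite sets. A
  point off \<open>Q\<close> has positive distance from the closed set \<open>Q\<close>, so
  \<open>A\<close> cannot accumulate there, and the closure adds only points of
  \<open>Q\<close>.\<close>

lemma countable_closure_if_finite_away:
  fixes A Q :: "real set"
  assumes Q: "closed Q" "countable Q"
    and fin: "\<And>\<eta>. \<eta> > 0 \<Longrightarrow> finite {a \<in> A. \<forall>q\<in>Q. \<eta> \<le> \<bar>a - q\<bar>}"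
  shows "countable (closure A)"
proof -
  define F where "F \<eta> = {a \<in> A. \<forall>q\<in>Q. \<eta> \<le> \<bar>a - q\<bar>}" for \<eta>
  have sep: "\<exists>\<eta>>0. \<forall>q\<in>Q. \<eta> \<le> \<bar>z - q\<bar>" if z: "z \<notin> Q" for z
  proof -
    have "open (- Q)" using Q(1) by (simp add: open_Compl)
    then obtain \<eta> where "\<eta> > 0" "ball z \<eta> \<subseteq> - Q"
      by (elim openE[where x = z]) (use z in auto)
    then show ?thesis by (intro exI[of _ \<eta>]) (force simp: dist_real_def)
  qed
  have "A \<subseteq> Q \<union> (\<Union>n. F (1 / Suc n))"
  proof
    fix a assume a: "a \<in> A"
    show "a \<in> Q \<union> (\<Union>n. F (1 / Suc n))"
    proof (cases "a \<in> Q")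
      case False
      then obtain \<eta> where \<eta>: "\<eta> > 0" "\<forall>q\<in>Q. \<eta> \<le> \<bar>a - q\<bar>" using sep by blast
      obtain n where "1 / Suc n < \<eta>" using \<eta>(1) nat_approx_posE by metis
      then have "a \<in> F (1 / Suc n)" using a \<eta>(2) by (force simp: F_def)
      then show ?thesis by blast
    qed simp
  qed
  moreover have "countable (F (1 / Suc n))" for n
    unfolding F_def by (intro countable_finite fin) simp
  then have "countable (Q \<union> (\<Union>n. F (1 / Suc n)))" using Q(2) by (intro countable_Un countable_UN) auto
  ultimately have "countable A" by (rule countable_subset)
  moreover have "closure A \<subseteq> A \<union> Q"
  proof
    fix z assume z: "z \<in> closure A"
    show "z \<in> A \<union> Q"
    proof (cases "z \<in> Q")
      case False
      then obtain \<eta> where \<eta>: "\<eta> > 0" "\<forall>q\<in>Q. \<eta> \<le> \<bar>z - q\<bar>" using sep by blast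
      \<comment> \<open>Points of \<open>A\<close> within \<eta>/2 of \<open>z\<close> still keep
        distance \<eta>/2 from \<open>Q\<close>, so they belong to one finite, hence closed,
        set.\<close>
      have "z \<in> closure (F (\<eta> / 2))"
        unfolding closure_approachable
      proof (intro allI impI)
        fix e :: real assume "e > 0"
        then obtain a where a: "a \<in> A" "dist a z < min e (\<eta> / 2)"
          using z \<eta>(1) unfolding closure_approachable by (metis half_gt_zero min_less_iff_conj)
        have "\<eta> / 2 \<le> \<bar>a - q\<bar>" if "q \<in> Q" for q
        proof -
          have "\<eta> \<le> \<bar>z - q\<bar>" using \<eta>(2) that by blast
          then show ?thesis using a(2) unfolding dist_real_def by linarith
        qed
        then show "\<exists>a\<in>F (\<eta> / 2). dist a z < e" using a by (auto simp: F_def)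
      qed
      moreover have "finite (F (\<eta> / 2))" unfolding F_def using \<eta>(1) by (intro fin) simp
      ultimately have "z \<in> F (\<eta> / 2)" by (simp add: finite_imp_closed closure_closed)
      then show ?thesis by (simp add: F_def)
    qed simp
  qed
  ultimately show ?thesis using Q(2) by (meson countable_Un countable_subset)
qed

text \<open>If no two consecutive elements are more than \<open>B\<close> apart, everything stays
  near the minimum; otherwise \<open>b\<close> is the last element before a long gap. The induction
  adds a new largest element.\<close>

lemma finite_nat_set_gap:
  fixes S :: "nat set"
  assumes "finite S" "S \<noteq> {}"
  shows "(\<forall>x\<in>S. x \<le> Min S + card S * B) \<or>
    (\<exists>b\<in>S. (\<exists>y\<in>S. b + B < y) \<and> (\<forall>x\<in>S. x \<le> b \<or> b + B < x))"
  using assms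
proof (induction S rule: finite_linorder_max_induct)
  case (insert b A)
  show ?case
  proof (cases "A = {}")
    case False
    let ?M = "Max A"
    have M: "?M \<in> A" "\<And>x. x \<in> A \<Longrightarrow> x \<le> ?M" using insert.hyps(1) False by auto
    have min: "Min (insert b A) = Min A"
    proof -
      have "Min A < b" using insert.hyps Min_in[OF _ False] by blast
      then show ?thesis using insert.hyps(1) False by (metis Min_insert min_absorb2 less_imp_le)
    qed
    have card: "card (insert b A) = Suc (card A)" using insert.hyps by (subst card_insert_disjoint) auto
    consider (bdd) "\<forall>x\<in>A. x \<le> Min A + card A * B"
      | (gap) "\<exists>b\<in>A. (\<exists>y\<in>A. b + B < y) \<and> (\<forall>x\<in>A. x \<le> b \<or> b + B < x)"
      using insert.IH False by blast
    then show ?thesis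
    proof cases
      case bdd
      show ?thesis
      proof (cases "b \<le> ?M + B")
        case True
        then have "b \<le> Min A + Suc (card A) * B" using bdd M(1) by fastforce
        then show ?thesis using bdd unfolding min card by (auto simp: algebra_simps intro: trans_le_add2)
      next
        case False
        then show ?thesis using M by (intro disjI2 bexI[of _ ?M]) auto
      qed
    next
      case gap
      then obtain b0 y where *: "b0 \<in> A" "y \<in> A" "b0 + B < y" "\<forall>x\<in>A. x \<le> b0 \<or> b0 + B < x" by blast
      moreover have "b0 + B < b" using * insert.hyps(2) by fastforce
      ultimately show ?thesis by (intro disjI2 bexI[of _ b0] conjI bexI[of _ y]) auto
    qed
  qed simp
qed simp

section \<open>Finitely supported digit sequences with a prescribed number of nonzero digits\<close>

definition supp :: "(nat \<Rightarrow> int) \<Rightarrow> nat set" where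
  "supp t = {a. t a \<noteq> 0}"

definition shift_digits :: "nat \<Rightarrow> (nat \<Rightarrow> int) \<Rightarrow> nat \<Rightarrow> int" where
  "shift_digits j t a = (if a < j then 0 else t (a - j))"

text \<open>The number of nonzero digits is exact because it is the induction parameter; the
  positions stay unrestricted, since nothing in the arithmetic bounds them.\<close>

definition configs :: "int \<Rightarrow> nat \<Rightarrow> (nat \<Rightarrow> int) set" where
  "configs D m = {t. finite (supp t) \<and> card (supp t) = m \<and> (\<forall>a. \<bar>t a\<bar> \<le> D)}"

lemma configs_nonneg:
  assumes "t \<in> configs D m"
  shows "0 \<le> D"
proof -
  have "\<bar>t 0\<bar> \<le> D" using assms by (simp add: configs_def)
  then show ?thesis by linarith
qed

lemma supp_shift: "supp (shift_digits j t) = (\<lambda>a. a + j) ` supp t"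
proof -
  have "a \<in> (\<lambda>a. a + j) ` supp t" if "a \<in> supp (shift_digits j t)" for a
    using that by (intro image_eqI[of _ _ "a - j"]) (auto simp: supp_def shift_digits_def split: if_splits)
  then show ?thesis by (auto simp: supp_def shift_digits_def)
qed

lemma configs_shift: "t \<in> configs D m \<Longrightarrow> shift_digits j t \<in> configs D m"
  by (auto simp: configs_def supp_shift card_image shift_digits_def intro: order_trans[OF abs_ge_zero])

lemma shift_Suc: "shift_digits (Suc j) t = shift_digits 1 (shift_digits j t)"
proof
  fix a show "shift_digits (Suc j) t a = shift_digits 1 (shift_digits j t) a"
    by (cases a) (auto simp: shift_digits_def)
qed

lemma shift_0 [simp]: "shift_digits 0 t = t"
  by (auto simp: shift_digits_def)

lemma finite_configs_bounded: "finite {t \<in> configs D m. supp t \<subseteq> {..N}}"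
proof (rule finite_subset)
  show "{t \<in> configs D m. supp t \<subseteq> {..N}}
    \<subseteq> {t. \<forall>a. (a \<in> {..N} \<longrightarrow> t a \<in> {- D..D}) \<and> (a \<notin> {..N} \<longrightarrow> t a = 0)}"
    by (auto simp: configs_def supp_def abs_le_iff minus_le_iff)
  show "finite {t. \<forall>a. (a \<in> {..N} \<longrightarrow> t a \<in> {- D..D}) \<and> (a \<notin> {..N} \<longrightarrow> t a = 0)}"
    by (rule finite_set_of_finite_funs) auto
qed

text \<open>Both halves are nonempty, with \<open>b\<close> in the lower and \<open>y\<close> in the
  upper one, so each has strictly fewer digits, as the induction on \<open>m\<close>
  requires.\<close>

lemma configs_split:
  assumes "t \<in> configs D m" "b \<in> supp t" "y \<in> supp t" "b < y"
  obtains l r tl tr where "l < m" "r < m" "tl \<in> configs D l" "tr \<in> configs D r"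
    "supp tl = {a \<in> supp t. a \<le> b}" "supp tr = {a \<in> supp t. b < a}" "t = (\<lambda>a. tl a + tr a)"
proof -
  define tl where "tl a = (if a \<le> b then t a else 0)" for a
  define tr where "tr a = (if b < a then t a else 0)" for a
  have s: "supp tl = {a \<in> supp t. a \<le> b}" "supp tr = {a \<in> supp t. b < a}"
    by (auto simp: supp_def tl_def tr_def)
  have fin: "finite (supp t)" and m: "card (supp t) = m" using assms by (auto simp: configs_def)
  have "supp tl \<subseteq> supp t" "y \<notin> supp tl" "supp tr \<subseteq> supp t" "b \<notin> supp tr"
    using assms(4) by (auto simp: s)
  then have "supp tl \<subset> supp t" "supp tr \<subset> supp t" using assms(2,3) by blast+
  then have "card (supp tl) < m" "card (supp tr) < m" using fin m psubset_card_mono by blast+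
  moreover have "tl \<in> configs D (card (supp tl))" "tr \<in> configs D (card (supp tr))"
    using assms(1) by (auto simp: configs_def s tl_def tr_def intro: order_trans[OF abs_ge_zero])
  moreover have "t = (\<lambda>a. tl a + tr a)" by (auto simp: tl_def tr_def)
  ultimately show thesis using that s by blast
qed

section \<open>Filter responses, their cosine products, and how these react to splitting and
  shifting\<close>

locale decaying_response =
  fixes \<theta> \<rho> C :: real and c :: "nat \<Rightarrow> real"
  assumes theta: "\<theta> > 1" and rho: "0 < \<rho>" "\<rho> < 1" "1 / \<theta> \<le> \<rho>"
    and C: "C > 0" and c_le: "\<And>n. \<bar>c n\<bar> \<le> C * \<rho> ^ n"
begin

text \<open>\<open>h a\<close> is the response of the filter to a unit digit at position \<open>a\<close>.\<close>

definition h :: "nat \<Rightarrow> nat \<Rightarrow> real" where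
  "h a k = (\<Sum>i<k. if i \<le> a then c (a - i) / \<theta> ^ (k - i) else 0)"

text \<open>The superposition of the unit responses; on the digits of an integer it reproduces the
  rounding errors exactly, see \<open>resp_digits\<close>.\<close>

definition resp :: "(nat \<Rightarrow> int) \<Rightarrow> nat \<Rightarrow> real" where
  "resp t k = (\<Sum>a\<in>supp t. of_int (t a) * h a k)"

text \<open>Absolute values discard the signs, which depend on the parities of the rounded integers
  and not on the errors.\<close>

definition pprod :: "(nat \<Rightarrow> int) \<Rightarrow> nat \<Rightarrow> real" where
  "pprod t n = (\<Prod>k<n. \<bar>cos (pi * resp t k)\<bar>)"

definition Phi :: "(nat \<Rightarrow> int) \<Rightarrow> real" where
  "Phi t = lim (pprod t)"

text \<open>Shifting a digit sequence towards infinity removes the effect of the boundary at \<open>0\<close>; the limiting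
  value \<open>Psi\<close> is shift invariant.\<close>

definition Psi :: "(nat \<Rightarrow> int) \<Rightarrow> real" where
  "Psi t = lim (\<lambda>j. Phi (shift_digits j t))"

definition H :: real where "H = C / (1 - \<rho>)"

lemma H_pos: "H > 0" using C rho by (simp add: H_def)

text \<open>In natural subtraction \<open>(k - a) + (a - k)\<close> is the distance between time and
  digit. The summand \<open>i\<close> decays with exponent (a - i) + (k - i), which is that distance
  plus twice min k a - i; one copy of the surplus suffices for a geometric series, whose bound is
  absorbed in \<open>H\<close>.\<close>

lemma h_le: "\<bar>h a k\<bar> \<le> H * \<rho> ^ ((k - a) + (a - k))"
proof -
  let ?e = "(k - a) + (a - k)" and ?m = "min k a"
  have summand_le: "\<bar>c (a - i) / \<theta> ^ (k - i)\<bar> \<le> C * \<rho> ^ ?e * \<rho> ^ (?m - i)" if "i < k" "i \<le> a" for i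
  proof -
    have "\<bar>c (a - i) / \<theta> ^ (k - i)\<bar> = \<bar>c (a - i)\<bar> * (1 / \<theta>) ^ (k - i)"
      using theta by (simp add: abs_mult power_divide)
    also have "\<dots> \<le> (C * \<rho> ^ (a - i)) * \<rho> ^ (k - i)"
      using theta rho C by (intro mult_mono c_le power_mono) auto
    also have "\<dots> = C * \<rho> ^ ((a - i) + (k - i))" by (simp add: power_add)
    also have "\<dots> \<le> C * \<rho> ^ (?e + (?m - i))"
      using C rho that by (intro mult_left_mono power_decreasing) auto
    finally show ?thesis by (simp add: power_add)
  qed
  have "\<bar>h a k\<bar> \<le> (\<Sum>i<k. \<bar>if i \<le> a then c (a - i) / \<theta> ^ (k - i) else 0\<bar>)"
    unfolding h_def by (rule sum_abs)
  also have "\<dots> = (\<Sum>i\<in>{i. i < k \<and> i \<le> a}. \<bar>c (a - i) / \<theta> ^ (k - i)\<bar>)"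
    by (rule sum.mono_neutral_cong_right) auto
  also have "\<dots> \<le> (\<Sum>i\<in>{i. i < k \<and> i \<le> a}. C * \<rho> ^ ?e * \<rho> ^ (?m - i))"
    using summand_le by (intro sum_mono) auto
  also have "\<dots> \<le> (\<Sum>i<Suc ?m. C * \<rho> ^ ?e * \<rho> ^ (?m - i))"
    using C rho by (intro sum_mono2) auto
  also have "\<dots> = C * \<rho> ^ ?e * (\<Sum>i<Suc ?m. \<rho> ^ i)"
    unfolding sum_distrib_left[symmetric] using sum.nat_diff_reindex[of "\<lambda>i. \<rho> ^ i" "Suc ?m"] by simp
  also have "\<dots> \<le> C * \<rho> ^ ?e * (1 / (1 - \<rho>))"
    using C rho by (intro mult_left_mono sum_power_le) auto
  finally show ?thesis by (simp add: H_def)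
qed

lemma resp_superset:
  assumes "finite S" "supp t \<subseteq> S"
  shows "resp t k = (\<Sum>a\<in>S. of_int (t a) * h a k)"
  unfolding resp_def using assms by (intro sum.mono_neutral_left) (auto simp: supp_def)

lemma resp_add:
  assumes "finite (supp s)" "finite (supp t)"
  shows "resp (\<lambda>a. s a + t a) k = resp s k + resp t k"
proof -
  have "supp (\<lambda>a. s a + t a) \<subseteq> supp s \<union> supp t" by (auto simp: supp_def)
  then show ?thesis
    using assms by (simp add: resp_superset[of "supp s \<union> supp t"] sum.distrib[symmetric] distrib_right)
qed

lemma resp_le:
  assumes t: "t \<in> configs D m" and le: "\<And>a. a \<in> supp t \<Longrightarrow> \<bar>h a k\<bar> \<le> x"
  shows "\<bar>resp t k\<bar> \<le> real m * of_int D * x"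
proof -
  have "\<bar>resp t k\<bar> \<le> (\<Sum>a\<in>supp t. \<bar>of_int (t a) * h a k\<bar>)" unfolding resp_def by (rule sum_abs)
  also have "\<dots> \<le> (\<Sum>a\<in>supp t. D * x)"
  proof (rule sum_mono)
    fix a assume a: "a \<in> supp t"
    have "real_of_int \<bar>t a\<bar> \<le> of_int D" using t unfolding of_int_le_iff by (auto simp: configs_def)
    then show "\<bar>of_int (t a) * h a k\<bar> \<le> D * x"
      unfolding abs_mult using le[OF a] by (intro mult_mono) (auto intro: order_trans[OF abs_ge_zero])
  qed
  finally show ?thesis using t by (simp add: configs_def)
qed

lemma resp_le_left:
  assumes "t \<in> configs D m" "supp t \<subseteq> {..b}"
  shows "\<bar>resp t k\<bar> \<le> real m * of_int D * (H * \<rho> ^ (k - b))"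
proof (rule resp_le[OF assms(1)])
  fix a assume "a \<in> supp t"
  then have "\<rho> ^ ((k - a) + (a - k)) \<le> \<rho> ^ (k - b)" using assms(2) rho by (intro power_decreasing) auto
  then show "\<bar>h a k\<bar> \<le> H * \<rho> ^ (k - b)" using h_le[of a k] H_pos by (meson mult_left_mono less_imp_le order_trans)
qed

lemma resp_le_right:
  assumes "t \<in> configs D m" "supp t \<subseteq> {b..}"
  shows "\<bar>resp t k\<bar> \<le> real m * of_int D * (H * \<rho> ^ (b - k))"
proof (rule resp_le[OF assms(1)])
  fix a assume "a \<in> supp t"
  then have "\<rho> ^ ((k - a) + (a - k)) \<le> \<rho> ^ (b - k)" using assms(2) rho by (intro power_decreasing) auto
  then show "\<bar>h a k\<bar> \<le> H * \<rho> ^ (b - k)" using h_le[of a k] H_pos by (meson mult_left_mono less_imp_le order_trans)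
qed

lemma pprod_bounds: "0 \<le> pprod t n" "pprod t n \<le> 1"
  by (auto simp: pprod_def intro!: prod_nonneg prod_le_1)

lemma pprod_tendsto: "pprod t \<longlonglongrightarrow> Phi t"
proof -
  have "decseq (pprod t)"
  proof (rule decseq_SucI)
    fix n
    have "pprod t (Suc n) = pprod t n * \<bar>cos (pi * resp t n)\<bar>" by (simp add: pprod_def)
    also have "\<dots> \<le> pprod t n" by (rule mult_right_le_one_le) (auto simp: pprod_bounds)
    finally show "pprod t (Suc n) \<le> pprod t n" .
  qed
  then have "convergent (pprod t)" using pprod_bounds(1) by (metis decseq_convergent convergentI)
  then show ?thesis by (simp add: Phi_def convergent_LIMSEQ_iff)
qed

lemma Phi_bounds: "0 \<le> Phi t" "Phi t \<le> 1"
  using pprod_tendsto[of t] pprod_bounds by (auto intro: LIMSEQ_le_const LIMSEQ_le_const2)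

text \<open>The square bounds the product of the two cosine arguments at one time; the other factor
  bounds a two-sided geometric series over all times.\<close>

definition split_const :: "int \<Rightarrow> nat \<Rightarrow> real" where
  "split_const D m = (pi * real m * of_int D * H)\<^sup>2 * (2 / (1 - sqrt \<rho>))"

lemma sum_power_two_sided:
  fixes x :: real
  assumes "0 \<le> x" "x < 1"
  shows "(\<Sum>k<n. x ^ ((k - b) + (b - k))) \<le> 2 / (1 - x)"
proof -
  have split: "(\<Sum>k<b + n. f k) = (\<Sum>k<b. f k) + (\<Sum>k<n. f (b + k))" for f :: "nat \<Rightarrow> real"
    by (induction n) (auto simp: add.assoc)
  have "(\<Sum>k<n. x ^ ((k - b) + (b - k))) \<le> (\<Sum>k<b + n. x ^ ((k - b) + (b - k)))"
    using assms by (intro sum_mono2) auto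
  also have "\<dots> = (\<Sum>k<b. x ^ (b - k)) + (\<Sum>k<n. x ^ k)"
    unfolding split by simp
  also have "(\<Sum>k<b. x ^ (b - k)) = (\<Sum>k<b. x ^ Suc k)"
    using sum.nat_diff_reindex[of "\<lambda>i. x ^ Suc i" b] by (simp add: Suc_diff_Suc cong: sum.cong_simp)
  also have "\<dots> \<le> (\<Sum>k<b. x ^ k)" using assms by (intro sum_mono power_decreasing) auto
  finally show ?thesis using sum_power_le[OF assms, of b] sum_power_le[OF assms, of n] by simp
qed

text \<open>Replacing the factors one by one costs at time \<open>k\<close> at most the product of
  the two responses, which decay away from their own sides of the gap.\<close>

lemma pprod_split:
  assumes s: "s \<in> configs D l" "supp s \<subseteq> {..b}" and t: "t \<in> configs D r" "supp t \<subseteq> {b'..}"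
    and lr: "l \<le> m" "r \<le> m" and b: "b \<le> b'" and D: "D \<ge> 0"
  shows "\<bar>pprod (\<lambda>a. s a + t a) n - pprod s n * pprod t n\<bar> \<le> split_const D m * sqrt \<rho> ^ (b' - b)"
proof -
  let ?K = "(pi * real m * of_int D * H)\<^sup>2"
  have fin: "finite (supp s)" "finite (supp t)" using s t by (auto simp: configs_def)
  have "\<bar>pprod (\<lambda>a. s a + t a) n - pprod s n * pprod t n\<bar>
      \<le> (\<Sum>k<n. \<bar>\<bar>cos (pi * resp s k + pi * resp t k)\<bar> - \<bar>cos (pi * resp s k)\<bar> * \<bar>cos (pi * resp t k)\<bar>\<bar>)"
    unfolding pprod_def prod.distrib[symmetric] resp_add[OF fin] distrib_left real_norm_def[symmetric]
    by (rule norm_prod_diff) (auto simp: mult_le_one)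
  also have "\<dots> \<le> (\<Sum>k<n. ?K * (sqrt \<rho> ^ (b' - b) * sqrt \<rho> ^ ((k - b) + (b - k))))"
  proof (rule sum_mono)
    fix k
    have "\<bar>resp s k\<bar> \<le> real l * of_int D * (H * \<rho> ^ (k - b))" by (rule resp_le_left[OF s])
    also have "\<dots> \<le> real m * of_int D * (H * \<rho> ^ (k - b))"
      using lr D H_pos rho(1) by (intro mult_right_mono) auto
    finally have 1: "\<bar>resp s k\<bar> \<le> real m * of_int D * H * \<rho> ^ (k - b)" by simp
    have "\<bar>resp t k\<bar> \<le> real r * of_int D * (H * \<rho> ^ (b' - k))" by (rule resp_le_right[OF t])
    also have "\<dots> \<le> real m * of_int D * (H * \<rho> ^ (b' - k))"
      using lr D H_pos rho(1) by (intro mult_right_mono) auto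
    finally have 2: "\<bar>resp t k\<bar> \<le> real m * of_int D * H * \<rho> ^ (b' - k)" by simp
    have "\<bar>\<bar>cos (pi * resp s k + pi * resp t k)\<bar> - \<bar>cos (pi * resp s k)\<bar> * \<bar>cos (pi * resp t k)\<bar>\<bar>
      \<le> \<bar>pi * resp s k\<bar> * \<bar>pi * resp t k\<bar>" by (rule abs_cos_add_le)
    also have "\<dots> = pi\<^sup>2 * (\<bar>resp s k\<bar> * \<bar>resp t k\<bar>)" by (simp add: abs_mult power2_eq_square)
    also have "\<dots> \<le> pi\<^sup>2 * ((real m * of_int D * H * \<rho> ^ (k - b)) * (real m * of_int D * H * \<rho> ^ (b' - k)))"
      using D H_pos rho(1) by (intro mult_left_mono mult_mono[OF 1 2]) auto
    also have "\<dots> = ?K * \<rho> ^ ((k - b) + (b' - k))" by (simp only: power_add power2_eq_square mult_ac)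
    \<comment> \<open>Passing to sqrt \<rho> doubles the exponent: one part pays for the gap
      \<open>b' - b\<close>, the rest for summability over \<open>k\<close>. The comparison holds
      for \<open>k\<close> below, inside and above the gap.\<close>
    also have "\<rho> ^ ((k - b) + (b' - k)) = sqrt \<rho> ^ (2 * ((k - b) + (b' - k)))"
      using rho by (simp only: power_mult) simp
    also have "?K * \<dots> \<le> ?K * sqrt \<rho> ^ ((b' - b) + ((k - b) + (b - k)))"
      using rho b by (intro mult_left_mono power_decreasing) auto
    finally show "\<bar>\<bar>cos (pi * resp s k + pi * resp t k)\<bar> - \<bar>cos (pi * resp s k)\<bar> * \<bar>cos (pi * resp t k)\<bar>\<bar>
      \<le> ?K * (sqrt \<rho> ^ (b' - b) * sqrt \<rho> ^ ((k - b) + (b - k)))" by (simp add: power_add)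
  qed
  also have "\<dots> = ?K * sqrt \<rho> ^ (b' - b) * (\<Sum>k<n. sqrt \<rho> ^ ((k - b) + (b - k)))"
    by (simp only: mult.assoc sum_distrib_left)
  also have "\<dots> \<le> ?K * sqrt \<rho> ^ (b' - b) * (2 / (1 - sqrt \<rho>))"
    using rho by (intro mult_left_mono sum_power_two_sided) auto
  finally show ?thesis by (simp add: split_const_def mult_ac)
qed

lemma Phi_split:
  assumes "s \<in> configs D l" "supp s \<subseteq> {..b}" and "t \<in> configs D r" "supp t \<subseteq> {b'..}"
    and "l \<le> m" "r \<le> m" "b \<le> b'" "D \<ge> 0"
  shows "\<bar>Phi (\<lambda>a. s a + t a) - Phi s * Phi t\<bar> \<le> split_const D m * sqrt \<rho> ^ (b' - b)"
proof (rule LIMSEQ_le_const2)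
  show "(\<lambda>n. \<bar>pprod (\<lambda>a. s a + t a) n - pprod s n * pprod t n\<bar>) \<longlonglongrightarrow> \<bar>Phi (\<lambda>a. s a + t a) - Phi s * Phi t\<bar>"
    by (intro tendsto_rabs tendsto_diff tendsto_mult pprod_tendsto)
qed (use pprod_split[OF assms] in auto)

text \<open>Shifting digit and time together creates one new summand, the one with
  \<open>i = 0\<close>; this boundary term is the only failure of shift invariance.\<close>

lemma h_Suc: "h (Suc a) (Suc k) = h a k + c (Suc a) / \<theta> ^ Suc k"
  unfolding h_def by (subst sum.lessThan_Suc_shift) (simp cong: if_cong)

lemma resp_0 [simp]: "resp t 0 = 0"
  by (simp add: resp_def h_def)

lemma resp_shift_Suc:
  "resp (shift_digits 1 t) (Suc k) = resp t k + (\<Sum>a\<in>supp t. of_int (t a) * c (Suc a)) / \<theta> ^ Suc k"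
proof -
  have "resp (shift_digits 1 t) (Suc k) = (\<Sum>a\<in>supp t. of_int (t a) * h (Suc a) (Suc k))"
    unfolding resp_def supp_shift by (subst sum.reindex) (auto simp: shift_digits_def)
  then show ?thesis
    by (simp add: h_Suc resp_def distrib_left sum.distrib sum_divide_distrib del: power_Suc)
qed

definition shift_const :: "int \<Rightarrow> nat \<Rightarrow> real" where
  "shift_const D m = pi * real m * of_int D * C / (1 - \<rho>)"

lemma pprod_shift:
  assumes t: "t \<in> configs D m" "supp t \<subseteq> {b..}"
  shows "\<bar>pprod (shift_digits 1 t) (Suc n) - pprod t n\<bar> \<le> shift_const D m * \<rho> ^ b"
proof -
  let ?s = "\<Sum>a\<in>supp t. of_int (t a) * c (Suc a)"
  have D: "D \<ge> 0" using t(1) by (rule configs_nonneg)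
  have "\<bar>?s\<bar> \<le> (\<Sum>a\<in>supp t. D * (C * \<rho> ^ b))"
  proof (rule order_trans[OF sum_abs sum_mono])
    fix a assume a: "a \<in> supp t"
    have "\<bar>c (Suc a)\<bar> \<le> C * \<rho> ^ Suc a" by (rule c_le)
    also have "\<dots> \<le> C * \<rho> ^ b" using C rho a t(2) by (intro mult_left_mono power_decreasing) auto
    finally have "\<bar>c (Suc a)\<bar> \<le> C * \<rho> ^ b" .
    moreover have "real_of_int \<bar>t a\<bar> \<le> of_int D" using t unfolding of_int_le_iff by (auto simp: configs_def)
    ultimately show "\<bar>of_int (t a) * c (Suc a)\<bar> \<le> D * (C * \<rho> ^ b)"
      unfolding abs_mult by (intro mult_mono) (auto simp: D)
  qed
  also have "\<dots> = real m * of_int D * C * \<rho> ^ b" using t by (simp add: configs_def)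
  finally have s: "\<bar>?s\<bar> \<le> real m * of_int D * C * \<rho> ^ b" .
  \<comment> \<open>The response at time 0 vanishes, so the first factor is 1 and the remaining ones
    line up with those of the unshifted product.\<close>
  have "pprod (shift_digits 1 t) (Suc n) = (\<Prod>k<n. \<bar>cos (pi * resp (shift_digits 1 t) (Suc k))\<bar>)"
    unfolding pprod_def by (subst prod.lessThan_Suc_shift) simp
  then have "\<bar>pprod (shift_digits 1 t) (Suc n) - pprod t n\<bar>
     \<le> (\<Sum>k<n. \<bar>\<bar>cos (pi * resp (shift_digits 1 t) (Suc k))\<bar> - \<bar>cos (pi * resp t k)\<bar>\<bar>)"
    unfolding pprod_def real_norm_def[symmetric] by (simp only:) (rule norm_prod_diff, auto)
  also have "\<dots> \<le> (\<Sum>k<n. pi * real m * of_int D * C * \<rho> ^ b * \<rho> ^ k)"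
  proof (rule sum_mono)
    fix k
    have "\<bar>\<bar>cos (pi * resp (shift_digits 1 t) (Suc k))\<bar> - \<bar>cos (pi * resp t k)\<bar>\<bar>
      \<le> \<bar>pi * resp (shift_digits 1 t) (Suc k) - pi * resp t k\<bar>" by (rule abs_abs_cos_diff_le)
    also have "\<dots> = pi * (\<bar>?s\<bar> * (1 / \<theta>) ^ Suc k)"
      unfolding resp_shift_Suc using theta
      by (simp add: distrib_left abs_mult power_divide del: power_Suc)
    also have "\<dots> \<le> pi * ((real m * of_int D * C * \<rho> ^ b) * \<rho> ^ k)"
    proof (intro mult_left_mono mult_mono s)
      have "(1 / \<theta>) ^ Suc k \<le> (1 / \<theta>) ^ k" using theta by (intro power_decreasing) auto
      also have "\<dots> \<le> \<rho> ^ k" using theta rho by (intro power_mono) auto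
      finally show "(1 / \<theta>) ^ Suc k \<le> \<rho> ^ k" .
    qed (use D C rho theta in auto)
    finally show "\<bar>\<bar>cos (pi * resp (shift_digits 1 t) (Suc k))\<bar> - \<bar>cos (pi * resp t k)\<bar>\<bar>
      \<le> pi * real m * of_int D * C * \<rho> ^ b * \<rho> ^ k" by (simp add: mult_ac)
  qed
  also have "\<dots> = pi * real m * of_int D * C * \<rho> ^ b * (\<Sum>k<n. \<rho> ^ k)" by (simp add: sum_distrib_left)
  also have "\<dots> \<le> pi * real m * of_int D * C * \<rho> ^ b * (1 / (1 - \<rho>))"
    using D C rho by (intro mult_left_mono sum_power_le) auto
  finally show ?thesis by (simp add: shift_const_def mult_ac)
qed

lemma Phi_shift:
  assumes "t \<in> configs D m" "supp t \<subseteq> {b..}"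
  shows "\<bar>Phi (shift_digits 1 t) - Phi t\<bar> \<le> shift_const D m * \<rho> ^ b"
proof (rule LIMSEQ_le_const2)
  show "(\<lambda>n. \<bar>pprod (shift_digits 1 t) (Suc n) - pprod t n\<bar>) \<longlonglongrightarrow> \<bar>Phi (shift_digits 1 t) - Phi t\<bar>"
    by (intro tendsto_rabs tendsto_diff pprod_tendsto LIMSEQ_Suc[OF pprod_tendsto])
qed (use pprod_shift[OF assms] in auto)

text \<open>Each further shift moves the support away from 0, so the one-step errors sum
  geometrically. This yields convergence to \<open>Psi\<close> and, at the limit, its distance from
  \<open>Phi\<close>.\<close>

lemma Phi_shift_diff:
  assumes t: "t \<in> configs D m" "supp t \<subseteq> {b..}"
  shows "\<bar>Phi (shift_digits (j + i) t) - Phi (shift_digits j t)\<bar> \<le> shift_const D m / (1 - \<rho>) * \<rho> ^ (b + j)"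
proof -
  have D: "D \<ge> 0" using t(1) by (rule configs_nonneg)
  have K: "shift_const D m \<ge> 0" using D C rho by (simp add: shift_const_def)
  have "\<bar>Phi (shift_digits (j + i) t) - Phi (shift_digits j t)\<bar> \<le> (\<Sum>k<i. shift_const D m * \<rho> ^ (b + j) * \<rho> ^ k)"
  proof (induction i)
    case (Suc i)
    have "supp (shift_digits (j + i) t) \<subseteq> {b + (j + i)..}" using t(2) by (auto simp: supp_shift)
    then have "\<bar>Phi (shift_digits 1 (shift_digits (j + i) t)) - Phi (shift_digits (j + i) t)\<bar> \<le> shift_const D m * \<rho> ^ (b + (j + i))"
      by (rule Phi_shift[OF configs_shift[OF t(1)]])
    also have "shift_digits 1 (shift_digits (j + i) t) = shift_digits (j + Suc i) t"
      unfolding add_Suc_right by (rule shift_Suc[symmetric])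
    finally show ?case using Suc.IH by (simp add: power_add mult.assoc)
  qed simp
  also have "\<dots> = shift_const D m * \<rho> ^ (b + j) * (\<Sum>k<i. \<rho> ^ k)" by (simp add: sum_distrib_left)
  also have "\<dots> \<le> shift_const D m * \<rho> ^ (b + j) * (1 / (1 - \<rho>))"
    using K rho by (intro mult_left_mono sum_power_le) auto
  finally show ?thesis by (simp add: mult_ac)
qed

lemma Phi_shift_tendsto:
  assumes t: "t \<in> configs D m"
  shows "(\<lambda>j. Phi (shift_digits j t)) \<longlonglongrightarrow> Psi t"
proof -
  let ?K = "shift_const D m / (1 - \<rho>)"
  have "Cauchy (\<lambda>j. Phi (shift_digits j t))"
  proof (rule CauchyI)
    fix e :: real assume e: "e > 0"
    have "(\<lambda>j. ?K * \<rho> ^ j) \<longlonglongrightarrow> ?K * 0" using rho by (intro tendsto_intros LIMSEQ_realpow_zero) auto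
    then have "eventually (\<lambda>j. ?K * \<rho> ^ j < e) sequentially" using e by (intro order_tendstoD) auto
    then obtain M where M: "\<And>j. j \<ge> M \<Longrightarrow> ?K * \<rho> ^ j < e" by (auto simp: eventually_sequentially)
    have *: "\<bar>Phi (shift_digits n t) - Phi (shift_digits j t)\<bar> < e" if "j \<ge> M" "n \<ge> j" for j n
      using Phi_shift_diff[OF t, of 0 j "n - j"] M[OF that(1)] that(2) by simp
    then have "norm (Phi (shift_digits j t) - Phi (shift_digits n t)) < e" if "j \<ge> M" "n \<ge> M" for j n
      using *[of j n] *[of n j] that by (cases "j \<le> n") (auto simp: abs_minus_commute)
    then show "\<exists>M. \<forall>j\<ge>M. \<forall>n\<ge>M. norm (Phi (shift_digits j t) - Phi (shift_digits n t)) < e" by blast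
  qed
  then show ?thesis by (simp add: Psi_def Cauchy_convergent convergent_LIMSEQ_iff[symmetric])
qed

lemma Phi_Psi_diff:
  assumes t: "t \<in> configs D m" "supp t \<subseteq> {b..}"
  shows "\<bar>Psi t - Phi t\<bar> \<le> shift_const D m / (1 - \<rho>) * \<rho> ^ b"
proof (rule LIMSEQ_le_const2)
  show "(\<lambda>j. \<bar>Phi (shift_digits j t) - Phi t\<bar>) \<longlonglongrightarrow> \<bar>Psi t - Phi t\<bar>"
    by (intro tendsto_rabs tendsto_diff tendsto_const Phi_shift_tendsto[OF t(1)])
qed (use Phi_shift_diff[OF t, of 0] in auto)

lemma Psi_bounds:
  assumes "t \<in> configs D m"
  shows "0 \<le> Psi t" "Psi t \<le> 1"
  using Phi_shift_tendsto[OF assms] Phi_bounds by (auto intro: LIMSEQ_le_const LIMSEQ_le_const2)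

lemma Psi_shift:
  assumes "t \<in> configs D m"
  shows "Psi (shift_digits j t) = Psi t"
proof -
  have "shift_digits i (shift_digits j t) = shift_digits (i + j) t" for i
    by (rule ext) (auto simp: shift_digits_def)
  then have "(\<lambda>i. Phi (shift_digits (i + j) t)) \<longlonglongrightarrow> Psi (shift_digits j t)"
    using Phi_shift_tendsto[OF configs_shift[OF assms], of j] by simp
  moreover have "(\<lambda>i. Phi (shift_digits (i + j) t)) \<longlonglongrightarrow> Psi t"
    using Phi_shift_tendsto[OF assms] by (rule LIMSEQ_ignore_initial_segment)
  ultimately show ?thesis by (rule LIMSEQ_unique)
qed

text \<open>The error in \<open>Phi_split\<close> depends on the gap but not on the position, so it
  survives the limit of shifts.\<close>

lemma Psi_split:
  assumes s: "s \<in> configs D l" "supp s \<subseteq> {..b}" and t: "t \<in> configs D r" "supp t \<subseteq> {b'..}"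
    and st: "(\<lambda>a. s a + t a) \<in> configs D m"
    and "l \<le> m" "r \<le> m" "b \<le> b'" "D \<ge> 0"
  shows "\<bar>Psi (\<lambda>a. s a + t a) - Psi s * Psi t\<bar> \<le> split_const D m * sqrt \<rho> ^ (b' - b)"
proof (rule LIMSEQ_le_const2)
  show "(\<lambda>j. \<bar>Phi (shift_digits j (\<lambda>a. s a + t a)) - Phi (shift_digits j s) * Phi (shift_digits j t)\<bar>)
      \<longlonglongrightarrow> \<bar>Psi (\<lambda>a. s a + t a) - Psi s * Psi t\<bar>"
    by (intro tendsto_rabs tendsto_diff tendsto_mult Phi_shift_tendsto[OF s(1)] Phi_shift_tendsto[OF t(1)] Phi_shift_tendsto[OF st])
  have "\<bar>Phi (shift_digits j (\<lambda>a. s a + t a)) - Phi (shift_digits j s) * Phi (shift_digits j t)\<bar> \<le> split_const D m * sqrt \<rho> ^ (b' - b)" for j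
  proof -
    have "shift_digits j (\<lambda>a. s a + t a) = (\<lambda>a. shift_digits j s a + shift_digits j t a)" by (auto simp: shift_digits_def)
    moreover have "supp (shift_digits j s) \<subseteq> {..b + j}" "supp (shift_digits j t) \<subseteq> {b' + j..}"
      using s(2) t(2) by (auto simp: supp_shift)
    ultimately show ?thesis
      using Phi_split[OF configs_shift[OF s(1)] _ configs_shift[OF t(1)], of j "b + j" j "b' + j" m] assms(6-)
      by simp
  qed
  then show "\<exists>N. \<forall>j\<ge>N. \<bar>Phi (shift_digits j (\<lambda>a. s a + t a)) - Phi (shift_digits j s) * Phi (shift_digits j t)\<bar> \<le> split_const D m * sqrt \<rho> ^ (b' - b)"
    by blast
qed

section \<open>Countability of the closures by induction on the number of digits\<close>

lemma compact_closure_Psi: "compact (closure (Psi ` configs D m))"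
  unfolding compact_closure
  by (rule bounded_subset[of "{0..1}"]) (auto simp: Psi_bounds)

lemma compact_closure_Phi: "compact (closure (Phi ` configs D m))"
  unfolding compact_closure
  by (rule bounded_subset[of "{0..1}"]) (auto simp: Phi_bounds)

lemma compact_products:
  fixes f :: "nat \<Rightarrow> real set"
  assumes "\<And>l. compact (f l)"
  shows "compact (\<Union>l<m. \<Union>r<m. (\<lambda>(x, y). x * y) ` (f l \<times> f r))"
  by (intro compact_UN compact_continuous_image compact_Times assms finite_lessThan)
    (auto simp: case_prod_unfold intro!: continuous_intros)

lemma countable_products:
  fixes f :: "nat \<Rightarrow> real set"
  assumes "\<And>l. l < m \<Longrightarrow> countable (f l)"
  shows "countable (\<Union>l<m. \<Union>r<m. (\<lambda>(x, y). x * y) ` (f l \<times> f r))"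
  using assms by (intro countable_UN countable_image countable_SIGMA) auto

lemma split_const_small:
  assumes "\<eta> > 0"
  obtains B where "split_const D m * sqrt \<rho> ^ B < \<eta>"
    and "shift_const D m / (1 - \<rho>) * \<rho> ^ B < \<eta>"
proof -
  have "(\<lambda>B. split_const D m * sqrt \<rho> ^ B) \<longlonglongrightarrow> split_const D m * 0"
    using rho by (intro tendsto_mult tendsto_const LIMSEQ_realpow_zero) auto
  then have "\<forall>\<^sub>F B in sequentially. split_const D m * sqrt \<rho> ^ B < \<eta>"
    using assms by (intro order_tendstoD) auto
  moreover have "(\<lambda>B. shift_const D m / (1 - \<rho>) * \<rho> ^ B) \<longlonglongrightarrow> shift_const D m / (1 - \<rho>) * 0"
    using rho by (intro tendsto_mult tendsto_const LIMSEQ_realpow_zero) auto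
  then have "\<forall>\<^sub>F B in sequentially. shift_const D m / (1 - \<rho>) * \<rho> ^ B < \<eta>"
    using assms by (intro order_tendstoD) auto
  ultimately have "\<forall>\<^sub>F B in sequentially. split_const D m * sqrt \<rho> ^ B < \<eta> \<and> shift_const D m / (1 - \<rho>) * \<rho> ^ B < \<eta>"
    by (rule eventually_conj)
  then obtain B where "\<forall>n\<ge>B. split_const D m * sqrt \<rho> ^ n < \<eta> \<and> shift_const D m / (1 - \<rho>) * \<rho> ^ n < \<eta>"
    unfolding eventually_sequentially by blast
  then show thesis using that[of B] by simp
qed

lemma configs_gap_split:
  assumes t: "t \<in> configs D m" and b: "b \<in> supp t" "y \<in> supp t" "b + B < y"
    and gap: "\<forall>x\<in>supp t. x \<le> b \<or> b + B < x"
  obtains l r tl tr where "l < m" "r < m" "tl \<in> configs D l" "tr \<in> configs D r"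
    "t = (\<lambda>a. tl a + tr a)" "supp tl \<subseteq> {..b}" "supp tr \<subseteq> {b + B..}"
proof -
  have "b < y" using b(3) by simp
  obtain l r tl tr where
    1: "l < m" "r < m" "tl \<in> configs D l" "tr \<in> configs D r" "t = (\<lambda>a. tl a + tr a)"
    and s: "supp tl = {a \<in> supp t. a \<le> b}" "supp tr = {a \<in> supp t. b < a}"
    by (rule configs_split[OF t b(1,2) \<open>b < y\<close>])
  have "supp tl \<subseteq> {..b}" "supp tr \<subseteq> {b + B..}" using gap by (auto simp: s)
  with 1 show thesis by (rule that)
qed

text \<open>A value at distance \<eta> from all products with fewer digits comes from a
  configuration without a gap longer than \<open>B\<close>, by \<open>Psi_split\<close>. Moved to
  start at 0, which does not change \<open>Psi\<close>, it fits into a window of length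
  \<open>m * B\<close>, and only finitely many configurations do.\<close>

lemma countable_closure_Psi: "countable (closure (Psi ` configs D m))"
proof (induction m rule: less_induct)
  case (less m)
  \<comment> \<open>Taking closures before multiplying makes \<open>Q\<close> compact, hence closed;
    the induction hypothesis makes it countable.\<close>
  define Q where "Q = (\<Union>l<m. \<Union>r<m. (\<lambda>(x, y). x * y) `
    (closure (Psi ` configs D l) \<times> closure (Psi ` configs D r)))"
  show ?case
  proof (rule countable_closure_if_finite_away)
    show "closed Q" unfolding Q_def
      by (intro compact_imp_closed compact_products compact_closure_Psi)
    show "countable Q" unfolding Q_def by (intro countable_products less)
    fix \<eta> :: real assume "\<eta> > 0"
    then obtain B where B: "split_const D m * sqrt \<rho> ^ B < \<eta>" by (rule split_const_small)
    have "{a \<in> Psi ` configs D m. \<forall>q\<in>Q. \<eta> \<le> \<bar>a - q\<bar>} \<subseteq> Psi ` {t \<in> configs D m. supp t \<subseteq> {..m * B}}"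
    proof safe
      fix t assume t: "t \<in> configs D m" and away: "\<forall>q\<in>Q. \<eta> \<le> \<bar>Psi t - q\<bar>"
      have D: "D \<ge> 0" using t by (rule configs_nonneg)
      have fin: "finite (supp t)" "card (supp t) = m" using t by (auto simp: configs_def)
      show "Psi t \<in> Psi ` {t \<in> configs D m. supp t \<subseteq> {..m * B}}"
      proof (cases "supp t = {}")
        case True
        then show ?thesis using t by (intro imageI) auto
      next
        case False
        consider (bdd) "\<forall>x\<in>supp t. x \<le> Min (supp t) + m * B"
          | (gap) b y where "b \<in> supp t" "y \<in> supp t" "b + B < y" "\<forall>x\<in>supp t. x \<le> b \<or> b + B < x"
          using finite_nat_set_gap[OF fin(1) False, of B] fin(2) by blast
        then show ?thesis
        proof cases
          case gap
          obtain l r tl tr where s: "l < m" "r < m"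
            "tl \<in> configs D l" "tr \<in> configs D r" "t = (\<lambda>a. tl a + tr a)" "supp tl \<subseteq> {..b}" "supp tr \<subseteq> {b + B..}"
            by (rule configs_gap_split[OF t gap])
          have "\<bar>Psi t - Psi tl * Psi tr\<bar> \<le> split_const D m * sqrt \<rho> ^ (b + B - b)"
            using Psi_split[OF s(3,6,4,7), of m] t s D by simp
          then have "\<bar>Psi t - Psi tl * Psi tr\<bar> < \<eta>" using B by simp
          moreover have "Psi tl \<in> closure (Psi ` configs D l)" "Psi tr \<in> closure (Psi ` configs D r)"
            using s(3,4) by (auto intro!: subsetD[OF closure_subset])
          then have "Psi tl * Psi tr \<in> Q"
            unfolding Q_def using s(1,2)
            by (intro UN_I[of l] UN_I[of r] image_eqI[of _ _ "(Psi tl, Psi tr)"]) auto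
          then have "\<eta> \<le> \<bar>Psi t - Psi tl * Psi tr\<bar>" using away by blast
          ultimately show ?thesis by linarith
        next
          case bdd
          define M where "M = Min (supp t)"
          have M: "M \<le> a" if "a \<in> supp t" for a using that fin by (simp add: M_def)
          define t' where "t' a = t (a + M)" for a
          have tt': "t = shift_digits M t'"
          proof
            fix a
            have "t a = 0" if "a < M" using M[of a] that by (force simp: supp_def)
            then show "t a = shift_digits M t' a" by (auto simp: shift_digits_def t'_def)
          qed
          have s: "supp t = (\<lambda>a. a + M) ` supp t'" unfolding tt' by (rule supp_shift)
          have "finite (supp t')" using fin(1) unfolding s by (rule finite_imageD) simp
          moreover have "card (supp t') = m" using fin(2) unfolding s by (subst (asm) card_image) auto
          ultimately have t': "t' \<in> configs D m" using t by (auto simp: configs_def t'_def)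
          have "supp t' \<subseteq> {..m * B}"
          proof
            fix x assume "x \<in> supp t'"
            then have "x + M \<in> supp t" unfolding s by blast
            then have "x + M \<le> M + m * B" using bdd unfolding M_def by blast
            then show "x \<in> {..m * B}" by simp
          qed
          moreover have "Psi t = Psi t'" unfolding tt' by (rule Psi_shift[OF t'])
          ultimately show ?thesis using t' by auto
        qed
      qed
    qed
    then show "finite {a \<in> Psi ` configs D m. \<forall>q\<in>Q. \<eta> \<le> \<bar>a - q\<bar>}"
      by (rule finite_subset) (intro finite_imageI finite_configs_bounded)
  qed
qed

text \<open>\<open>Phi\<close> is not shift invariant, so the exceptional set is enlarged by the
  closure of the \<open>Psi\<close> values, near which lie all configurations starting at or beyond
  \<open>B\<close>. Those starting earlier and without long gaps fit into a fixed window.\<close>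

lemma countable_closure_Phi: "countable (closure (Phi ` configs D m))"
proof (induction m rule: less_induct)
  case (less m)
  define Q where "Q = (\<Union>l<m. \<Union>r<m. (\<lambda>(x, y). x * y) `
    (closure (Phi ` configs D l) \<times> closure (Phi ` configs D r)))"
  let ?Q = "closure (Psi ` configs D m) \<union> Q"
  show ?case
  proof (rule countable_closure_if_finite_away)
    show "closed ?Q" unfolding Q_def
      by (intro closed_Un closed_closure compact_imp_closed[OF compact_products] compact_closure_Phi)
    show "countable ?Q" unfolding Q_def
      by (intro countable_Un countable_closure_Psi countable_products less)
    fix \<eta> :: real assume "\<eta> > 0"
    then obtain B where B: "split_const D m * sqrt \<rho> ^ B < \<eta>" "shift_const D m / (1 - \<rho>) * \<rho> ^ B < \<eta>"
      by (rule split_const_small)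
    have "{a \<in> Phi ` configs D m. \<forall>q\<in>?Q. \<eta> \<le> \<bar>a - q\<bar>} \<subseteq> Phi ` {t \<in> configs D m. supp t \<subseteq> {..B + m * B}}"
    proof safe
      fix t assume t: "t \<in> configs D m" and away: "\<forall>q\<in>?Q. \<eta> \<le> \<bar>Phi t - q\<bar>"
      have D: "D \<ge> 0" using t by (rule configs_nonneg)
      have fin: "finite (supp t)" "card (supp t) = m" using t by (auto simp: configs_def)
      show "Phi t \<in> Phi ` {t \<in> configs D m. supp t \<subseteq> {..B + m * B}}"
      proof (cases "supp t = {}")
        case True
        then show ?thesis using t by (intro imageI) auto
      next
        case False
        have near: "Min (supp t) < B"
        proof (rule ccontr)
          assume "\<not> Min (supp t) < B"
          then have "supp t \<subseteq> {B..}" using Min_le[OF fin(1)] by fastforce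
          then have "\<bar>Psi t - Phi t\<bar> \<le> shift_const D m / (1 - \<rho>) * \<rho> ^ B" by (rule Phi_Psi_diff[OF t])
          moreover have "Psi t \<in> ?Q" using t by (intro UnI1 subsetD[OF closure_subset] imageI)
          then have "\<eta> \<le> \<bar>Phi t - Psi t\<bar>" using away by blast
          ultimately show False using B(2) by linarith
        qed
        consider (bdd) "\<forall>x\<in>supp t. x \<le> Min (supp t) + m * B"
          | (gap) b y where "b \<in> supp t" "y \<in> supp t" "b + B < y" "\<forall>x\<in>supp t. x \<le> b \<or> b + B < x"
          using finite_nat_set_gap[OF fin(1) False, of B] fin(2) by blast
        then show ?thesis
        proof cases
          case gap
          obtain l r tl tr where s: "l < m" "r < m"
            "tl \<in> configs D l" "tr \<in> configs D r" "t = (\<lambda>a. tl a + tr a)" "supp tl \<subseteq> {..b}" "supp tr \<subseteq> {b + B..}"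
            by (rule configs_gap_split[OF t gap])
          have "\<bar>Phi t - Phi tl * Phi tr\<bar> \<le> split_const D m * sqrt \<rho> ^ (b + B - b)"
            using Phi_split[OF s(3,6,4,7), of m] s D by simp
          then have "\<bar>Phi t - Phi tl * Phi tr\<bar> < \<eta>" using B by simp
          moreover have "Phi tl \<in> closure (Phi ` configs D l)" "Phi tr \<in> closure (Phi ` configs D r)"
            using s(3,4) by (auto intro!: subsetD[OF closure_subset])
          then have "Phi tl * Phi tr \<in> Q"
            unfolding Q_def using s(1,2)
            by (intro UN_I[of l] UN_I[of r] image_eqI[of _ _ "(Phi tl, Phi tr)"]) auto
          then have "\<eta> \<le> \<bar>Phi t - Phi tl * Phi tr\<bar>" using away by blast
          ultimately show ?thesis by linarith
        next
          case bdd
          then have "supp t \<subseteq> {..B + m * B}" using near by fastforce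
          then show ?thesis using t by auto
        qed
      qed
    qed
    then show "finite {a \<in> Phi ` configs D m. \<forall>q\<in>?Q. \<eta> \<le> \<bar>a - q\<bar>}"
      by (rule finite_subset) (intro finite_imageI finite_configs_bounded)
  qed
qed

end

section \<open>Digit sequences of integers\<close>

text \<open>\<open>A\<close> is the reversed minimal polynomial. Its integrality yields integer
  digits, the inverse \<open>c\<close> of \<open>B\<close> yields locality, and the irrational
  powers yield nonzero limit points.\<close>

locale pisot_recurrence = decaying_response +
  fixes A :: "int poly" and B :: "real poly"
  assumes A0: "coeff A 0 = 1" and AB: "map_poly of_int A = [:1, - \<theta>:] * B"
    and Bc: "fps_of_poly B * Abs_fps c = 1"
    and irrational_power: "\<And>j. j > 0 \<Longrightarrow> \<theta> ^ j \<notin> \<rat>"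
begin

definition digit_bound :: int where "digit_bound = (\<Sum>i\<le>degree A. \<bar>coeff A i\<bar>)"

lemma coeff_A: "of_int (coeff A (Suc i)) = coeff B (Suc i) - \<theta> * coeff B i" "coeff B 0 = 1"
proof -
  have *: "of_int (coeff A n) = coeff ([:1, - \<theta>:] * B) n" for n
    using arg_cong[OF AB, of "\<lambda>p. coeff p n"] by (simp add: coeff_map_poly)
  show "of_int (coeff A (Suc i)) = coeff B (Suc i) - \<theta> * coeff B i" "coeff B 0 = 1"
    using *[of "Suc i"] *[of 0] A0 by simp_all
qed

text \<open>The factorization of \<open>A\<close> read on forward shifts: the two-term filter e_i -
  \<theta> e_(i+1) first, then \<open>B\<close>.\<close>

lemma recurrence_factor:
  assumes "degree A \<le> Suc N" "degree B \<le> N"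
  shows "(\<Sum>i\<le>Suc N. of_int (coeff A i) * e i) = (\<Sum>i\<le>N. coeff B i * (e i - \<theta> * e (Suc i)))"
proof -
  have "(\<Sum>i\<le>Suc N. of_int (coeff A i) * e i) = e 0 + (\<Sum>i\<le>N. (coeff B (Suc i) - \<theta> * coeff B i) * e (Suc i))"
    by (subst sum.atMost_Suc_shift) (simp add: A0 coeff_A)
  also have "\<dots> = (coeff B 0 * e 0 + (\<Sum>i\<le>N. coeff B (Suc i) * e (Suc i))) - (\<Sum>i\<le>N. \<theta> * coeff B i * e (Suc i))"
    by (simp add: coeff_A(2) left_diff_distrib sum_subtractf)
  also have "coeff B 0 * e 0 + (\<Sum>i\<le>N. coeff B (Suc i) * e (Suc i)) = (\<Sum>i\<le>Suc N. coeff B i * e i)"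
    by (subst sum.atMost_Suc_shift) simp
  also have "\<dots> = (\<Sum>i\<le>N. coeff B i * e i)" using assms(2) by (simp add: coeff_eq_0)
  finally have "(\<Sum>i\<le>Suc N. of_int (coeff A i) * e i)
      = (\<Sum>i\<le>N. coeff B i * e i) - (\<Sum>i\<le>N. \<theta> * coeff B i * e (Suc i))" .
  moreover have "(\<Sum>i\<le>N. coeff B i * (e i - \<theta> * e (Suc i)))
      = (\<Sum>i\<le>N. coeff B i * e i) - (\<Sum>i\<le>N. \<theta> * coeff B i * e (Suc i))"
    unfolding sum_subtractf[symmetric] by (intro sum.cong) (simp_all add: right_diff_distrib mult_ac)
  ultimately show ?thesis by simp
qed

lemma convolution_Bc: "(\<Sum>i\<le>n. coeff B i * c (n - i)) = (if n = 0 then 1 else 0)"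
  using arg_cong[OF Bc, of "\<lambda>f. fps_nth f n"] by (simp add: fps_mult_nth atLeast0AtMost)

lemma summable_c: "summable (\<lambda>n. \<bar>c n\<bar>)"
proof (rule summable_comparison_test'[where g = "\<lambda>n. C * \<rho> ^ n"])
  show "summable (\<lambda>n. C * \<rho> ^ n)" using rho by (intro summable_mult summable_geometric) auto
  show "norm \<bar>c n\<bar> \<le> C * \<rho> ^ n" for n using c_le by simp
qed

text \<open>The double sum is regrouped by \<open>m + i\<close>, where the convolution of
  \<open>B\<close> with \<open>c\<close> is the unit at 0. Boundedness of \<open>w\<close> and
  summability of \<open>c\<close> make the shifted series converge.\<close>

lemma invert_recurrence:
  assumes "degree B \<le> N" and w: "\<And>n. \<bar>w n\<bar> \<le> W"
  shows "(\<lambda>m. c m * (\<Sum>i\<le>N. coeff B i * w (m + i))) sums w 0"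
proof -
  define U where "U i = (\<Sum>m. c m * w (m + i))" for i
  have U: "(\<lambda>m. c m * w (m + i)) sums U i" for i
    unfolding U_def
  proof (rule summable_sums, rule summable_comparison_test'[where g = "\<lambda>n. \<bar>c n\<bar> * W"])
    show "summable (\<lambda>n. \<bar>c n\<bar> * W)" by (intro summable_mult2 summable_c)
    show "norm (c n * w (n + i)) \<le> \<bar>c n\<bar> * W" for n
      using w by (simp add: abs_mult mult_left_mono)
  qed
  have "(\<lambda>n. if n < i then 0 else c (n - i) * w n) sums U i" for i
    using U[of i] sums_zero_iff_shift[of i "\<lambda>n. if n < i then 0 else c (n - i) * w n" "U i"] by simp
  then have "(\<lambda>n. \<Sum>i\<le>N. coeff B i * (if n < i then 0 else c (n - i) * w n)) sums (\<Sum>i\<le>N. coeff B i * U i)"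
    by (intro sums_sum sums_mult)
  moreover have "(\<Sum>i\<le>N. coeff B i * (if n < i then 0 else c (n - i) * w n)) = (if n = 0 then w 0 else 0)" for n
  proof -
    have "(\<Sum>i\<le>N. coeff B i * (if n < i then 0 else c (n - i) * w n))
      = (\<Sum>i\<le>N + n. coeff B i * (if n < i then 0 else c (n - i) * w n))"
      using assms(1) by (intro sum.mono_neutral_left) (auto simp: coeff_eq_0)
    also have "\<dots> = (\<Sum>i\<le>n. coeff B i * c (n - i) * w n)"
      by (rule sum.mono_neutral_cong_right) auto
    also have "\<dots> = (if n = 0 then w 0 else 0)"
      unfolding sum_distrib_right[symmetric] convolution_Bc by simp
    finally show ?thesis .
  qed
  ultimately have "(\<lambda>n. if n = 0 then w 0 else 0) sums (\<Sum>i\<le>N. coeff B i * U i)" by simp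
  moreover have "(\<lambda>n. if n = 0 then w 0 else 0) sums w 0" using sums_single[of 0 "\<lambda>_. w 0"] by simp
  ultimately have "w 0 = (\<Sum>i\<le>N. coeff B i * U i)" by (metis sums_unique2)
  moreover have "(\<lambda>m. \<Sum>i\<le>N. coeff B i * (c m * w (m + i))) sums (\<Sum>i\<le>N. coeff B i * U i)"
    by (intro sums_sum sums_mult U)
  moreover have "(\<Sum>i\<le>N. coeff B i * (c m * w (m + i))) = c m * (\<Sum>i\<le>N. coeff B i * w (m + i))" for m
    by (simp add: sum_distrib_left mult_ac)
  ultimately show ?thesis by simp
qed

section \<open>Rounding errors and the integer digits that generate them\<close>

definition err :: "int \<Rightarrow> nat \<Rightarrow> real" where
  "err y k = of_int y / \<theta> ^ k - of_int (round (of_int y / \<theta> ^ k))"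

text \<open>An integer combination of rounded values, hence an integer, which by
  \<open>digits_err\<close> is at the same time a combination of small errors.\<close>

definition digits :: "int \<Rightarrow> nat \<Rightarrow> int" where
  "digits y k = (\<Sum>i\<le>degree A. coeff A i * round (of_int y / \<theta> ^ (k + i)))"

lemma err_le: "\<bar>err y k\<bar> \<le> 1 / 2"
  unfolding err_def using of_int_round_abs_le[of "of_int y / \<theta> ^ k"] by (simp add: abs_minus_commute)

text \<open>\<open>A\<close> vanishes at 1/\<theta>, so the exact values y/\<theta>^k cancel and
  only the errors remain, with a minus sign.\<close>

lemma digits_err: "of_int (digits y k) = - (\<Sum>i\<le>degree A. of_int (coeff A i) * err y (k + i))"
proof -
  have "poly (map_poly of_int A) (1 / \<theta>) = 0" using theta by (simp add: AB)
  then have "(\<Sum>i\<le>degree A. of_int (coeff A i) * (1 / \<theta>) ^ i) = (0 :: real)"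
    by (simp add: poly_altdef degree_map_poly coeff_map_poly)
  then have "of_int y / \<theta> ^ k * (\<Sum>i\<le>degree A. of_int (coeff A i) * (1 / \<theta>) ^ i) = 0" by simp
  then have "(\<Sum>i\<le>degree A. of_int (coeff A i) * (of_int y / \<theta> ^ (k + i))) = 0"
    by (simp add: sum_distrib_left power_add power_divide mult_ac)
  then show ?thesis
    by (simp add: digits_def err_def right_diff_distrib sum_subtractf)
qed

lemma abs_digits_le: "\<bar>digits y k\<bar> \<le> digit_bound"
proof -
  have "real_of_int \<bar>digits y k\<bar> \<le> (\<Sum>i\<le>degree A. \<bar>of_int (coeff A i) * err y (k + i)\<bar>)"
    by (simp add: digits_err)
  also have "\<dots> \<le> (\<Sum>i\<le>degree A. \<bar>of_int (coeff A i)\<bar> * 1)"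
    unfolding abs_mult by (intro sum_mono mult_left_mono order_trans[OF err_le]) auto
  also have "\<dots> = of_int digit_bound" by (simp add: digit_bound_def)
  finally show ?thesis by linarith
qed

lemma finite_supp_digits: "finite (supp (digits y))"
proof -
  have "(\<lambda>k. of_int y * (1 / \<theta>) ^ k) \<longlonglongrightarrow> of_int y * 0"
    using theta by (intro tendsto_mult tendsto_const LIMSEQ_realpow_zero) auto
  then have "\<forall>\<^sub>F k in sequentially. dist (of_int y * (1 / \<theta>) ^ k) 0 < 1 / 2"
    by (intro tendstoD) auto
  then obtain N where N: "\<And>k. k \<ge> N \<Longrightarrow> \<bar>of_int y / \<theta> ^ k\<bar> < 1 / 2"
    by (auto simp: eventually_sequentially power_divide)
  have "round (of_int y / \<theta> ^ k) = 0" if "k \<ge> N" for k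
    using N[OF that] by (intro round_unique') auto
  then have "digits y k = 0" if "k \<ge> N" for k using that by (simp add: digits_def)
  then have "supp (digits y) \<subseteq> {..<N}" by (force simp: supp_def not_less[symmetric])
  then show ?thesis by (rule finite_subset) simp
qed

text \<open>\<open>A\<close> is inverted in two stable steps. The differences \<open>w j\<close> are
  recovered from the present and later digits through \<open>c\<close>; the errors then follow
  forwards from \<open>w\<close> with contraction factor 1/\<theta>, starting from error 0 at time 0
  because \<open>y\<close> is an integer. Composing the two sums gives \<open>h\<close>.\<close>

lemma resp_digits: "resp (digits y) k = err y k"
proof -
  let ?t = "digits y"
  define w where "w j = err y j - \<theta> * err y (Suc j)" for j
  define N where "N = max (degree A) (degree B)"
  have wle: "\<bar>w j\<bar> \<le> 1 + \<theta>" for j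
  proof -
    have "\<bar>w j\<bar> \<le> \<bar>err y j\<bar> + \<theta> * \<bar>err y (Suc j)\<bar>"
      unfolding w_def using theta by (intro order_trans[OF abs_triangle_ineq4]) (simp add: abs_mult)
    also have "\<dots> \<le> 1 / 2 + \<theta> * (1 / 2)" using theta by (intro add_mono mult_left_mono err_le) auto
    finally show ?thesis using theta by simp
  qed
  have Bw: "(\<Sum>i\<le>N. coeff B i * w (k + i)) = - of_int (?t k)" for k
  proof -
    have "(\<Sum>i\<le>degree A. of_int (coeff A i) * err y (k + i)) = (\<Sum>i\<le>Suc N. of_int (coeff A i) * err y (k + i))"
      by (intro sum.mono_neutral_left) (auto simp: N_def coeff_eq_0)
    also have "\<dots> = (\<Sum>i\<le>N. coeff B i * w (k + i))"
      using recurrence_factor[of N "\<lambda>i. err y (k + i)"] by (simp add: N_def w_def)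
    finally show ?thesis by (simp add: digits_err)
  qed
  have w_eq: "w i = - (\<Sum>a\<in>supp ?t. if a < i then 0 else of_int (?t a) * c (a - i))" for i
  proof -
    have "(\<lambda>m. c m * (\<Sum>j\<le>N. coeff B j * w (i + (m + j)))) sums w (i + 0)"
      by (rule invert_recurrence[where W = "1 + \<theta>"]) (auto simp: N_def wle)
    then have "(\<lambda>m. - (c m * of_int (?t (i + m)))) sums w i"
      using Bw[of "i + _"] by (simp add: add.assoc)
    then have "(\<lambda>m. c m * of_int (?t (i + m))) sums (- w i)" using sums_minus by fastforce
    then have "(\<lambda>a. if a < i then 0 else of_int (?t a) * c (a - i)) sums (- w i)"
      using sums_zero_iff_shift[of i "\<lambda>a. if a < i then 0 else of_int (?t a) * c (a - i)" "- w i"]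
      by (simp add: add.commute mult.commute)
    moreover have "(\<lambda>a. if a < i then 0 else of_int (?t a) * c (a - i)) sums
        (\<Sum>a\<in>supp ?t. if a < i then 0 else of_int (?t a) * c (a - i))"
      by (rule sums_finite[OF finite_supp_digits]) (auto simp: supp_def)
    ultimately show ?thesis using sums_unique2 by fastforce
  qed
  have "err y k = - (\<Sum>i<k. w i / \<theta> ^ (k - i))"
  proof (induction k)
    case 0
    then show ?case by (simp add: err_def)
  next
    case (Suc k)
    have "err y (Suc k) = (err y k - w k) / \<theta>" using theta by (simp add: w_def)
    also have "\<dots> = - ((\<Sum>i<k. w i / \<theta> ^ (k - i)) / \<theta>) - w k / \<theta>" by (simp add: Suc diff_divide_distrib)
    also have "(\<Sum>i<k. w i / \<theta> ^ (k - i)) / \<theta> = (\<Sum>i<k. w i / \<theta> ^ (Suc k - i))"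
      unfolding sum_divide_distrib by (intro sum.cong) (auto simp: Suc_diff_le less_imp_le)
    finally show ?case by simp
  qed
  also have "\<dots> = (\<Sum>i<k. \<Sum>a\<in>supp ?t. of_int (?t a) * (if i \<le> a then c (a - i) / \<theta> ^ (k - i) else 0))"
    unfolding w_eq sum_divide_distrib sum_negf[symmetric] by (intro sum.cong refl) (auto simp: sum_divide_distrib intro!: sum.cong)
  also have "\<dots> = resp ?t k"
    unfolding resp_def h_def sum_distrib_left by (rule sum.swap)
  finally show ?thesis by simp
qed

end

lemma abs_cos_pi_add_int: "\<bar>cos (pi * (of_int n + x))\<bar> = \<bar>cos (pi * x)\<bar>"
proof -
  have "sin (pi * of_int n) = 0" by simp
  then have "cos (pi * (of_int n + x)) = cos (pi * of_int n) * cos (pi * x)"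
    by (simp add: distrib_left cos_add)
  moreover have "\<bar>cos (pi * of_int n)\<bar> = 1"
    by (rule sin_zero_abs_cos_one) fact
  ultimately show ?thesis by (simp add: abs_mult)
qed

context pisot_recurrence
begin

text \<open>The doubling turns the angle 2 pi n/\<theta>^k into pi times 2n/\<theta>^k, and the
  rounded integer part of the latter changes only the sign of the cosine.\<close>

lemma pprod_digits:
  "pprod (digits (2 * n)) N = \<bar>\<Prod>k<N. cos (2 * pi * of_int n / \<theta> ^ k)\<bar>"
  unfolding pprod_def abs_prod
proof (rule prod.cong[OF refl])
  fix k
  let ?y = "of_int (2 * n) / \<theta> ^ k"
  have "\<bar>cos (pi * (of_int (round ?y) + err (2 * n) k))\<bar> = \<bar>cos (pi * err (2 * n) k)\<bar>"
    by (rule abs_cos_pi_add_int)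
  moreover have "pi * (of_int (round ?y) + err (2 * n) k) = 2 * pi * of_int n / \<theta> ^ k"
    by (simp add: err_def)
  ultimately show "\<bar>cos (pi * resp (digits (2 * n)) k)\<bar> = \<bar>cos (2 * pi * of_int n / \<theta> ^ k)\<bar>"
    by (simp add: resp_digits)
qed

lemma digits_in_configs: "digits y \<in> configs digit_bound (card (supp (digits y)))"
  by (simp add: configs_def finite_supp_digits abs_digits_le)

text \<open>A nonzero digit has modulus at least 1, while errors all below 1/(2
  \<open>digit_bound\<close>) would keep it at most 1/2.\<close>

lemma digits_nonzero_err:
  assumes "digits y k \<noteq> 0"
  shows "\<exists>i\<le>degree A. 1 / (2 * of_int digit_bound) \<le> \<bar>err y (k + i)\<bar>"
proof (rule ccontr)
  assume neg: "\<not> (\<exists>i\<le>degree A. 1 / (2 * of_int digit_bound) \<le> \<bar>err y (k + i)\<bar>)"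
  have small: "\<bar>err y (k + i)\<bar> < 1 / (2 * of_int digit_bound)" if "i \<le> degree A" for i
  proof (rule ccontr)
    assume "\<not> ?thesis"
    then have "1 / (2 * of_int digit_bound) \<le> \<bar>err y (k + i)\<bar>" by linarith
    then show False using neg that by blast
  qed
  have pos: "0 < digit_bound"
    using abs_digits_le[of y k] assms by linarith
  have "1 \<le> \<bar>real_of_int (digits y k)\<bar>" using assms by linarith
  also have "\<dots> \<le> (\<Sum>i\<le>degree A. \<bar>of_int (coeff A i) * err y (k + i)\<bar>)"
    unfolding digits_err abs_minus_cancel by (rule sum_abs)
  also have "\<dots> \<le> (\<Sum>i\<le>degree A. \<bar>of_int (coeff A i)\<bar> * (1 / (2 * of_int digit_bound)))"
    unfolding abs_mult by (intro sum_mono mult_left_mono less_imp_le[OF small]) auto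
  also have "\<dots> = of_int digit_bound * (1 / (2 * of_int digit_bound))"
    unfolding sum_distrib_right[symmetric] by (simp add: digit_bound_def)
  also have "\<dots> = 1 / 2" using pos by simp
  finally show False by simp
qed

text \<open>Each nonzero digit is followed, within \<open>degree A\<close> steps, by an error of
  size at least \<open>\<kappa>\<close>, hence by a cosine at most \<open>q\<close> < 1. One index
  serves at most \<open>degree A + 1\<close> digits, and a product that is at least \<delta> leaves
  room for fewer than \<open>M\<close> such cosines.\<close>

lemma card_supp_digits_bounded:
  assumes "\<delta> > 0"
  obtains M where "\<forall>y. \<delta> \<le> Phi (digits y) \<longrightarrow> card (supp (digits y)) \<le> M"
proof -
  have pos: "1 \<le> digit_bound"
  proof -
    have "\<bar>coeff A 0\<bar> \<le> digit_bound" unfolding digit_bound_def by (rule member_le_sum) auto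
    then show ?thesis using A0 by simp
  qed
  define \<kappa> where "\<kappa> = 1 / (2 * real_of_int digit_bound)"
  have "1 \<le> real_of_int digit_bound" using pos by simp
  \<comment> \<open>The bound 1/2 keeps the angles in [0, pi/2], where cosine is nonnegative and
    decreasing.\<close>
  then have \<kappa>: "0 < \<kappa>" "\<kappa> \<le> 1 / 2" unfolding \<kappa>_def by (simp_all add: field_simps)
  have pi\<kappa>: "0 < pi * \<kappa>" "pi * \<kappa> \<le> pi / 2"
    using \<kappa> mult_left_mono[of \<kappa> "1 / 2" pi] by auto
  define q where "q = cos (pi * \<kappa>)"
  have q0: "0 \<le> q" unfolding q_def using pi\<kappa> by (intro cos_ge_zero) linarith+
  have "q < cos 0" unfolding q_def using pi\<kappa> by (intro cos_monotone_0_pi) auto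
  then have q1: "q < 1" by simp
  obtain M where M: "q ^ M < \<delta>" using real_arch_pow_inv[OF assms q1] by blast
  have "card (supp (digits y)) \<le> Suc (degree A) * M" if y: "\<delta> \<le> Phi (digits y)" for y
  proof -
    let ?S = "supp (digits y)"
    have "\<forall>k\<in>?S. \<exists>i. i \<le> degree A \<and> \<kappa> \<le> \<bar>err y (k + i)\<bar>"
      using digits_nonzero_err[of y] by (simp add: supp_def \<kappa>_def)
    from bchoice[OF this] obtain f
      where f: "\<forall>k\<in>?S. f k \<le> degree A \<and> \<kappa> \<le> \<bar>err y (k + f k)\<bar>" ..
    define F where "F = (\<lambda>k. k + f k) ` ?S"
    have finF: "finite F" by (simp add: F_def finite_supp_digits)
    then obtain N where N: "F \<subseteq> {..<N}" using finite_nat_iff_bounded by blast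
    have small: "\<bar>cos (pi * resp (digits y) k)\<bar> \<le> q" if "k \<in> F" for k
    proof -
      have e: "\<kappa> \<le> \<bar>err y k\<bar>" using that f by (auto simp: F_def)
 have pe: "0 \<le> pi * \<bar>err y k\<bar>" "pi * \<bar>err y k\<bar> \<le> pi / 2" "pi * \<kappa> \<le> pi * \<bar>err y k\<bar>"
        using e err_le[of y k] mult_left_mono[of "\<bar>err y k\<bar>" "1 / 2" pi] by auto
      have "\<bar>cos (pi * err y k)\<bar> = \<bar>cos (pi * \<bar>err y k\<bar>)\<bar>" by (cases "err y k \<ge> 0") (simp_all add: abs_of_nonpos)
      also have "\<dots> = cos (pi * \<bar>err y k\<bar>)" using pe pi\<kappa> by (intro abs_of_nonneg cos_ge_zero) linarith+
      also have "\<dots> \<le> q" unfolding q_def using pe pi\<kappa> by (intro cos_monotone_0_pi_le) linarith+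
      finally show ?thesis by (simp add: resp_digits)
    qed
    have "\<delta> \<le> pprod (digits y) N"
    proof -
      have "Phi (digits y) \<le> pprod (digits y) N"
      proof (rule decseq_ge[OF _ pprod_tendsto])
        show "decseq (pprod (digits y))"
        proof (rule decseq_SucI)
          fix n
          have "pprod (digits y) (Suc n) = pprod (digits y) n * \<bar>cos (pi * resp (digits y) n)\<bar>" by (simp add: pprod_def)
          also have "\<dots> \<le> pprod (digits y) n" by (rule mult_right_le_one_le) (auto simp: pprod_bounds)
          finally show "pprod (digits y) (Suc n) \<le> pprod (digits y) n" .
        qed
      qed
      then show ?thesis using y by simp
    qed
    also have "\<dots> = (\<Prod>k\<in>F. \<bar>cos (pi * resp (digits y) k)\<bar>) * (\<Prod>k\<in>{..<N} - F. \<bar>cos (pi * resp (digits y) k)\<bar>)"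
      unfolding pprod_def by (subst prod.subset_diff[OF N]) (simp_all add: mult.commute)
    also have "\<dots> \<le> (\<Prod>k\<in>F. q) * 1"
      by (intro mult_mono prod_mono prod_le_1 prod_nonneg) (auto simp: small q0)
    finally have "\<delta> \<le> q ^ card F" by simp
    have "card F < M"
    proof (rule ccontr)
      assume "\<not> card F < M"
      then have "q ^ card F \<le> q ^ M" using q0 q1 by (intro power_decreasing) auto
      then show False using M \<open>\<delta> \<le> q ^ card F\<close> by simp
    qed
    have "?S \<subseteq> (\<Union>i\<le>degree A. (\<lambda>k. k - i) ` F)"
    proof
      fix k assume k: "k \<in> ?S"
      then have "k + f k \<in> F" "f k \<le> degree A" using f by (auto simp: F_def)
      then show "k \<in> (\<Union>i\<le>degree A. (\<lambda>k. k - i) ` F)"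
        by (intro UN_I[of "f k"] image_eqI[of _ _ "k + f k"]) auto
    qed
    then have "card ?S \<le> card (\<Union>i\<le>degree A. (\<lambda>k. k - i) ` F)" using finF by (intro card_mono) auto
    also have "\<dots> \<le> (\<Sum>i\<le>degree A. card ((\<lambda>k. k - i) ` F))" by (rule card_UN_le) simp
    also have "\<dots> \<le> (\<Sum>i\<le>degree A. card F)" by (intro sum_mono card_image_le finF)
    also have "\<dots> = Suc (degree A) * card F" by simp
    finally have "card ?S \<le> Suc (degree A) * card F" .
    moreover have "Suc (degree A) * card F \<le> Suc (degree A) * M"
      using \<open>card F < M\<close> by (intro mult_le_mono) auto
    ultimately show ?thesis by (rule order_trans)
  qed
  then show thesis using that by blast
qed

text \<open>Near a nonzero \<open>z\<close> the moduli are bounded below, so digit counts up to some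
  \<open>M\<close> suffice, and a finite union of closures is closed. As \<open>M\<close> depends on
  \<open>z\<close>, the value 0 is adjoined separately; the lost signs are restored by reflecting
  \<open>S\<close>.\<close>

lemma countable_closure_values:
  fixes \<phi> :: "int \<Rightarrow> real"
  assumes \<phi>: "\<And>n. (\<lambda>N. \<Prod>k<N. cos (2 * pi * of_int n / \<theta> ^ k)) \<longlonglongrightarrow> \<phi> n"
  shows "countable (closure (range \<phi>))"
proof -
  have abs_\<phi>: "\<bar>\<phi> n\<bar> = Phi (digits (2 * n))" for n
  proof (rule LIMSEQ_unique)
    show "pprod (digits (2 * n)) \<longlonglongrightarrow> Phi (digits (2 * n))" by (rule pprod_tendsto)
    show "pprod (digits (2 * n)) \<longlonglongrightarrow> \<bar>\<phi> n\<bar>"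
      unfolding pprod_digits by (intro tendsto_rabs \<phi>)
  qed
  define S where "S = insert 0 (\<Union>m. closure (Phi ` configs digit_bound m))"
  have S: "countable S" unfolding S_def
    by (intro countable_insert countable_UN countable_closure_Phi) auto
  have *: "\<bar>z\<bar> \<in> S" if z: "z \<in> closure (range \<phi>)" for z
  proof (cases "z = 0")
    case False
    then have "\<bar>z\<bar> / 2 > 0" by simp
    then obtain M where M: "\<forall>y. \<bar>z\<bar> / 2 \<le> Phi (digits y) \<longrightarrow> card (supp (digits y)) \<le> M"
      by (rule card_supp_digits_bounded)
    define T where "T = (\<Union>m\<le>M. closure (Phi ` configs digit_bound m))"
    have "closed T" unfolding T_def by (intro closed_UN) auto
    moreover have "\<exists>y\<in>T. dist y \<bar>z\<bar> < e" if "e > 0" for e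
    proof -
      have "min e (\<bar>z\<bar> / 2) > 0" using that False by simp
      then obtain n where n: "dist (\<phi> n) z < min e (\<bar>z\<bar> / 2)"
        using z unfolding closure_approachable by blast
      then have d: "\<bar>\<phi> n - z\<bar> < e" "\<bar>\<phi> n - z\<bar> < \<bar>z\<bar> / 2" by (auto simp: dist_real_def)
      then have "\<bar>z\<bar> / 2 \<le> \<bar>\<phi> n\<bar>" by linarith
      then have "card (supp (digits (2 * n))) \<le> M" using M by (simp add: abs_\<phi>)
      moreover have "\<bar>\<phi> n\<bar> \<in> closure (Phi ` configs digit_bound (card (supp (digits (2 * n)))))"
        unfolding abs_\<phi> by (intro subsetD[OF closure_subset] imageI digits_in_configs)
      ultimately have "\<bar>\<phi> n\<bar> \<in> T" unfolding T_def by blast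
      moreover have "dist \<bar>\<phi> n\<bar> \<bar>z\<bar> < e" using d(1) by (simp add: dist_real_def)
      ultimately show ?thesis by blast
    qed
    ultimately have "\<bar>z\<bar> \<in> T" using closed_approachable by blast
    then show ?thesis unfolding S_def T_def by blast
  qed (simp add: S_def)
  have "closure (range \<phi>) \<subseteq> S \<union> uminus ` S"
  proof (intro subsetI)
    fix z assume z: "z \<in> closure (range \<phi>)"
    show "z \<in> S \<union> uminus ` S"
    proof (cases "z \<ge> 0")
      case False
      then show ?thesis using *[OF z] by (intro UnI2 image_eqI[of _ _ "\<bar>z\<bar>"]) auto
    qed (use *[OF z] in simp)
  qed
  then show ?thesis using S by (meson countable_Un countable_image countable_subset)
qed

end

section \<open>Limit points along multiples of a Pisot sequence\<close>

lemma prod_tendsto_nonzero: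
  fixes f :: "nat \<Rightarrow> real"
  assumes nz: "\<And>n. f n \<noteq> 0" and sum: "summable (\<lambda>n. \<bar>f n - 1\<bar>)"
  obtains L where "(\<lambda>n. \<Prod>k<n. f k) \<longlonglongrightarrow> L" "L \<noteq> 0"
proof -
  have "abs_convergent_prod f"
    using sum by (simp add: abs_convergent_prod_conv_summable)
  then have conv: "convergent_prod f" by (rule abs_convergent_prod_imp_convergent_prod)
  have "(\<lambda>n. \<Prod>k\<le>n. f k) \<longlonglongrightarrow> prodinf f" using conv by (rule convergent_prod_LIMSEQ)
  then have "(\<lambda>n. \<Prod>k<Suc n. f k) \<longlonglongrightarrow> prodinf f" by (simp only: lessThan_Suc_atMost)
  then have "(\<lambda>n. \<Prod>k<n. f k) \<longlonglongrightarrow> prodinf f" by (rule LIMSEQ_imp_Suc)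
  moreover have "prodinf f \<noteq> 0" using conv nz by (rule prodinf_nonzero)
  ultimately show thesis by (rule that)
qed

lemma infinite_if_small_nonzero:
  fixes S :: "'a :: real_normed_vector set"
  assumes "\<And>e. e > 0 \<Longrightarrow> \<exists>z\<in>S. z \<noteq> 0 \<and> norm z < e"
  shows "infinite S"
proof
  assume fin: "finite S"
  define d where "d = Min (insert 1 (norm ` (S - {0})))"
  have "d > 0" using fin by (auto simp: d_def)
  then obtain z where z: "z \<in> S" "z \<noteq> 0" "norm z < d" using assms by blast
  have "d \<le> norm z" unfolding d_def using fin z by (intro Min_le) auto
  then show False using z(3) by simp
qed

context pisot_recurrence
begin

text \<open>\<open>u m\<close> is the \<open>m\<close>-th coefficient of \<open>1 / ((1 - \<theta> x) B)\<close>, and \<open>\<beta>\<close> below is its leading constant.\<close>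

definition u :: "nat \<Rightarrow> real" where
  "u m = (\<Sum>i\<le>m. \<theta> ^ i * c (m - i))"

text \<open>In generating functions \<open>u\<close> is the geometric series of \<theta> times
  \<open>c\<close>, and the two factors of \<open>A\<close> invert one of these each.\<close>

lemma u_recurrence: "(\<Sum>i\<le>m. of_int (coeff A i) * u (m - i)) = (if m = 0 then 1 else 0)"
proof -
  let ?g = "Abs_fps (\<lambda>n. \<theta> ^ n)" and ?c = "Abs_fps c"
  have geo: "fps_of_poly [:1, - \<theta>:] * ?g = 1"
  proof (rule fps_ext)
    fix n
    show "fps_nth (fps_of_poly [:1, - \<theta>:] * ?g) n = fps_nth 1 n"
    proof (cases n)
      case (Suc k)
      have "fps_nth (fps_of_poly [:1, - \<theta>:] * ?g) n = (\<Sum>i\<le>Suc k. coeff [:1, - \<theta>:] i * \<theta> ^ (Suc k - i))"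
        by (simp add: fps_mult_nth atLeast0AtMost Suc)
      also have "\<dots> = (\<Sum>i\<in>{0, 1}. coeff [:1, - \<theta>:] i * \<theta> ^ (Suc k - i))"
        by (rule sum.mono_neutral_right) (auto simp: coeff_pCons split: nat.split)
      finally show ?thesis by (simp add: Suc)
    qed (simp add: fps_mult_nth)
  qed
  have "fps_of_poly (map_poly of_int A) * (?g * ?c) = (fps_of_poly [:1, - \<theta>:] * ?g) * (fps_of_poly B * ?c)"
    unfolding AB fps_of_poly_mult by (simp only: mult_ac)
  then have "fps_of_poly (map_poly of_int A) * (?g * ?c) = 1" unfolding geo Bc by simp
  then have "fps_nth (fps_of_poly (map_poly of_int A) * (?g * ?c)) m = (if m = 0 then 1 else 0)" by simp
  moreover have "fps_nth (?g * ?c) n = u n" for n by (simp add: fps_mult_nth u_def atLeast0AtMost)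
  ultimately show ?thesis by (simp add: fps_mult_nth[of "fps_of_poly (map_poly of_int A)"] atLeast0AtMost coeff_map_poly)
qed

text \<open>Constant coefficient 1 lets the integer recurrence be solved for \<open>u m\<close>
  without division.\<close>

lemma u_Ints: "u m \<in> \<int>"
proof (induction m rule: less_induct)
  case (less m)
  have "u m + (\<Sum>i<m. of_int (coeff A (Suc i)) * u (m - Suc i)) = (if m = 0 then 1 else 0)"
    using u_recurrence[of m] A0 by (simp add: sum.atMost_shift)
  then have "u m = (if m = 0 then 1 else 0) - (\<Sum>i<m. of_int (coeff A (Suc i)) * u (m - Suc i))"
    by linarith
  moreover have "(\<Sum>i<m. of_int (coeff A (Suc i)) * u (m - Suc i)) \<in> \<int>"
    by (intro Ints_sum Ints_mult less) auto
  ultimately show ?case by (simp add: Ints_diff)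
qed

definition \<beta> :: real where "\<beta> = (\<Sum>i. c i / \<theta> ^ i)"

lemma summable_beta: "summable (\<lambda>i. c i / \<theta> ^ i)"
proof (rule summable_comparison_test'[where g = "\<lambda>n. \<bar>c n\<bar>" and N = 0])
  show "norm (c n / \<theta> ^ n) \<le> \<bar>c n\<bar>" for n
    using theta by (simp add: abs_divide divide_le_eq_1 field_simps mult_le_cancel_left1 one_le_power)
qed (rule summable_c)

text \<open>Applying \<open>invert_recurrence\<close> to the powers of 1/\<theta> gives \<beta>
  B(1/\<theta>) = 1.\<close>

lemma beta_nonzero: "\<beta> \<noteq> 0"
proof
  assume "\<beta> = 0"
  have "(\<lambda>m. c m * (\<Sum>i\<le>degree B. coeff B i * (1 / \<theta>) ^ (m + i))) sums ((1 / \<theta>) ^ 0)"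
    using theta by (intro invert_recurrence[where W = 1]) (auto simp: power_le_one)
  moreover have "c m * (\<Sum>i\<le>degree B. coeff B i * (1 / \<theta>) ^ (m + i)) = c m / \<theta> ^ m * poly B (1 / \<theta>)" for m
    by (simp add: poly_altdef power_add power_divide sum_distrib_left mult_ac)
  moreover have "(\<lambda>m. c m / \<theta> ^ m * poly B (1 / \<theta>)) sums (\<beta> * poly B (1 / \<theta>))"
    unfolding \<beta>_def by (intro sums_mult2 summable_sums summable_beta)
  ultimately show False using \<open>\<beta> = 0\<close> sums_unique2 by fastforce
qed

text \<open>\<open>u m\<close> is \<theta>^m times a partial sum of the series for \<beta>. The
  factor \<theta>^m cancels against the denominators of the tail, and the decay of \<open>c\<close>
  leaves \<rho>^m.\<close>

lemma u_approx: "\<bar>u m - \<beta> * \<theta> ^ m\<bar> \<le> H * \<rho> ^ m"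
proof -
  have "\<beta> = (\<Sum>i. c (i + Suc m) / \<theta> ^ (i + Suc m)) + (\<Sum>i<Suc m. c i / \<theta> ^ i)"
    unfolding \<beta>_def by (rule suminf_split_initial_segment[OF summable_beta])
  moreover have "(\<Sum>i<Suc m. c i / \<theta> ^ i) * \<theta> ^ m = u m"
  proof -
    have "(\<Sum>i<Suc m. c i / \<theta> ^ i) * \<theta> ^ m = (\<Sum>i\<le>m. \<theta> ^ (m - i) * c i)"
      unfolding sum_distrib_right lessThan_Suc_atMost using theta
      by (intro sum.cong) (auto simp: power_diff)
    also have "\<dots> = u m" unfolding u_def
      using sum.nat_diff_reindex[of "\<lambda>i. \<theta> ^ i * c (m - i)" "Suc m"]
      by (simp add: lessThan_Suc_atMost)
    finally show ?thesis .
  qed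
  ultimately have "u m - \<beta> * \<theta> ^ m = - ((\<Sum>i. c (i + Suc m) / \<theta> ^ (i + Suc m)) * \<theta> ^ m)"
    by (simp add: distrib_right)
  also have "\<bar>\<dots>\<bar> = \<bar>\<Sum>i. c (i + Suc m) / \<theta> ^ (i + Suc m)\<bar> * \<theta> ^ m"
    using theta by (simp add: abs_mult)
  also have "\<bar>\<Sum>i. c (i + Suc m) / \<theta> ^ (i + Suc m)\<bar> \<le> (\<Sum>i. C * \<rho> ^ m / \<theta> ^ m * \<rho> ^ i)"
  proof -
    have b: "\<bar>c (i + Suc m) / \<theta> ^ (i + Suc m)\<bar> \<le> C * \<rho> ^ m / \<theta> ^ m * \<rho> ^ i" for i
    proof -
      have "\<bar>c (i + Suc m)\<bar> \<le> C * \<rho> ^ (i + Suc m)" by (rule c_le)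
      also have "\<dots> \<le> C * \<rho> ^ (m + i)" using C rho by (intro mult_left_mono power_decreasing) auto
      finally have 1: "\<bar>c (i + Suc m)\<bar> \<le> C * \<rho> ^ m * \<rho> ^ i" by (simp add: power_add)
      have 2: "\<theta> ^ m \<le> \<theta> ^ (i + Suc m)" using theta by (intro power_increasing) auto
      have "\<bar>c (i + Suc m) / \<theta> ^ (i + Suc m)\<bar> = \<bar>c (i + Suc m)\<bar> / \<theta> ^ (i + Suc m)" using theta by (simp add: abs_divide)
      also have "\<dots> \<le> (C * \<rho> ^ m * \<rho> ^ i) / \<theta> ^ m" using 1 2 theta by (intro frac_le) auto
      finally show ?thesis by simp
    qed
    have s: "summable (\<lambda>i. C * \<rho> ^ m / \<theta> ^ m * \<rho> ^ i)" using rho by (intro summable_mult summable_geometric) auto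
    have "summable (\<lambda>i. \<bar>c (i + Suc m) / \<theta> ^ (i + Suc m)\<bar>)"
      by (rule summable_comparison_test'[OF s, of 0]) (use b in auto)
    then show ?thesis
      using b s by (intro order_trans[OF summable_rabs] suminf_le) auto
  qed
  also have "(\<Sum>i. C * \<rho> ^ m / \<theta> ^ m * \<rho> ^ i) = C * \<rho> ^ m / \<theta> ^ m * (1 / (1 - \<rho>))"
    using rho by (subst suminf_mult) (auto simp: suminf_geometric summable_geometric)
  also have "\<dots> * \<theta> ^ m = H * \<rho> ^ m" using theta by (simp add: H_def)
  finally show ?thesis using theta by simp
qed

text \<open>The quotient of two such values would be a rational positive power of \<theta>. Hence at
  most one denominator has to be cleared, which is why a single \<open>b\<close> exists.\<close>

lemma beta_rational_unique:
  assumes "\<beta> * \<theta> powi i \<in> \<rat>" "\<beta> * \<theta> powi j \<in> \<rat>"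
  shows "i = j"
proof -
  have False if ij: "i < j" "\<beta> * \<theta> powi i \<in> \<rat>" "\<beta> * \<theta> powi j \<in> \<rat>" for i j
  proof -
    have "\<theta> ^ nat (j - i) = \<theta> powi (j - i)" using ij by (simp add: power_int_def)
    also have "\<dots> = (\<beta> * \<theta> powi j) / (\<beta> * \<theta> powi i)"
      using theta beta_nonzero by (simp add: power_int_diff)
    also have "\<dots> \<in> \<rat>" using ij by (intro Rats_divide)
    finally show False using irrational_power[of "nat (j - i)"] ij(1) by simp
  qed
  then show ?thesis using assms by (meson linorder_neqE)
qed

lemma common_denominator:
  obtains b :: nat where "b > 0" "\<And>j. \<beta> * \<theta> powi j \<in> \<rat> \<Longrightarrow> b * (\<beta> * \<theta> powi j) \<in> \<int>"
proof (cases "\<exists>j. \<beta> * \<theta> powi j \<in> \<rat>")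
  case True
  then obtain j where j: "\<beta> * \<theta> powi j \<in> \<rat>" by blast
  then obtain p q :: int where pq: "q > 0" "\<beta> * \<theta> powi j = of_int p / of_int q"
    by (rule Rats_cases')
  show thesis
  proof (rule that[of "nat q"])
    fix i assume "\<beta> * \<theta> powi i \<in> \<rat>"
    then have "i = j" using j by (rule beta_rational_unique)
    then have "real (nat q) * (\<beta> * \<theta> powi i) = of_int p" using pq by simp
    then show "real (nat q) * (\<beta> * \<theta> powi i) \<in> \<int>" by simp
  qed (use pq in simp)
next
  case False
  then show thesis using that[of 1] by simp
qed

text \<open>At a zero, 4 b r \<beta> \<theta>^j would be an odd integer. Then \<beta> \<theta>^j is
  rational, \<open>b\<close> clears its denominator, and the same integer is divisible by 4.\<close>

lemma cos_nonzero:
  assumes b: "\<And>j. \<beta> * \<theta> powi j \<in> \<rat> \<Longrightarrow> real b * (\<beta> * \<theta> powi j) \<in> \<int>" and "b > 0" "r > 0"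
  shows "cos (2 * pi * (real b * real r * (\<beta> * \<theta> powi j))) \<noteq> 0"
proof
  assume "cos (2 * pi * (real b * real r * (\<beta> * \<theta> powi j))) = 0"
  then obtain i :: int where i: "odd i" "2 * pi * (real b * real r * (\<beta> * \<theta> powi j)) = of_int i * (pi / 2)"
    unfolding cos_zero_iff_int by blast
  then have "pi * (4 * (real b * real r * (\<beta> * \<theta> powi j))) = pi * of_int i" by simp
  then have eq: "4 * (real b * real r * (\<beta> * \<theta> powi j)) = of_int i" by (simp only: mult_cancel_left) simp
  then have "\<beta> * \<theta> powi j = of_int i / of_int (4 * int b * int r)" using assms(2,3) by (simp add: field_simps)
  then have "\<beta> * \<theta> powi j \<in> \<rat>" by simp
  then obtain k where k: "real b * (\<beta> * \<theta> powi j) = of_int k" using b by (blast elim: Ints_cases)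
  have "of_int i = 4 * (real r * (real b * (\<beta> * \<theta> powi j)))" using eq by (simp add: mult_ac)
  also have "\<dots> = of_int (4 * int r * k)" unfolding k by simp
  finally have "i = 4 * int r * k" by linarith
  then show False using i(1) by simp
qed

end


section \<open>The functional equation of the cosine product and its nonzero limit points\<close>

context pisot_recurrence
begin

lemma product_lipschitz:
  fixes \<phi> :: "real \<Rightarrow> real"
  assumes \<phi>: "\<And>t. (\<lambda>N. \<Prod>k<N. cos (2 * pi * t / \<theta> ^ k)) \<longlonglongrightarrow> \<phi> t"
  shows "\<bar>\<phi> s - \<phi> t\<bar> \<le> 2 * pi / (1 - 1 / \<theta>) * \<bar>s - t\<bar>"
proof (rule LIMSEQ_le_const2)
  show "(\<lambda>N. \<bar>(\<Prod>k<N. cos (2 * pi * s / \<theta> ^ k)) - (\<Prod>k<N. cos (2 * pi * t / \<theta> ^ k))\<bar>) \<longlonglongrightarrow> \<bar>\<phi> s - \<phi> t\<bar>"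
    by (intro tendsto_rabs tendsto_diff \<phi>)
  have "\<bar>(\<Prod>k<N. cos (2 * pi * s / \<theta> ^ k)) - (\<Prod>k<N. cos (2 * pi * t / \<theta> ^ k))\<bar>
      \<le> 2 * pi / (1 - 1 / \<theta>) * \<bar>s - t\<bar>" for N
  proof -
    have "\<bar>(\<Prod>k<N. cos (2 * pi * s / \<theta> ^ k)) - (\<Prod>k<N. cos (2 * pi * t / \<theta> ^ k))\<bar>
      \<le> (\<Sum>k<N. \<bar>cos (2 * pi * s / \<theta> ^ k) - cos (2 * pi * t / \<theta> ^ k)\<bar>)"
      unfolding real_norm_def[symmetric] by (rule norm_prod_diff) auto
    also have "\<dots> \<le> (\<Sum>k<N. 2 * pi * \<bar>s - t\<bar> * (1 / \<theta>) ^ k)"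
    proof (rule sum_mono)
      fix k
      have "\<bar>cos (2 * pi * s / \<theta> ^ k) - cos (2 * pi * t / \<theta> ^ k)\<bar> \<le> \<bar>2 * pi * s / \<theta> ^ k - 2 * pi * t / \<theta> ^ k\<bar>"
        by (rule abs_cos_diff_le)
      also have "2 * pi * s / \<theta> ^ k - 2 * pi * t / \<theta> ^ k = 2 * pi * (s - t) * (1 / \<theta>) ^ k"
        by (simp add: power_divide right_diff_distrib diff_divide_distrib)
      finally show "\<bar>cos (2 * pi * s / \<theta> ^ k) - cos (2 * pi * t / \<theta> ^ k)\<bar> \<le> 2 * pi * \<bar>s - t\<bar> * (1 / \<theta>) ^ k"
        using theta by (simp add: abs_mult)
    qed
    also have "\<dots> = 2 * pi * \<bar>s - t\<bar> * (\<Sum>k<N. (1 / \<theta>) ^ k)" by (simp only: sum_distrib_left)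
    also have "\<dots> \<le> 2 * pi * \<bar>s - t\<bar> * (1 / (1 - 1 / \<theta>))"
      using theta by (intro mult_left_mono sum_power_le) auto
    finally show ?thesis by simp
  qed
  then show "\<exists>N0. \<forall>N\<ge>N0. \<bar>(\<Prod>k<N. cos (2 * pi * s / \<theta> ^ k)) - (\<Prod>k<N. cos (2 * pi * t / \<theta> ^ k))\<bar>
      \<le> 2 * pi / (1 - 1 / \<theta>) * \<bar>s - t\<bar>" by blast
qed

text \<open>Splitting off the first factor at \<theta> s leaves the product at s; this functional
  equation is iterated \<open>m\<close> times.\<close>

lemma product_scale:
  fixes \<phi> :: "real \<Rightarrow> real"
  assumes \<phi>: "\<And>t. (\<lambda>N. \<Prod>k<N. cos (2 * pi * t / \<theta> ^ k)) \<longlonglongrightarrow> \<phi> t"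
  shows "\<phi> (\<theta> ^ m * t) = (\<Prod>j<m. cos (2 * pi * (\<theta> ^ Suc j * t))) * \<phi> t"
proof (induction m)
  case (Suc m)
  let ?s = "\<theta> ^ m * t"
  have "(\<lambda>N. \<Prod>k<Suc N. cos (2 * pi * (\<theta> * ?s) / \<theta> ^ k)) \<longlonglongrightarrow> \<phi> (\<theta> * ?s)"
    by (rule LIMSEQ_Suc[OF \<phi>])
  moreover have "(\<Prod>k<Suc N. cos (2 * pi * (\<theta> * ?s) / \<theta> ^ k)) = cos (2 * pi * (\<theta> * ?s)) * (\<Prod>k<N. cos (2 * pi * ?s / \<theta> ^ k))" for N
    using theta by (subst prod.lessThan_Suc_shift) (simp add: mult_ac)
  moreover have "(\<lambda>N. cos (2 * pi * (\<theta> * ?s)) * (\<Prod>k<N. cos (2 * pi * ?s / \<theta> ^ k))) \<longlonglongrightarrow> cos (2 * pi * (\<theta> * ?s)) * \<phi> ?s"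
    by (intro tendsto_mult tendsto_const \<phi>)
  ultimately have "\<phi> (\<theta> * ?s) = cos (2 * pi * (\<theta> * ?s)) * \<phi> ?s"
    using LIMSEQ_unique by simp
  then show ?case using Suc by (simp add: mult_ac)
qed simp

lemma product_nonzero:
  fixes \<phi> :: "real \<Rightarrow> real"
  assumes \<phi>: "\<And>t. (\<lambda>N. \<Prod>k<N. cos (2 * pi * t / \<theta> ^ k)) \<longlonglongrightarrow> \<phi> t"
    and nz: "\<And>k. cos (2 * pi * t / \<theta> ^ k) \<noteq> 0"
  shows "\<phi> t \<noteq> 0"
proof -
  have "summable (\<lambda>k. \<bar>cos (2 * pi * t / \<theta> ^ k) - 1\<bar>)"
  proof (rule summable_comparison_test'[where g = "\<lambda>k. 2 * pi * \<bar>t\<bar> * (1 / \<theta>) ^ k" and N = 0])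
    show "summable (\<lambda>k. 2 * pi * \<bar>t\<bar> * (1 / \<theta>) ^ k)" using theta by (intro summable_mult summable_geometric) auto
    show "norm \<bar>cos (2 * pi * t / \<theta> ^ k) - 1\<bar> \<le> 2 * pi * \<bar>t\<bar> * (1 / \<theta>) ^ k" for k
      using abs_cos_diff_le[of "2 * pi * t / \<theta> ^ k" 0] theta by (simp add: abs_mult power_divide)
  qed
  from prod_tendsto_nonzero[OF nz this] obtain L where "(\<lambda>n. \<Prod>k<n. cos (2 * pi * t / \<theta> ^ k)) \<longlonglongrightarrow> L" "L \<noteq> 0" .
  then show ?thesis using \<phi>[of t] LIMSEQ_unique by blast
qed

lemma product_le_factor:
  fixes \<phi> :: "real \<Rightarrow> real"
  assumes \<phi>: "\<And>t. (\<lambda>N. \<Prod>k<N. cos (2 * pi * t / \<theta> ^ k)) \<longlonglongrightarrow> \<phi> t"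
  shows "\<bar>\<phi> t\<bar> \<le> \<bar>cos (2 * pi * t / \<theta> ^ k)\<bar>"
proof (rule LIMSEQ_le_const2)
  show "(\<lambda>N. \<bar>\<Prod>k<N. cos (2 * pi * t / \<theta> ^ k)\<bar>) \<longlonglongrightarrow> \<bar>\<phi> t\<bar>" by (intro tendsto_rabs \<phi>)
  have "\<bar>\<Prod>k<N. cos (2 * pi * t / \<theta> ^ k)\<bar> \<le> \<bar>cos (2 * pi * t / \<theta> ^ k)\<bar>" if "N \<ge> Suc k" for N
  proof -
    have "(\<Prod>k<N. \<bar>cos (2 * pi * t / \<theta> ^ k)\<bar>)
      = \<bar>cos (2 * pi * t / \<theta> ^ k)\<bar> * (\<Prod>k\<in>{..<N} - {k}. \<bar>cos (2 * pi * t / \<theta> ^ k)\<bar>)"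
      using that by (intro prod.remove) auto
    also have "\<dots> \<le> \<bar>cos (2 * pi * t / \<theta> ^ k)\<bar> * 1"
      by (intro mult_left_mono prod_le_1) auto
    finally show ?thesis by (simp add: abs_prod)
  qed
  then show "\<exists>N0. \<forall>N\<ge>N0. \<bar>\<Prod>k<N. cos (2 * pi * t / \<theta> ^ k)\<bar> \<le> \<bar>cos (2 * pi * t / \<theta> ^ k)\<bar>" by blast
qed

lemma u_unbounded: "filterlim (\<lambda>m. \<bar>u m\<bar>) at_top sequentially"
proof (rule filterlim_at_top_mono)
  have "filterlim (\<lambda>m. \<bar>\<beta>\<bar> * \<theta> ^ m) at_top sequentially"
    using theta beta_nonzero
    by (intro filterlim_tendsto_pos_mult_at_top[OF tendsto_const]
        filterlim_at_infinity_imp_filterlim_at_top filterlim_realpow_sequentially_gt1) auto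
  then show "filterlim (\<lambda>m. - H + \<bar>\<beta>\<bar> * \<theta> ^ m) at_top sequentially"
    by (rule filterlim_tendsto_add_at_top[OF tendsto_const])
  have "- H + \<bar>\<beta>\<bar> * \<theta> ^ m \<le> \<bar>u m\<bar>" for m
  proof -
    have "H * \<rho> ^ m \<le> H * 1" using H_pos rho by (intro mult_left_mono power_le_one) auto
    moreover have "\<bar>\<beta> * \<theta> ^ m\<bar> = \<bar>\<beta>\<bar> * \<theta> ^ m" using theta by (simp add: abs_mult)
    ultimately show ?thesis using u_approx[of m] by linarith
  qed
  then show "\<forall>\<^sub>F m in sequentially. - H + \<bar>\<beta>\<bar> * \<theta> ^ m \<le> \<bar>u m\<bar>" by simp
qed

text \<open>\<open>limit_points\<close> counts indices and not values, so convergence along indices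
  of unbounded modulus suffices, even for repeated values.\<close>

lemma limit_point_along:
  fixes f :: "int \<Rightarrow> 'b :: topological_space"
  assumes lim: "(\<lambda>m. f (n m)) \<longlonglongrightarrow> z" and unb: "filterlim (\<lambda>m. \<bar>n m\<bar>) at_top sequentially"
  shows "z \<in> limit_points f"
  unfolding limit_points_def
proof safe
  fix U assume U: "open U" "z \<in> U" and fin: "finite {i. f i \<in> U}"
  then have "finite (abs ` {i. f i \<in> U})" by simp
  then obtain K where K: "\<And>i. f i \<in> U \<Longrightarrow> \<bar>i\<bar> \<le> K"
    using bdd_above_finite unfolding bdd_above_def by fastforce
  have "\<forall>\<^sub>F m in sequentially. f (n m) \<in> U" using lim U by (rule topological_tendstoD)
  moreover have "\<forall>\<^sub>F m in sequentially. K + 1 \<le> \<bar>n m\<bar>" using unb by (simp add: filterlim_at_top)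
  ultimately have "\<forall>\<^sub>F m in sequentially. False"
    by eventually_elim (use K in force)
  then show False by simp
qed

text \<open>The integers b r u_m lie within O(\<rho>^m) of \<theta>^m t, where t = b r \<beta>. The
  functional equation gives the value there as that at t times cosines at near-integer multiples of
  2 pi. These tend to 1 geometrically and none vanishes, so their product has a nonzero limit
  \<open>L\<close>.\<close>

lemma limit_point_values:
  fixes \<phi> :: "real \<Rightarrow> real"
  assumes \<phi>: "\<And>t. (\<lambda>N. \<Prod>k<N. cos (2 * pi * t / \<theta> ^ k)) \<longlonglongrightarrow> \<phi> t"
    and b: "\<And>j. \<beta> * \<theta> powi j \<in> \<rat> \<Longrightarrow> real b * (\<beta> * \<theta> powi j) \<in> \<int>" "b > 0" and r: "r > 0"
  obtains z where "z \<noteq> 0" "z \<in> limit_points (\<lambda>n :: int. complex_of_real (\<phi> (of_int n)))"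
    and "\<And>k. norm z \<le> \<bar>cos (2 * pi * (real b * real r * \<beta>) / \<theta> ^ k)\<bar>"
proof -
  define t where "t = real b * real r * \<beta>"
  have nz: "cos (2 * pi * (t * \<theta> powi j)) \<noteq> 0" for j
    using cos_nonzero[OF b r, of j] by (simp add: t_def mult_ac)
  have nz1: "cos (2 * pi * (\<theta> ^ Suc j * t)) \<noteq> 0" for j
    using nz[of "int (Suc j)"] unfolding power_int_of_nat mult.commute[of t] .
  have nz2: "cos (2 * pi * t / \<theta> ^ k) \<noteq> 0" for k
    using nz[of "- int k"] by (simp add: power_int_minus power_int_of_nat divide_inverse mult.assoc)
  have int: "real b * real r * u m \<in> \<int>" for m by (intro Ints_mult u_Ints) auto
  define n where "n m = \<lfloor>real b * real r * u m\<rfloor>" for m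
  have n: "of_int (n m) = real b * real r * u m" for m using int[of m] by (auto simp: n_def elim!: Ints_cases)
  have diff: "\<bar>of_int (n m) - \<theta> ^ m * t\<bar> \<le> real b * real r * H * \<rho> ^ m" for m
  proof -
    have "of_int (n m) - \<theta> ^ m * t = real b * real r * (u m - \<beta> * \<theta> ^ m)"
      by (simp add: n t_def algebra_simps)
    also have "\<bar>\<dots>\<bar> \<le> real b * real r * (H * \<rho> ^ m)"
      unfolding abs_mult using u_approx[of m] by (intro mult_mono) auto
    finally show ?thesis by (simp add: mult.assoc)
  qed
  have "summable (\<lambda>j. \<bar>cos (2 * pi * (\<theta> ^ Suc j * t)) - 1\<bar>)"
  proof (rule summable_comparison_test'[where g = "\<lambda>j. 2 * pi * (real b * real r * H) * \<rho> ^ Suc j" and N = 0])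
    show "summable (\<lambda>j. 2 * pi * (real b * real r * H) * \<rho> ^ Suc j)"
      using rho by (intro summable_mult summable_Suc_iff[THEN iffD2] summable_geometric) auto
    fix j
    have "cos (2 * pi * of_int (n (Suc j))) = 1" by (rule cos_int_2pin)
    then have "\<bar>cos (2 * pi * (\<theta> ^ Suc j * t)) - 1\<bar> \<le> \<bar>2 * pi * (\<theta> ^ Suc j * t) - 2 * pi * of_int (n (Suc j))\<bar>"
      using abs_cos_diff_le[of "2 * pi * (\<theta> ^ Suc j * t)" "2 * pi * of_int (n (Suc j))"] by simp
    also have "\<dots> = 2 * pi * \<bar>of_int (n (Suc j)) - \<theta> ^ Suc j * t\<bar>"
      unfolding right_diff_distrib[symmetric] abs_mult by (simp add: abs_minus_commute)
    also have "\<dots> \<le> 2 * pi * (real b * real r * H * \<rho> ^ Suc j)" by (intro mult_left_mono diff) simp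
    finally show "norm \<bar>cos (2 * pi * (\<theta> ^ Suc j * t)) - 1\<bar> \<le> 2 * pi * (real b * real r * H) * \<rho> ^ Suc j"
      by (simp add: mult.assoc)
  qed
  from prod_tendsto_nonzero[OF nz1 this] obtain L where
    L: "(\<lambda>m. \<Prod>j<m. cos (2 * pi * (\<theta> ^ Suc j * t))) \<longlonglongrightarrow> L" "L \<noteq> 0" .
  have scaled: "(\<lambda>m. \<phi> (\<theta> ^ m * t)) \<longlonglongrightarrow> L * \<phi> t"
    unfolding product_scale[OF \<phi>] by (intro tendsto_mult tendsto_const L)
  \<comment> \<open>The Lipschitz bound transfers the limit from the points \<theta>^m t to the
    nearby integers.\<close>
  have "(\<lambda>m. \<phi> (of_int (n m)) - \<phi> (\<theta> ^ m * t)) \<longlonglongrightarrow> 0"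
  proof (rule Lim_null_comparison)
    let ?K = "2 * pi / (1 - 1 / \<theta>)"
    have "\<bar>\<phi> (of_int (n m)) - \<phi> (\<theta> ^ m * t)\<bar> \<le> ?K * (real b * real r * H * \<rho> ^ m)" for m
    proof -
      have "\<bar>\<phi> (of_int (n m)) - \<phi> (\<theta> ^ m * t)\<bar> \<le> ?K * \<bar>of_int (n m) - \<theta> ^ m * t\<bar>" by (rule product_lipschitz[OF \<phi>])
      also have "\<dots> \<le> ?K * (real b * real r * H * \<rho> ^ m)" using theta by (intro mult_left_mono diff) auto
      finally show ?thesis .
    qed
    then show "\<forall>\<^sub>F m in sequentially. norm (\<phi> (of_int (n m)) - \<phi> (\<theta> ^ m * t)) \<le> ?K * (real b * real r * H * \<rho> ^ m)" by simp
    have "(\<lambda>m. ?K * (real b * real r * H * \<rho> ^ m)) \<longlonglongrightarrow> ?K * (real b * real r * H * 0)"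
      using rho by (intro tendsto_mult tendsto_const LIMSEQ_realpow_zero) auto
    then show "(\<lambda>m. ?K * (real b * real r * H * \<rho> ^ m)) \<longlonglongrightarrow> 0" by simp
  qed
  from tendsto_add[OF this scaled] have lim: "(\<lambda>m. \<phi> (of_int (n m))) \<longlonglongrightarrow> L * \<phi> t" by simp
  have unb: "filterlim (\<lambda>m. \<bar>n m\<bar>) at_top sequentially"
  proof -
    have "filterlim (\<lambda>m. real b * real r * \<bar>u m\<bar>) at_top sequentially"
      using b(2) r by (intro filterlim_tendsto_pos_mult_at_top[OF tendsto_const _ u_unbounded]) auto
    moreover have "real b * real r * \<bar>u m\<bar> = of_int \<bar>n m\<bar>" for m by (simp add: n abs_mult)
    ultimately have "filterlim (\<lambda>m. real_of_int \<bar>n m\<bar>) at_top sequentially" by simp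
    then show ?thesis
      unfolding filterlim_at_top
    proof (intro allI)
      fix Z :: int
      assume *: "\<forall>Z. \<forall>\<^sub>F x in sequentially. Z \<le> real_of_int \<bar>n x\<bar>"
      from *[rule_format, of "of_int Z"] show "\<forall>\<^sub>F x in sequentially. Z \<le> \<bar>n x\<bar>"
        by (simp only: of_int_le_iff)
    qed
  qed
  show thesis
  proof (rule that[of "complex_of_real (L * \<phi> t)"])
    show "complex_of_real (L * \<phi> t) \<noteq> 0" using L(2) product_nonzero[OF \<phi> nz2] by simp
    show "complex_of_real (L * \<phi> t) \<in> limit_points (\<lambda>n :: int. complex_of_real (\<phi> (of_int n)))"
      by (rule limit_point_along[OF tendsto_of_real[OF lim] unb])
    \<comment> \<open>Since \<open>L\<close> contributes a factor of modulus at most 1, each single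
      cosine in the product at \<open>t\<close> bounds the limit point; this is the handle for
      making it small.\<close>
    have "\<bar>L * \<phi> t\<bar> \<le> \<bar>\<phi> t\<bar>"
    proof (rule LIMSEQ_le_const2)
      show "(\<lambda>m. \<bar>\<phi> (\<theta> ^ m * t)\<bar>) \<longlonglongrightarrow> \<bar>L * \<phi> t\<bar>" by (intro tendsto_rabs scaled)
      have "\<bar>\<phi> (\<theta> ^ m * t)\<bar> \<le> \<bar>\<phi> t\<bar>" for m
        unfolding product_scale[OF \<phi>] abs_mult abs_prod
        by (intro mult_left_le_one_le prod_le_1 prod_nonneg) auto
      then show "\<exists>N. \<forall>m\<ge>N. \<bar>\<phi> (\<theta> ^ m * t)\<bar> \<le> \<bar>\<phi> t\<bar>" by blast
    qed
    then show "norm (complex_of_real (L * \<phi> t)) \<le> \<bar>cos (2 * pi * (real b * real r * \<beta>) / \<theta> ^ k)\<bar>" for k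
      using product_le_factor[OF \<phi>, of t k] unfolding norm_of_real t_def by linarith
  qed
qed

lemma infinite_limit_points:
  fixes \<phi> :: "real \<Rightarrow> real"
  assumes \<phi>: "\<And>t. (\<lambda>N. \<Prod>k<N. cos (2 * pi * t / \<theta> ^ k)) \<longlonglongrightarrow> \<phi> t"
  shows "infinite (limit_points (\<lambda>n :: int. complex_of_real (\<phi> (of_int n))))"
proof (rule infinite_if_small_nonzero)
  fix e :: real assume e: "e > 0"
  obtain b :: nat where b: "b > 0" "\<And>j. \<beta> * \<theta> powi j \<in> \<rat> \<Longrightarrow> b * (\<beta> * \<theta> powi j) \<in> \<int>"
    using common_denominator by blast
  \<comment> \<open>Negative exponents are wanted, since only the factors cos(2 pi t/\<theta>^k) of
    the product at \<open>t\<close> are available; of two exponents at least one gives an irrational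
    number.\<close>
  have "\<beta> * \<theta> powi (- int 1) \<notin> \<rat> \<or> \<beta> * \<theta> powi (- int 2) \<notin> \<rat>"
    using beta_rational_unique[of "- int 1" "- int 2"] by auto
  then obtain k where k: "\<beta> * \<theta> powi (- int k) \<notin> \<rat>" by blast
  define \<alpha> where "\<alpha> = 2 * real b * (\<beta> * \<theta> powi (- int k))"
  have "\<alpha> \<notin> \<rat>"
  proof
    assume "\<alpha> \<in> \<rat>"
    then have "\<alpha> / (2 * real b) \<in> \<rat>" by (intro Rats_divide) auto
    moreover have "\<alpha> / (2 * real b) = \<beta> * \<theta> powi (- int k)" using b(1) by (simp add: \<alpha>_def)
    ultimately show False using k by simp
  qed
  \<comment> \<open>The angle 2 pi b r \<beta>/\<theta>^k equals pi r \<alpha>; moving r \<alpha>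
    modulo 1 close to 1/2 puts it close to a zero of the cosine.\<close>
  then obtain r :: nat where r: "r > 0" "\<bar>frac (real r * \<alpha>) - 1 / 2\<bar> < e / pi"
    using Kronecker_approx_1_explicit[of \<alpha> "1 / 2" "e / pi"] e by auto
  have "\<bar>cos (2 * pi * (real b * real r * \<beta>) / \<theta> ^ k)\<bar> < e"
  proof -
    let ?f = "frac (real r * \<alpha>)"
    have "2 * pi * (real b * real r * \<beta>) / \<theta> ^ k = pi * (of_int \<lfloor>real r * \<alpha>\<rfloor> + ?f)"
      by (simp add: frac_def \<alpha>_def power_int_minus power_int_of_nat divide_inverse mult_ac)
    then have "\<bar>cos (2 * pi * (real b * real r * \<beta>) / \<theta> ^ k)\<bar> = \<bar>cos (pi * ?f)\<bar>"
      by (simp only: abs_cos_pi_add_int)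
    also have "\<dots> = \<bar>sin (pi / 2 - pi * ?f)\<bar>" by (simp add: sin_diff)
    also have "\<dots> \<le> \<bar>pi / 2 - pi * ?f\<bar>" by (rule abs_sin_x_le_abs_x)
    also have "pi / 2 - pi * ?f = pi * - (?f - 1 / 2)" by (simp add: algebra_simps)
    also have "\<bar>\<dots>\<bar> = pi * \<bar>?f - 1 / 2\<bar>" unfolding abs_mult abs_minus_cancel by simp
    also have "\<dots> < e" using r(2) by (simp add: field_simps)
    finally show ?thesis .
  qed
  moreover obtain z where "z \<noteq> 0" "z \<in> limit_points (\<lambda>n :: int. complex_of_real (\<phi> (of_int n)))"
    "\<And>k. norm z \<le> \<bar>cos (2 * pi * (real b * real r * \<beta>) / \<theta> ^ k)\<bar>"
    using limit_point_values[OF \<phi> b(2,1) r(1)] by blast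
  ultimately show "\<exists>z\<in>limit_points (\<lambda>n :: int. complex_of_real (\<phi> (of_int n))). z \<noteq> 0 \<and> norm z < e"
    by (meson le_less_trans)
qed

end

section \<open>Convolution operators on the circle\<close>

text \<open>The representative in [0, 1) is a measurable section of the projection; through it,
  measurability questions are settled on the real line.\<close>

lift_definition circle_rep :: "circle \<Rightarrow> real" is frac
proof -
  fix x y :: real assume "x - y \<in> \<int>"
  then obtain k where "x = y + of_int k" by (metis Ints_cases add.commute diff_add_cancel)
  then show "frac x = frac y" by (simp add: frac_def)
qed

lemma circle_rep_circle_of: "circle_rep (circle_of x) = frac x"
  by transfer simp

lemma circle_rep_0 [simp]: "circle_rep 0 = 0"
  by transfer simp

lemma circle_of_frac: "circle_of (frac x) = circle_of x"
  by transfer (simp add: frac_def)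

lemma circle_of_rep [simp]: "circle_of (circle_rep x) = x"
proof -
  obtain y where "x = circle_of y" using surj_circle_of by (metis surjD)
  then show ?thesis by (simp add: circle_rep_circle_of circle_of_frac)
qed

lemma circle_of_minus: "circle_of (x - y) = circle_of x - circle_of y"
  by transfer simp

lemma circle_of_add: "circle_of (x + y) = circle_of x + circle_of y"
  by transfer simp

lemma circle_of_eq_iff: "circle_of x = circle_of y \<longleftrightarrow> x - y \<in> \<int>"
  by transfer simp

lemma circle_of_of_int [simp]: "circle_of (of_int k) = 0"
  by transfer simp

lemma open_circle_of_image:
  assumes "open U"
  shows "open (circle_of ` U)"
proof -
  have "circle_of -` (circle_of ` U) = (\<Union>k :: int. (\<lambda>x. x + of_int k) ` U)"
  proof safe
    fix x u assume "circle_of x = circle_of u" "u \<in> U"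
    then obtain k where "x = u + of_int k" by (metis Ints_cases add.commute circle_of_eq_iff diff_add_cancel)
    then show "x \<in> (\<Union>k :: int. (\<lambda>x. x + of_int k) ` U)" using \<open>u \<in> U\<close> by blast
  qed (auto simp: circle_of_add)
  moreover have "open ((\<lambda>x. x + of_int k) ` U)" for k :: int
    using open_translation[OF assms, of "of_int k"] by (simp add: add.commute)
  ultimately show ?thesis unfolding open_circle_def by (simp add: open_UN)
qed

text \<open>A nonempty sublevel set is the closed point 0 together with the image of an open
  interval, and the projection is an open map.\<close>

lemma measurable_circle_rep [measurable]: "circle_rep \<in> borel_measurable borel"
proof (rule borel_measurableI_less)
  fix a :: real
  have open_arc: "circle_of ` {0<..<b} \<in> sets borel" for b
    by (intro borel_open open_circle_of_image) simp
  have zero: "{0 :: circle} \<in> sets borel"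
  proof (rule borel_closed)
    have "circle_of -` (- {0}) = - \<int>"
      using circle_of_eq_iff[of _ 0] by (auto simp flip: circle_of_of_int[of 0])
    then have "open (- {0 :: circle})" unfolding open_circle_def by (simp add: closed_of_int_image open_Compl flip: Ints_def)
    then show "closed {0 :: circle}" by (simp add: closed_def)
  qed
  have rep: "0 \<le> circle_rep x" "circle_rep x < 1" for x
    by (transfer, simp add: frac_lt_1)+
  have "{x \<in> space borel. circle_rep x < a} =
    (if a \<le> 0 then {} else {0} \<union> circle_of ` {0<..<min a 1})"
  proof (cases "a \<le> 0")
    case True
    then show ?thesis using rep(1) by (auto simp: not_less intro: order_trans)
  next
    case False
    have "circle_rep x = 0 \<longleftrightarrow> x = 0" for x
      by transfer (auto simp: frac_eq_0_iff)
    moreover have "x \<in> circle_of ` {0<..<min a 1}" if "circle_rep x < a" "circle_rep x \<noteq> 0" for x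
      using that rep[of x] by (intro image_eqI[of _ _ "circle_rep x"]) auto
    moreover have "circle_rep (circle_of y) < a" if "y \<in> {0<..<min a 1}" for y
      using that by (simp add: circle_rep_circle_of frac_eq[THEN iffD2])
    ultimately show ?thesis using False by auto
  qed
  then show "{x \<in> space borel. circle_rep x < a} \<in> sets borel"
    using sets.Un[OF zero open_arc[of "min a 1"]] by simp
qed

lemma measurable_circle_diff [measurable (raw)]:
  assumes [measurable]: "f \<in> M \<rightarrow>\<^sub>M (borel :: circle measure)" "g \<in> M \<rightarrow>\<^sub>M (borel :: circle measure)"
  shows "(\<lambda>x. f x - g x) \<in> M \<rightarrow>\<^sub>M borel"
proof -
  have "(\<lambda>x. f x - g x) = (\<lambda>x. circle_of (circle_rep (f x) - circle_rep (g x)))"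
    by (simp add: circle_of_minus)
  then show ?thesis by simp
qed

lemma sets_haar_circle [measurable_cong, simp]: "sets haar_circle = sets borel"
  by (simp add: haar_circle_def)

lemma measurable_haar_circle [simp]: "measurable haar_circle N = measurable borel N"
  by (rule measurable_cong_sets) simp_all

lemma space_haar_circle [simp]: "space haar_circle = UNIV"
  by (simp add: haar_circle_def)

lemma nn_integral_haar_circle:
  assumes [measurable]: "f \<in> borel_measurable borel"
  shows "(\<integral>\<^sup>+x. f x \<partial>haar_circle) = (\<integral>\<^sup>+x. f (circle_of x) * indicator {0..<1} x \<partial>lborel)"
  unfolding haar_circle_def
  by (subst nn_integral_distr) (auto simp: nn_integral_restrict_space intro!: measurable_restrict_space1)

interpretation haar: prob_space haar_circle
proof
  have "emeasure haar_circle (space haar_circle) = (\<integral>\<^sup>+x. 1 \<partial>haar_circle)" by simp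
  also have "\<dots> = 1" by (subst nn_integral_haar_circle) simp_all
  finally show "emeasure haar_circle (space haar_circle) = 1" .
qed

text \<open>The window [s, s+1) is cut at the integer \<open>n\<close>; moving its left piece by 1
  turns it into [n, n+1), and integer translations preserve the integrand.\<close>

lemma nn_integral_periodic_shift:
  fixes f :: "circle \<Rightarrow> ennreal"
  assumes [measurable]: "f \<in> borel_measurable borel"
  shows "(\<integral>\<^sup>+x. f (circle_of x) * indicator {s..<s + 1} x \<partial>lborel)
    = (\<integral>\<^sup>+x. f (circle_of x) * indicator {0..<1} x \<partial>lborel)"
proof -
  define n where "n = \<lceil>s\<rceil>"
  have n: "s \<le> of_int n" "of_int n < s + 1" unfolding n_def by linarith+
  define I where "I a b = (\<integral>\<^sup>+x. f (circle_of x) * indicator {a..<b} x \<partial>lborel)" for a b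
  have split: "I a c = I a b + I b c" if "a \<le> b" "b \<le> c" for a b c
  proof -
    have "I a c = (\<integral>\<^sup>+x. f (circle_of x) * indicator {a..<b} x + f (circle_of x) * indicator {b..<c} x \<partial>lborel)"
      unfolding I_def using that by (intro nn_integral_cong) (auto simp: indicator_def)
    then show ?thesis unfolding I_def by (subst (asm) nn_integral_add) auto
  qed
  have shift: "I (a + of_int k) (b + of_int k) = I a b" for a b and k :: int
  proof -
    have "I (a + of_int k) (b + of_int k)
      = (\<integral>\<^sup>+x. f (circle_of x) * indicator {a + of_int k..<b + of_int k} x \<partial>distr lborel borel (\<lambda>x. of_int k + x))"
      unfolding I_def by (subst lborel_distr_plus) simp
    also have "\<dots> = (\<integral>\<^sup>+x. f (circle_of (of_int k + x)) * indicator {a + of_int k..<b + of_int k} (of_int k + x) \<partial>lborel)"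
      by (subst nn_integral_distr) auto
    also have "\<dots> = I a b"
      unfolding I_def by (intro nn_integral_cong) (auto simp: circle_of_add indicator_def)
    finally show ?thesis .
  qed
  have "I s (s + 1) = I s (of_int n) + I (of_int n) (s + 1)" using n by (intro split) auto
  also have "I s (of_int n) = I (s + 1) (of_int n + 1)" using shift[of s 1 "of_int n"] by simp
  also have "I (s + 1) (of_int n + 1) + I (of_int n) (s + 1) = I (of_int n) (of_int n + 1)"
    using n by (subst split[of "of_int n" "s + 1" "of_int n + 1"]) (auto simp: add.commute)
  also have "\<dots> = I 0 1" using shift[of 0 n 1] by (simp add: add.commute)
  finally show ?thesis by (simp add: I_def)
qed

lemma nn_integral_haar_diff:
  assumes [measurable]: "f \<in> borel_measurable borel"
  shows "(\<integral>\<^sup>+x. f (x - y) \<partial>haar_circle) = (\<integral>\<^sup>+x. f x \<partial>haar_circle)"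
proof -
  define s where "s = circle_rep y"
  have "(\<integral>\<^sup>+x. f (x - y) \<partial>haar_circle) = (\<integral>\<^sup>+x. f (circle_of x - y) * indicator {0..<1} x \<partial>lborel)"
    by (rule nn_integral_haar_circle) simp
  also have "\<dots> = (\<integral>\<^sup>+x. f (circle_of (x - s)) * indicator {0..<1} x \<partial>distr lborel borel (\<lambda>x. s + x))"
    by (subst lborel_distr_plus) (simp add: circle_of_minus s_def)
  also have "\<dots> = (\<integral>\<^sup>+x. f (circle_of x) * indicator {- s..<- s + 1} x \<partial>lborel)"
    by (subst nn_integral_distr) (auto intro!: nn_integral_cong simp: indicator_def)
  also have "\<dots> = (\<integral>\<^sup>+x. f x \<partial>haar_circle)"
    by (simp only: nn_integral_periodic_shift[OF assms] nn_integral_haar_circle[OF assms])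
  finally show ?thesis .
qed

lemma measurable_circle_char [measurable]: "circle_char n \<in> borel_measurable borel"
proof -
  have "circle_char n = (\<lambda>x. cis (2 * pi * of_int n * circle_rep x))"
    by (metis circle_char_circle_of circle_of_rep)
  moreover have "cis \<in> borel_measurable borel"
    by (intro borel_measurable_continuous_onI continuous_intros)
  ultimately show ?thesis by simp
qed

lemma circle_char_minus: "circle_char n (x - y) = circle_char n x * cnj (circle_char n y)"
  by transfer (simp add: cis_cnj cis_mult right_diff_distrib)

lemma norm_circle_char [simp]: "norm (circle_char n x) = 1"
  by transfer simp

section \<open>Convolution with a probability measure as a contraction, defined almost
  everywhere\<close>

locale circle_measure = prob_space \<nu> for \<nu> :: "circle measure" +
  assumes sets_nu [measurable_cong, simp]: "sets \<nu> = sets borel"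
begin

text \<open>Fubini and translation invariance: averaging translates preserves the integral. The
  almost-everywhere statements and the bounds in \<open>L^1\<close> and \<open>L^2\<close> all rest
  on this.\<close>

lemma nn_integral_convolution_haar:
  assumes [measurable]: "f \<in> borel_measurable borel"
  shows "(\<integral>\<^sup>+x. \<integral>\<^sup>+y. f (x - y) \<partial>\<nu> \<partial>haar_circle) = (\<integral>\<^sup>+x. f x \<partial>haar_circle)"
proof -
  interpret pair_sigma_finite haar_circle \<nu> ..
  have "(\<integral>\<^sup>+x. \<integral>\<^sup>+y. f (x - y) \<partial>\<nu> \<partial>haar_circle) = (\<integral>\<^sup>+y. \<integral>\<^sup>+x. f (x - y) \<partial>haar_circle \<partial>\<nu>)"
    by (rule Fubini'[symmetric]) measurable
  also have "\<dots> = (\<integral>\<^sup>+x. f x \<partial>haar_circle)"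
    by (simp add: nn_integral_haar_diff emeasure_space_1)
  finally show ?thesis .
qed

lemma measurable_conv_op [measurable]:
  assumes [measurable]: "f \<in> borel_measurable borel"
  shows "conv_op \<nu> f \<in> borel_measurable borel"
  unfolding conv_op_def by measurable

lemma AE_finite_convolution:
  assumes [measurable]: "g \<in> borel_measurable borel" and "(\<integral>\<^sup>+x. g x \<partial>haar_circle) < \<infinity>"
  shows "AE x in haar_circle. (\<integral>\<^sup>+y. g (x - y) \<partial>\<nu>) < \<infinity>"
  using nn_integral_PInf_AE[of "\<lambda>x. \<integral>\<^sup>+y. g (x - y) \<partial>\<nu>" haar_circle]
    nn_integral_convolution_haar[of g] assms(2)
  by (auto simp: top.not_eq_extremum less_top)

lemma AE_integrable_convolution:
  fixes f :: "circle \<Rightarrow> complex"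
  assumes "integrable haar_circle f"
  shows "AE x in haar_circle. integrable \<nu> (\<lambda>y. f (x - y))"
proof -
  have [measurable]: "f \<in> borel_measurable borel" using assms by (simp add: integrable_iff_bounded)
  have "(\<integral>\<^sup>+x. ennreal (norm (f x)) \<partial>haar_circle) < \<infinity>" using assms by (simp add: integrable_iff_bounded)
  then have "AE x in haar_circle. (\<integral>\<^sup>+y. ennreal (norm (f (x - y))) \<partial>\<nu>) < \<infinity>"
    by (intro AE_finite_convolution) auto
  then show ?thesis
  proof eventually_elim
    case (elim x)
    have "(\<lambda>y. f (x - y)) \<in> borel_measurable \<nu>" by measurable
    then show ?case using elim by (simp add: integrable_iff_bounded)
  qed
qed

lemma conv_op_L1:
  assumes [measurable]: "f \<in> borel_measurable borel"
  shows "(\<integral>\<^sup>+x. norm (conv_op \<nu> f x) \<partial>haar_circle) \<le> (\<integral>\<^sup>+x. norm (f x) \<partial>haar_circle)"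
proof -
  have "(\<integral>\<^sup>+x. norm (conv_op \<nu> f x) \<partial>haar_circle) \<le> (\<integral>\<^sup>+x. \<integral>\<^sup>+y. norm (f (x - y)) \<partial>\<nu> \<partial>haar_circle)"
  proof (rule nn_integral_mono)
    fix x
    show "norm (conv_op \<nu> f x) \<le> (\<integral>\<^sup>+y. norm (f (x - y)) \<partial>\<nu>)"
    proof (cases "integrable \<nu> (\<lambda>y. f (x - y))")
      case True
      then show ?thesis unfolding conv_op_def by (rule integral_norm_bound_ennreal)
    \<comment> \<open>Where the integrand is not integrable, the integral is 0 by convention and the
      bound is trivial.\<close>
    qed (simp add: conv_op_def not_integrable_integral_eq)
  qed
  also have "\<dots> = (\<integral>\<^sup>+x. norm (f x) \<partial>haar_circle)" by (rule nn_integral_convolution_haar) simp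
  finally show ?thesis .
qed

lemma integrable_conv_op:
  assumes "integrable haar_circle f"
  shows "integrable haar_circle (conv_op \<nu> f)"
proof -
  have [measurable]: "f \<in> borel_measurable borel" using assms by (simp add: integrable_iff_bounded)
  show ?thesis unfolding integrable_iff_bounded
    using conv_op_L1[of f] assms by (auto simp: integrable_iff_bounded intro: le_less_trans)
qed

lemma conv_op_bounded:
  assumes "\<And>x. norm (f x) \<le> K"
  shows "norm (conv_op \<nu> f x) \<le> K"
proof (cases "integrable \<nu> (\<lambda>y. f (x - y))")
  case True
  have "norm (conv_op \<nu> f x) \<le> (\<integral>y. norm (f (x - y)) \<partial>\<nu>)" unfolding conv_op_def by (rule integral_norm_bound)
  also have "\<dots> \<le> (\<integral>y. K \<partial>\<nu>)" using True assms by (intro integral_mono) auto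
  finally show ?thesis by (simp add: prob_space)
next
  case False
  have "0 \<le> K" using assms[of 0] norm_ge_zero by (rule order_trans[rotated])
  then show ?thesis using False by (simp add: conv_op_def not_integrable_integral_eq)
qed

text \<open>Cauchy-Schwarz for the probability measure, in the form that a variance is nonnegative,
  followed by the averaging identity.\<close>

lemma conv_op_L2:
  assumes [measurable]: "f \<in> borel_measurable borel"
  shows "(\<integral>\<^sup>+x. (norm (conv_op \<nu> f x))\<^sup>2 \<partial>haar_circle) \<le> (\<integral>\<^sup>+x. (norm (f x))\<^sup>2 \<partial>haar_circle)"
proof -
  have "(\<integral>\<^sup>+x. (norm (conv_op \<nu> f x))\<^sup>2 \<partial>haar_circle) \<le> (\<integral>\<^sup>+x. \<integral>\<^sup>+y. (norm (f (x - y)))\<^sup>2 \<partial>\<nu> \<partial>haar_circle)"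
  proof (rule nn_integral_mono)
    fix x
    let ?g = "\<lambda>y. norm (f (x - y))"
    show "ennreal ((norm (conv_op \<nu> f x))\<^sup>2) \<le> (\<integral>\<^sup>+y. (norm (f (x - y)))\<^sup>2 \<partial>\<nu>)"
    proof (cases "integrable \<nu> (\<lambda>y. f (x - y))")
      case int: True
      show ?thesis
      proof (cases "integrable \<nu> (\<lambda>y. (?g y)\<^sup>2)")
        case True
        define m where "m = (\<integral>y. ?g y \<partial>\<nu>)"
        have "0 \<le> (\<integral>y. (?g y - m)\<^sup>2 \<partial>\<nu>)" by simp
        also have "\<dots> = (\<integral>y. (?g y)\<^sup>2 - 2 * m * ?g y + m\<^sup>2 \<partial>\<nu>)"
          by (intro Bochner_Integration.integral_cong) (auto simp: power2_diff)
        also have "\<dots> = (\<integral>y. (?g y)\<^sup>2 \<partial>\<nu>) - 2 * m * m + m\<^sup>2"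
          using True int by (simp add: m_def prob_space)
        finally have "m\<^sup>2 \<le> (\<integral>y. (?g y)\<^sup>2 \<partial>\<nu>)" by (simp add: power2_eq_square)
        moreover have "norm (conv_op \<nu> f x) \<le> m" unfolding conv_op_def m_def by (rule integral_norm_bound)
        ultimately have "(norm (conv_op \<nu> f x))\<^sup>2 \<le> (\<integral>y. (?g y)\<^sup>2 \<partial>\<nu>)"
          by (meson norm_ge_zero order_trans power_mono)
        then show ?thesis using True by (simp add: nn_integral_eq_integral ennreal_leI)
      next
        case False
        then have "(\<integral>\<^sup>+y. (?g y)\<^sup>2 \<partial>\<nu>) = \<infinity>"
          by (simp add: integrable_iff_bounded top.not_eq_extremum[symmetric] not_less top_unique)
        then show ?thesis by simp
      qed
    qed (simp add: conv_op_def not_integrable_integral_eq)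
  qed
  also have "\<dots> = (\<integral>\<^sup>+x. (norm (f x))\<^sup>2 \<partial>haar_circle)" by (rule nn_integral_convolution_haar) simp
  finally show ?thesis .
qed

lemma conv_op_add_AE:
  assumes "integrable haar_circle f" "integrable haar_circle g"
  shows "AE x in haar_circle. conv_op \<nu> (\<lambda>x. f x + g x) x = conv_op \<nu> f x + conv_op \<nu> g x"
  using AE_integrable_convolution[OF assms(1)] AE_integrable_convolution[OF assms(2)]
  by eventually_elim (simp add: conv_op_def)

lemma conv_op_cmult: "conv_op \<nu> (\<lambda>x. a * f x) x = a * conv_op \<nu> f x"
  by (simp add: conv_op_def)

text \<open>\<open>\<nu>\<close> may be singular, so a Haar null set need not be
  \<open>\<nu>\<close>-null. Averaging the indicator \<open>N\<close> of disagreement shows that its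
  reflected translate is \<open>\<nu>\<close>-null at almost every \<open>x\<close>.\<close>

lemma conv_op_cong_AE:
  assumes [measurable]: "f \<in> borel_measurable borel" "g \<in> borel_measurable borel"
    and "AE x in haar_circle. f x = g x"
  shows "AE x in haar_circle. conv_op \<nu> f x = conv_op \<nu> g x"
proof -
  define N where "N x = (if f x = g x then 0 else 1 :: ennreal)" for x
  have [measurable]: "N \<in> borel_measurable borel" unfolding N_def by measurable
  have "(\<integral>\<^sup>+x. N x \<partial>haar_circle) = 0"
    using assms(3) by (subst nn_integral_0_iff_AE) (auto simp: N_def)
  then have "AE x in haar_circle. (\<integral>\<^sup>+y. N (x - y) \<partial>\<nu>) = 0"
    by (subst nn_integral_0_iff_AE[symmetric]) (simp_all add: nn_integral_convolution_haar)
  then show ?thesis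
  proof eventually_elim
    case (elim x)
    then have "AE y in \<nu>. f (x - y) = g (x - y)"
      by (subst (asm) nn_integral_0_iff_AE) (auto simp: N_def split: if_splits)
    then show ?case unfolding conv_op_def by (intro integral_cong_AE) auto
  qed
qed

lemma conv_op_circle_char: "conv_op \<nu> (circle_char n) x = fourier_coeff \<nu> n * circle_char n x"
  by (simp add: conv_op_def circle_char_minus fourier_coeff_def mult.commute)

end

section \<open>Density of trigonometric polynomials\<close>

definition sqnorm :: "(circle \<Rightarrow> complex) \<Rightarrow> ennreal" where
  "sqnorm f = (\<integral>\<^sup>+x. (norm (f x))\<^sup>2 \<partial>haar_circle)"

definition trig_polys :: "(circle \<Rightarrow> complex) set" where
  "trig_polys = {\<lambda>x. \<Sum>n\<in>F. a n * circle_char n x |F a. finite F}"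

lemma power2_norm_add_le: "(norm (x + y))\<^sup>2 \<le> 2 * (norm x)\<^sup>2 + 2 * (norm y)\<^sup>2" for x y :: complex
proof -
  have "(norm (x + y))\<^sup>2 \<le> (norm x + norm y)\<^sup>2" by (intro power_mono norm_triangle_ineq) auto
  also have "\<dots> \<le> 2 * (norm x)\<^sup>2 + 2 * (norm y)\<^sup>2"
    using zero_le_power2[of "norm x - norm y"] by (simp add: power2_sum power2_diff)
  finally show ?thesis .
qed

lemma sqnorm_add_le:
  assumes [measurable]: "f \<in> borel_measurable borel" "g \<in> borel_measurable borel"
    and "AE x in haar_circle. h x = f x + g x"
  shows "sqnorm h \<le> 2 * sqnorm f + 2 * sqnorm g"
proof -
  have "sqnorm h \<le> (\<integral>\<^sup>+x. 2 * ennreal ((norm (f x))\<^sup>2) + 2 * ennreal ((norm (g x))\<^sup>2) \<partial>haar_circle)"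
    unfolding sqnorm_def
  proof (rule nn_integral_mono_AE, use assms(3) in eventually_elim)
    case (elim x)
    have "ennreal ((norm (h x))\<^sup>2) \<le> ennreal (2 * (norm (f x))\<^sup>2 + 2 * (norm (g x))\<^sup>2)"
      unfolding elim by (intro ennreal_leI power2_norm_add_le)
    then show ?case by (simp add: ennreal_plus ennreal_mult')
  qed
  also have "\<dots> = 2 * sqnorm f + 2 * sqnorm g"
    unfolding sqnorm_def by (subst nn_integral_add) (auto simp: nn_integral_cmult)
  finally show ?thesis .
qed

lemma sqnorm_cmult:
  assumes [measurable]: "f \<in> borel_measurable borel"
  shows "sqnorm (\<lambda>x. a * f x) = ennreal ((norm a)\<^sup>2) * sqnorm f"
  unfolding sqnorm_def by (simp add: norm_mult power_mult_distrib ennreal_mult' nn_integral_cmult)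

lemma circle_char_add: "circle_char (m + n) x = circle_char m x * circle_char n x"
  by transfer (simp add: cis_mult distrib_right distrib_left)

lemma circle_char_uminus: "circle_char (- n) x = cnj (circle_char n x)"
  by transfer (simp add: cis_cnj)

lemma circle_char_0 [simp]: "circle_char 0 x = 1"
  by transfer simp

lemma distr_haar_diff: "distr haar_circle borel (\<lambda>x. x - y) = haar_circle"
proof (rule measure_eqI)
  fix A assume "A \<in> sets (distr haar_circle borel (\<lambda>x. x - y))"
  then have [measurable]: "A \<in> sets borel" by simp
  have "emeasure (distr haar_circle borel (\<lambda>x. x - y)) A = (\<integral>\<^sup>+x. indicator A (x - y) \<partial>haar_circle)"
    by (subst nn_integral_indicator[symmetric], simp) (subst nn_integral_distr, auto)
  also have "\<dots> = emeasure haar_circle A" by (subst nn_integral_haar_diff) auto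
  finally show "emeasure (distr haar_circle borel (\<lambda>x. x - y)) A = emeasure haar_circle A" .
qed simp

text \<open>Translation by 1/(2n) multiplies the character by -1, so its integral equals its own
  negative.\<close>

lemma integral_circle_char: "(\<integral>x. circle_char n x \<partial>haar_circle) = (if n = 0 then 1 else 0)"
proof (cases "n = 0")
  case True
  then show ?thesis using haar.prob_space by simp
next
  case False
  define y where "y = circle_of (1 / (2 * of_int n))"
  have "(\<integral>x. circle_char n x \<partial>haar_circle) = (\<integral>x. circle_char n x \<partial>distr haar_circle borel (\<lambda>x. x - y))"
    by (simp add: distr_haar_diff)
  also have "\<dots> = (\<integral>x. circle_char n (x - y) \<partial>haar_circle)" by (rule integral_distr) auto
  also have "\<dots> = - (\<integral>x. circle_char n x \<partial>haar_circle)"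
  proof -
    have "circle_char n y = - 1" using False by (simp add: y_def circle_char_circle_of)
    then show ?thesis by (simp add: circle_char_minus)
  qed
  finally show ?thesis using False by simp
qed

lemma sqnorm_trig_poly:
  assumes "finite F"
  shows "sqnorm (\<lambda>x. \<Sum>n\<in>F. a n * circle_char n x) = ennreal (\<Sum>n\<in>F. (norm (a n))\<^sup>2)"
proof -
  let ?P = "\<lambda>x. \<Sum>n\<in>F. a n * circle_char n x"
  have int: "integrable haar_circle (\<lambda>x. circle_char n x)" for n
    by (rule haar.integrable_const_bound[of _ 1]) auto
  have "complex_of_real ((norm (?P x))\<^sup>2) = (\<Sum>n\<in>F. \<Sum>m\<in>F. a n * cnj (a m) * circle_char (n - m) x)" for x
  proof -
    have "complex_of_real ((norm (?P x))\<^sup>2) = ?P x * cnj (?P x)" by (rule complex_norm_square)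
    also have "\<dots> = (\<Sum>n\<in>F. \<Sum>m\<in>F. (a n * circle_char n x) * cnj (a m * circle_char m x))"
      by (simp add: sum_product)
    also have "\<dots> = (\<Sum>n\<in>F. \<Sum>m\<in>F. a n * cnj (a m) * circle_char (n - m) x)"
      using circle_char_add[of _ "- _"] by (intro sum.cong refl) (simp add: circle_char_uminus mult_ac)
    finally show ?thesis .
  qed
  then have "(\<integral>x. complex_of_real ((norm (?P x))\<^sup>2) \<partial>haar_circle)
      = (\<Sum>n\<in>F. \<Sum>m\<in>F. a n * cnj (a m) * (if n - m = 0 then 1 else 0))"
    using int by (simp add: integral_circle_char integral_sum integrable_sum)
  also have "\<dots> = (\<Sum>n\<in>F. a n * cnj (a n))"
    using assms by (intro sum.cong refl) (simp add: if_distrib[of "\<lambda>x. _ * x"] sum.delta cong: if_cong)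
  also have "\<dots> = complex_of_real (\<Sum>n\<in>F. (norm (a n))\<^sup>2)" by (simp only: of_real_sum complex_norm_square)
  finally have "(\<integral>x. (norm (?P x))\<^sup>2 \<partial>haar_circle) = (\<Sum>n\<in>F. (norm (a n))\<^sup>2)"
    unfolding integral_complex_of_real of_real_eq_iff .
  moreover have "integrable haar_circle (\<lambda>x. (norm (?P x))\<^sup>2)"
  proof (rule haar.integrable_const_bound)
    show "AE x in haar_circle. norm ((norm (?P x))\<^sup>2) \<le> (\<Sum>n\<in>F. norm (a n))\<^sup>2"
      by (intro AE_I2) (auto intro!: power_mono order_trans[OF norm_sum] simp: norm_mult)
  qed simp
  ultimately show ?thesis unfolding sqnorm_def by (subst nn_integral_eq_integral) auto
qed

lemma trig_polysI: "finite F \<Longrightarrow> (\<lambda>x. \<Sum>n\<in>F. a n * circle_char n x) \<in> trig_polys"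
  unfolding trig_polys_def by blast

lemma trig_polys_char: "circle_char n \<in> trig_polys"
  using trig_polysI[of "{n}" "\<lambda>_. 1"] by simp

lemma trig_polys_zero: "(\<lambda>_. 0) \<in> trig_polys"
  using trig_polysI[of "{}"] by simp

lemma trig_polys_cmult: "f \<in> trig_polys \<Longrightarrow> (\<lambda>x. c * f x) \<in> trig_polys"
proof -
  assume "f \<in> trig_polys"
  then obtain F a where f: "f = (\<lambda>x. \<Sum>n\<in>F. a n * circle_char n x)" "finite F" by (auto simp: trig_polys_def)
  then have "(\<lambda>x. c * f x) = (\<lambda>x. \<Sum>n\<in>F. (c * a n) * circle_char n x)" by (simp add: sum_distrib_left mult.assoc)
  then show ?thesis using trig_polysI[OF f(2)] by simp
qed

lemma trig_polys_add:
  assumes "f \<in> trig_polys" "g \<in> trig_polys"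
  shows "(\<lambda>x. f x + g x) \<in> trig_polys"
proof -
  obtain F a where f: "f = (\<lambda>x. \<Sum>n\<in>F. a n * circle_char n x)" "finite F" using assms(1) by (auto simp: trig_polys_def)
  obtain G b where g: "g = (\<lambda>x. \<Sum>n\<in>G. b n * circle_char n x)" "finite G" using assms(2) by (auto simp: trig_polys_def)
  define a' where "a' n = (if n \<in> F then a n else 0) + (if n \<in> G then b n else 0)" for n
  have "f x + g x = (\<Sum>n\<in>F \<union> G. a' n * circle_char n x)" for x
  proof -
    have "f x = (\<Sum>n\<in>F \<union> G. (if n \<in> F then a n else 0) * circle_char n x)"
      unfolding f(1) using f(2) g(2) by (intro sum.mono_neutral_cong_left) auto
    moreover have "g x = (\<Sum>n\<in>F \<union> G. (if n \<in> G then b n else 0) * circle_char n x)"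
      unfolding g(1) using f(2) g(2) by (intro sum.mono_neutral_cong_left) auto
    ultimately show ?thesis by (simp add: a'_def distrib_right sum.distrib)
  qed
  then show ?thesis using trig_polysI[of "F \<union> G" a'] f(2) g(2) by simp
qed

lemma trig_polys_sum:
  assumes "\<And>i. i \<in> I \<Longrightarrow> f i \<in> trig_polys"
  shows "(\<lambda>x. \<Sum>i\<in>I. f i x) \<in> trig_polys"
  using assms
proof (induction I rule: infinite_finite_induct)
  case (insert i I)
  then show ?case using trig_polys_add[of "f i" "\<lambda>x. \<Sum>i\<in>I. f i x"] by simp
qed (simp_all add: trig_polys_zero)

lemma trig_polys_mult:
  assumes "f \<in> trig_polys" "g \<in> trig_polys"
  shows "(\<lambda>x. f x * g x) \<in> trig_polys"
proof -
  obtain F a where f: "f = (\<lambda>x. \<Sum>n\<in>F. a n * circle_char n x)" using assms(1) by (auto simp: trig_polys_def)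
  obtain G b where g: "g = (\<lambda>x. \<Sum>n\<in>G. b n * circle_char n x)" using assms(2) by (auto simp: trig_polys_def)
  have "(\<lambda>x. f x * g x) = (\<lambda>x. \<Sum>n\<in>F. \<Sum>m\<in>G. (a n * b m) * circle_char (n + m) x)"
    unfolding f g by (simp add: sum_product circle_char_add mult_ac)
  moreover have "(\<lambda>x. \<Sum>n\<in>F. \<Sum>m\<in>G. (a n * b m) * circle_char (n + m) x) \<in> trig_polys"
    by (intro trig_polys_sum trig_polys_cmult trig_polys_char)
  ultimately show ?thesis by simp
qed

lemma measurable_trig_polys [measurable_dest]: "f \<in> trig_polys \<Longrightarrow> f \<in> borel_measurable borel"
  by (auto simp: trig_polys_def)

text \<open>A real-linear functional of z is a combination of z and its conjugate, which on the
  circle are the characters of index 1 and -1.\<close>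

lemma real_polynomial_circle_char:
  fixes p :: "complex \<Rightarrow> real"
  assumes "real_polynomial_function p"
  shows "(\<lambda>x. complex_of_real (p (circle_char 1 x))) \<in> trig_polys"
  using assms
proof (induction p rule: real_polynomial_function.induct)
  case (linear f)
  interpret f: bounded_linear f by fact
  have *: "complex_of_real (f z) = (of_real (f 1) - \<i> * of_real (f \<i>)) / 2 * z + (of_real (f 1) + \<i> * of_real (f \<i>)) / 2 * cnj z" for z
  proof -
    have "f z = f (Re z *\<^sub>R 1 + Im z *\<^sub>R \<i>)" by (rule arg_cong[of _ _ f]) (simp add: complex_eq_iff)
    also have "\<dots> = Re z * f 1 + Im z * f \<i>" unfolding f.add f.scaleR by simp
    finally have "f z = Re z * f 1 + Im z * f \<i>" .
    moreover have "Re ((of_real (f 1) - \<i> * of_real (f \<i>)) / 2 * z + (of_real (f 1) + \<i> * of_real (f \<i>)) / 2 * cnj z)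
        = Re z * f 1 + Im z * f \<i>" by (simp add: algebra_simps)
    moreover have "Im ((of_real (f 1) - \<i> * of_real (f \<i>)) / 2 * z + (of_real (f 1) + \<i> * of_real (f \<i>)) / 2 * cnj z) = 0"
      by (simp add: diff_divide_distrib)
    ultimately show ?thesis by (intro complex_eqI) (simp_all only: Re_complex_of_real Im_complex_of_real)
  qed
  have eq: "(\<lambda>x. complex_of_real (f (circle_char 1 x)))
    = (\<lambda>x. (of_real (f 1) - \<i> * of_real (f \<i>)) / 2 * circle_char 1 x + (of_real (f 1) + \<i> * of_real (f \<i>)) / 2 * circle_char (- 1) x)"
    unfolding circle_char_uminus by (intro ext *)
  show ?case unfolding eq by (intro trig_polys_add trig_polys_cmult trig_polys_char)
next
  case (const c)
  then show ?case using trig_polys_cmult[OF trig_polys_char[of 0], of "of_real c"] by simp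
next
  case (add f g)
  then show ?case using trig_polys_add[OF add.IH] by simp
next
  case (mult f g)
  then show ?case using trig_polys_mult[OF mult.IH] by simp
qed

text \<open>The class is closed under sums, multiples and dominated limits, which carries
  approximability from continuous functions over closed and Borel sets to all of
  \<open>L^2\<close>.\<close>

definition trig_approx :: "(circle \<Rightarrow> complex) \<Rightarrow> bool" where
  "trig_approx f \<longleftrightarrow> f \<in> borel_measurable borel \<and>
     (\<forall>\<epsilon>>0. \<exists>P\<in>trig_polys. sqnorm (\<lambda>x. f x - P x) < ennreal \<epsilon>)"

lemma trig_approx_measurable [measurable_dest]: "trig_approx f \<Longrightarrow> f \<in> borel_measurable borel"
  by (simp add: trig_approx_def)

lemma trig_approxD:
  assumes "trig_approx f" "\<epsilon> > 0"
  obtains P where "P \<in> trig_polys" "sqnorm (\<lambda>x. f x - P x) < ennreal \<epsilon>"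
  using assms that unfolding trig_approx_def by blast

text \<open>Quarter tolerances match the doubling in \<open>sqnorm_add_le\<close>, which replaces
  the triangle inequality for squared norms.\<close>

lemma less_ennreal_if_le_twice_sum:
  assumes "x < ennreal (\<epsilon> / 4)" "y < ennreal (\<epsilon> / 4)" "z \<le> 2 * x + 2 * y" "\<epsilon> > 0"
  shows "z < ennreal \<epsilon>"
proof -
  have "2 * x < 2 * ennreal (\<epsilon> / 4)" "2 * y < 2 * ennreal (\<epsilon> / 4)"
    using assms(1,2) by (simp_all add: ennreal_mult_strict_left_mono)
  then have "2 * x + 2 * y < 2 * ennreal (\<epsilon> / 4) + 2 * ennreal (\<epsilon> / 4)"
    by (rule add_strict_mono)
  also have "2 * ennreal (\<epsilon> / 4) + 2 * ennreal (\<epsilon> / 4) = ennreal 4 * ennreal (\<epsilon> / 4)"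
    by (simp add: distrib_right[symmetric])
  also have "\<dots> = ennreal \<epsilon>" using assms(4) by (subst ennreal_mult[symmetric]) auto
  finally show ?thesis using assms(3) by (rule le_less_trans[rotated])
qed

lemma trig_approx_add:
  assumes f: "trig_approx f" and g: "trig_approx g"
  shows "trig_approx (\<lambda>x. f x + g x)"
  unfolding trig_approx_def
proof (intro conjI allI impI)
  note [measurable] = trig_approx_measurable[OF f] trig_approx_measurable[OF g]
  show "(\<lambda>x. f x + g x) \<in> borel_measurable borel" by measurable
  fix \<epsilon> :: real assume e: "\<epsilon> > 0"
  then have e4: "\<epsilon> / 4 > 0" by simp
  obtain P where P: "P \<in> trig_polys" "sqnorm (\<lambda>x. f x - P x) < ennreal (\<epsilon> / 4)" using trig_approxD[OF f e4] .
  obtain Q where Q: "Q \<in> trig_polys" "sqnorm (\<lambda>x. g x - Q x) < ennreal (\<epsilon> / 4)" using trig_approxD[OF g e4] .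
  note [measurable] = measurable_trig_polys[OF P(1)] measurable_trig_polys[OF Q(1)]
  have "sqnorm (\<lambda>x. f x + g x - (P x + Q x)) \<le> 2 * sqnorm (\<lambda>x. f x - P x) + 2 * sqnorm (\<lambda>x. g x - Q x)"
    by (rule sqnorm_add_le) auto
  then have "sqnorm (\<lambda>x. f x + g x - (P x + Q x)) < ennreal \<epsilon>" using less_ennreal_if_le_twice_sum[OF P(2) Q(2) _ e] by blast
  then show "\<exists>R\<in>trig_polys. sqnorm (\<lambda>x. f x + g x - R x) < ennreal \<epsilon>"
    using trig_polys_add[OF P(1) Q(1)] by (intro bexI[where x = "\<lambda>x. P x + Q x"])
qed

lemma trig_approx_trig_poly: "P \<in> trig_polys \<Longrightarrow> trig_approx P"
  unfolding trig_approx_def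
proof (intro conjI allI impI)
  assume P: "P \<in> trig_polys"
  then show "P \<in> borel_measurable borel" by (rule measurable_trig_polys)
  fix \<epsilon> :: real assume "\<epsilon> > 0"
  then have "sqnorm (\<lambda>x. P x - P x) < ennreal \<epsilon>" by (simp add: sqnorm_def)
  then show "\<exists>Q\<in>trig_polys. sqnorm (\<lambda>x. P x - Q x) < ennreal \<epsilon>" using P by (intro bexI[where x = P])
qed

lemma trig_approx_cmult:
  assumes f: "trig_approx f"
  shows "trig_approx (\<lambda>x. c * f x)"
proof (cases "c = 0")
  case True
  then show ?thesis using trig_approx_trig_poly[OF trig_polys_zero] by simp
next
  case False
  note [measurable] = trig_approx_measurable[OF f]
  show ?thesis unfolding trig_approx_def
  proof (intro conjI allI impI)
    show "(\<lambda>x. c * f x) \<in> borel_measurable borel" by measurable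
    fix \<epsilon> :: real assume e: "\<epsilon> > 0"
    then have "\<epsilon> / (norm c)\<^sup>2 > 0" using False by simp
    then obtain P where P: "P \<in> trig_polys" "sqnorm (\<lambda>x. f x - P x) < ennreal (\<epsilon> / (norm c)\<^sup>2)" by (rule trig_approxD[OF f])
    note [measurable] = measurable_trig_polys[OF P(1)]
    have "sqnorm (\<lambda>x. c * f x - c * P x) = ennreal ((norm c)\<^sup>2) * sqnorm (\<lambda>x. f x - P x)"
      by (subst sqnorm_cmult[symmetric]) (simp_all add: right_diff_distrib)
    also have "\<dots> < ennreal ((norm c)\<^sup>2) * ennreal (\<epsilon> / (norm c)\<^sup>2)"
      using False P(2) by (intro ennreal_mult_strict_left_mono) auto
    also have "\<dots> = ennreal \<epsilon>" using False by (subst ennreal_mult'[symmetric]) auto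
    finally show "\<exists>R\<in>trig_polys. sqnorm (\<lambda>x. c * f x - R x) < ennreal \<epsilon>"
      using trig_polys_cmult[OF P(1)] by (intro bexI[where x = "\<lambda>x. c * P x"])
  qed
qed

lemma trig_approx_sum:
  assumes "\<And>i. i \<in> I \<Longrightarrow> trig_approx (f i)"
  shows "trig_approx (\<lambda>x. \<Sum>i\<in>I. f i x)"
  using assms
proof (induction I rule: infinite_finite_induct)
  case (insert i I)
  then show ?case using trig_approx_add[of "f i" "\<lambda>x. \<Sum>i\<in>I. f i x"] by simp
qed (simp_all add: trig_approx_trig_poly[OF trig_polys_zero])

lemma trig_approx_limit:
  assumes [measurable]: "f \<in> borel_measurable borel"
    and g: "\<And>i. trig_approx (g i)" and lim: "\<And>x. (\<lambda>i. g i x) \<longlonglongrightarrow> f x"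
    and bound: "\<And>i x. (norm (g i x - f x))\<^sup>2 \<le> w x" and [measurable]: "w \<in> borel_measurable borel"
    and fin: "(\<integral>\<^sup>+x. ennreal (w x) \<partial>haar_circle) < \<infinity>"
  shows "trig_approx f"
  unfolding trig_approx_def
proof (intro conjI allI impI)
  note [measurable] = trig_approx_measurable[OF g]
  show "f \<in> borel_measurable borel" by fact
  have "(\<lambda>i. sqnorm (\<lambda>x. g i x - f x)) \<longlonglongrightarrow> (\<integral>\<^sup>+x. 0 \<partial>haar_circle)"
    unfolding sqnorm_def
  proof (rule nn_integral_dominated_convergence[where w = "\<lambda>x. ennreal (w x)"])
    show "AE x in haar_circle. (\<lambda>i. ennreal ((norm (g i x - f x))\<^sup>2)) \<longlonglongrightarrow> 0"
    proof (intro AE_I2)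
      fix x
      have "(\<lambda>i. (norm (g i x - f x))\<^sup>2) \<longlonglongrightarrow> (norm (f x - f x))\<^sup>2" by (intro tendsto_intros lim)
      then show "(\<lambda>i. ennreal ((norm (g i x - f x))\<^sup>2)) \<longlonglongrightarrow> 0"
        using tendsto_ennrealI[of "\<lambda>i. (norm (g i x - f x))\<^sup>2" 0] by simp
    qed
  qed (use bound fin in \<open>auto intro!: ennreal_leI\<close>)
  then have small: "\<forall>\<^sub>F i in sequentially. sqnorm (\<lambda>x. g i x - f x) < ennreal e" if "e > 0" for e
    using that by (intro order_tendstoD) auto
  fix \<epsilon> :: real assume e: "\<epsilon> > 0"
  then have e4: "\<epsilon> / 4 > 0" by simp
  obtain i where i: "sqnorm (\<lambda>x. g i x - f x) < ennreal (\<epsilon> / 4)"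
    using small[OF e4] by (auto simp: eventually_sequentially)
  obtain P where P: "P \<in> trig_polys" "sqnorm (\<lambda>x. g i x - P x) < ennreal (\<epsilon> / 4)" using trig_approxD[OF g e4] .
  note [measurable] = measurable_trig_polys[OF P(1)]
  have "sqnorm (\<lambda>x. f x - P x) \<le> 2 * sqnorm (\<lambda>x. f x - g i x) + 2 * sqnorm (\<lambda>x. g i x - P x)"
    by (rule sqnorm_add_le) auto
  moreover have "sqnorm (\<lambda>x. f x - g i x) = sqnorm (\<lambda>x. g i x - f x)" by (simp add: sqnorm_def norm_minus_commute)
  ultimately have "sqnorm (\<lambda>x. f x - P x) < ennreal \<epsilon>" using less_ennreal_if_le_twice_sum[OF i P(2) _ e] by simp
  then show "\<exists>P\<in>trig_polys. sqnorm (\<lambda>x. f x - P x) < ennreal \<epsilon>" using P(1) by blast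
qed

lemma haar_finite_const: "(\<integral>\<^sup>+x. ennreal c \<partial>haar_circle) < \<infinity>"
  using haar.emeasure_space_1 by simp

text \<open>Stone-Weierstrass on the unit circle supplies uniform approximations by real polynomials
  in the coordinates of \<open>circle_char 1\<close>.\<close>

lemma trig_approx_continuous:
  fixes \<psi> :: "complex \<Rightarrow> real"
  assumes "continuous_on UNIV \<psi>"
  shows "trig_approx (\<lambda>x. of_real (\<psi> (circle_char 1 x)))"
proof -
  have [measurable]: "\<psi> \<in> borel_measurable borel" using assms by (rule borel_measurable_continuous_onI)
  have "\<exists>p. real_polynomial_function p \<and> (\<forall>z\<in>sphere 0 1. \<bar>\<psi> z - p z\<bar> < 1 / real (Suc i))" for i
  proof -
    have "0 < 1 / real (Suc i)" by simp
    from Stone_Weierstrass_real_polynomial_function[OF compact_sphere continuous_on_subset[OF assms subset_UNIV] this]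
    obtain g where "real_polynomial_function g" "\<And>z. z \<in> sphere 0 1 \<Longrightarrow> \<bar>\<psi> z - g z\<bar> < 1 / real (Suc i)"
      by blast
    then show ?thesis by blast
  qed
  then have "\<forall>i. \<exists>p. real_polynomial_function p \<and> (\<forall>z\<in>sphere 0 1. \<bar>\<psi> z - p z\<bar> < 1 / real (Suc i))" ..
  from choice[OF this] obtain p where
    p: "\<forall>i. real_polynomial_function (p i) \<and> (\<forall>z\<in>sphere 0 1. \<bar>\<psi> z - p i z\<bar> < 1 / real (Suc i))" ..
  show ?thesis
  proof (rule trig_approx_limit[where g = "\<lambda>i x. of_real (p i (circle_char 1 x))" and w = "\<lambda>_. 1"])
  show "(\<lambda>x. complex_of_real (\<psi> (circle_char 1 x))) \<in> borel_measurable borel" by measurable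
  show "trig_approx (\<lambda>x. of_real (p i (circle_char 1 x)))" for i
    using p by (intro trig_approx_trig_poly real_polynomial_circle_char) blast
  have close: "norm (complex_of_real (p i (circle_char 1 x)) - of_real (\<psi> (circle_char 1 x))) \<le> 1 / Suc i" for i x
  proof -
    have "circle_char 1 x \<in> sphere 0 1" by simp
    then have "\<bar>\<psi> (circle_char 1 x) - p i (circle_char 1 x)\<bar> < 1 / real (Suc i)" using p by blast
    then show ?thesis unfolding of_real_diff[symmetric] norm_of_real by linarith
  qed
  show "(\<lambda>i. complex_of_real (p i (circle_char 1 x))) \<longlonglongrightarrow> of_real (\<psi> (circle_char 1 x))" for x
  proof (rule LIMSEQ_I)
    fix r :: real assume "r > 0"
    then obtain N where "1 / real (Suc N) < r" using nat_approx_posE by metis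
    then have "1 / real (Suc n) < r" if "n \<ge> N" for n
      using that by (intro le_less_trans[of "1 / real (Suc n)" "1 / real (Suc N)"] frac_le) auto
    then show "\<exists>N. \<forall>n\<ge>N. norm (complex_of_real (p n (circle_char 1 x)) - of_real (\<psi> (circle_char 1 x))) < r"
      by (intro exI[of _ N] allI impI le_less_trans[OF close])
  qed
  show "(norm (complex_of_real (p i (circle_char 1 x)) - of_real (\<psi> (circle_char 1 x))))\<^sup>2 \<le> 1" for i x
  proof (rule power_le_one)
    show "norm (complex_of_real (p i (circle_char 1 x)) - of_real (\<psi> (circle_char 1 x))) \<le> 1"
      by (rule order_trans[OF close]) simp
  qed simp
  show "(\<integral>\<^sup>+x. ennreal 1 \<partial>haar_circle) < \<infinity>" by (rule haar_finite_const)
qed simp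
qed

lemma inj_circle_char_1: "inj (circle_char 1)"
proof (rule injI)
  fix x y assume "circle_char 1 x = circle_char 1 y"
  then have "cis (2 * pi * (circle_rep x - circle_rep y)) = 1"
    using circle_char_minus[of 1 x y] circle_char_circle_of[of 1 "circle_rep x - circle_rep y"]
    by (simp add: circle_of_minus complex_norm_square[symmetric])
  then have "cos (2 * pi * (circle_rep x - circle_rep y)) = 1" by (simp add: complex_eq_iff)
  then obtain k :: int where "2 * pi * (circle_rep x - circle_rep y) = of_int k * 2 * pi"
    by (auto simp: cos_one_2pi_int)
  then have "circle_rep x - circle_rep y = of_int k" by simp
  then have "circle_of (circle_rep x) = circle_of (circle_rep y)" unfolding circle_of_eq_iff by simp
  then show "x = y" by simp
qed

text \<open>\<open>circle_char 1\<close> maps the closed set injectively onto a compact plane set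
  \<open>E\<close>, whose indicator is the pointwise limit of continuous functions of the distance
  to \<open>E\<close>.\<close>

lemma trig_approx_closed:
  assumes C: "closed (C :: circle set)"
  shows "trig_approx (indicator C)"
proof (cases "C = {}")
  case True
  then show ?thesis using trig_approx_trig_poly[OF trig_polys_zero] by (simp add: indicator_def[abs_def])
next
  case False
  define E where "E = circle_char 1 ` C"
  have "E = (\<lambda>x. cis (2 * pi * x)) ` (circle_of -` C \<inter> {0..1})"
  proof -
    have "circle_char 1 x \<in> (\<lambda>x. cis (2 * pi * x)) ` (circle_of -` C \<inter> {0..1})" if "x \<in> C" for x
    proof -
      have "0 \<le> circle_rep x" "circle_rep x \<le> 1" by (transfer, simp add: frac_lt_1 less_imp_le)+
      then show ?thesis using that circle_char_circle_of[of 1 "circle_rep x"]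
        by (intro image_eqI[of _ _ "circle_rep x"]) auto
    qed
    moreover have "cis (2 * pi * t) \<in> E" if "circle_of t \<in> C" for t
      unfolding E_def using that by (intro image_eqI[of _ _ "circle_of t"]) (simp_all add: circle_char_circle_of)
    ultimately show ?thesis unfolding E_def by blast
  qed
  moreover have "closed (circle_of -` C)"
    using C unfolding closed_def open_circle_def by (simp add: vimage_Compl)
  then have "compact (circle_of -` C \<inter> {0..1})" by (intro closed_Int_compact) auto
  then have "compact ((\<lambda>x. cis (2 * pi * x)) ` (circle_of -` C \<inter> {0..1}))"
    by (intro compact_continuous_image continuous_intros)
  ultimately have E: "closed E" by (simp add: compact_imp_closed)
  have Ene: "E \<noteq> {}" using False by (simp add: E_def)
  have mem: "circle_char 1 x \<in> E \<longleftrightarrow> x \<in> C" for x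
    unfolding E_def using inj_circle_char_1 by (simp add: inj_image_mem_iff)
  define \<psi> where "\<psi> i z = max 0 (1 - real i * infdist z E)" for i z
  show ?thesis
  proof (rule trig_approx_limit[where w = "\<lambda>_. 1"])
    show "(indicator C :: circle \<Rightarrow> complex) \<in> borel_measurable borel" using C by simp
    show "trig_approx (\<lambda>x. of_real (\<psi> i (circle_char 1 x)))" for i
      unfolding \<psi>_def by (intro trig_approx_continuous continuous_intros)
    show "(\<lambda>i. complex_of_real (\<psi> i (circle_char 1 x))) \<longlonglongrightarrow> indicator C x" for x
    proof (cases "x \<in> C")
      case True
      then show ?thesis using mem[of x] by (simp add: \<psi>_def)
    next
      case False
      then have "infdist (circle_char 1 x) E > 0"
        using mem[of x] E Ene by (metis in_closed_iff_infdist_zero infdist_nonneg less_le)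
      then obtain N :: nat where N: "1 < N * infdist (circle_char 1 x) E" using reals_Archimedean3 by blast
      have "\<psi> i (circle_char 1 x) = 0" if "i \<ge> N" for i
      proof -
        have "N * infdist (circle_char 1 x) E \<le> i * infdist (circle_char 1 x) E"
          using that by (intro mult_right_mono infdist_nonneg) auto
        then show ?thesis using N by (simp add: \<psi>_def)
      qed
      then have "\<forall>\<^sub>F i in sequentially. complex_of_real (\<psi> i (circle_char 1 x)) = 0"
        by (auto simp: eventually_sequentially)
      then show ?thesis using False by (simp add: tendsto_eventually)
    qed
    show "(norm (complex_of_real (\<psi> i (circle_char 1 x)) - indicator C x))\<^sup>2 \<le> 1" for i x
    proof (rule power_le_one)
      have "\<psi> i (circle_char 1 x) \<ge> 0" "\<psi> i (circle_char 1 x) \<le> 1"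
        using infdist_nonneg[of "circle_char 1 x" E] by (auto simp: \<psi>_def)
      moreover have "indicator C x = complex_of_real (indicator C x)" by (simp add: indicator_def)
      ultimately show "norm (complex_of_real (\<psi> i (circle_char 1 x)) - indicator C x) \<le> 1"
        by (simp flip: of_real_diff) (auto simp: indicator_def)
    qed simp
    show "(\<integral>\<^sup>+x. ennreal 1 \<partial>haar_circle) < \<infinity>" by (rule haar_finite_const)
  qed simp
qed

text \<open>Closed sets are an intersection-stable generator, so closure under complements and
  disjoint countable unions is enough.\<close>

lemma trig_approx_indicator:
  assumes "A \<in> sets (borel :: circle measure)"
  shows "trig_approx (indicator A)"
proof -
  let ?G = "Collect closed :: circle set set"
  have gen: "sets (borel :: circle measure) = sigma_sets UNIV ?G"
    by (subst borel_eq_closed) simp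
  have "A \<in> sigma_sets UNIV ?G" using assms by (simp add: gen)
  then show ?thesis
  proof (induction A rule: sigma_sets_induct_disjoint[rotated 2, consumes 1, case_names basic empty compl union])
    case (basic A)
    then show ?case by (simp add: trig_approx_closed)
  next
    case empty
    show ?case by (rule trig_approx_closed) simp
  next
    case (compl A)
    have "indicator (UNIV - A) = (\<lambda>x. indicator UNIV x + (- 1) * indicator A x :: complex)"
      by (auto simp: indicator_def)
    moreover have "trig_approx (indicator UNIV)" by (rule trig_approx_closed) simp
    ultimately show ?case using compl by (simp only: trig_approx_add trig_approx_cmult)
  next
    case (union A)
    have A: "A i \<in> sets borel" for i using union.hyps by (auto simp: gen)
    show ?case
    proof (rule trig_approx_limit[where w = "\<lambda>_. 1"])
      show "(indicator (\<Union> (range A)) :: circle \<Rightarrow> complex) \<in> borel_measurable borel"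
        using A by (intro borel_measurable_indicator sets.countable_UN) auto
      show "trig_approx (\<lambda>x. \<Sum>j<i. indicator (A j) x)" for i by (intro trig_approx_sum union.IH)
      have sum: "(\<Sum>j<i. indicator (A j) x :: complex) = indicator (\<Union>j<i. A j) x" for i x
        using union.hyps(1) by (subst indicator_UN_disjoint[symmetric]) (auto simp: disjoint_family_on_def)
      show "(\<lambda>i. \<Sum>j<i. indicator (A j) x :: complex) \<longlonglongrightarrow> indicator (\<Union> (range A)) x" for x
      proof (cases "x \<in> \<Union> (range A)")
        case True
        then obtain N where N: "x \<in> A N" by blast
        then have "(\<Sum>j<i. indicator (A j) x :: complex) = 1" if "i \<ge> Suc N" for i
          unfolding sum using that by (auto simp: indicator_def)
        then have "\<forall>\<^sub>F i in sequentially. (\<Sum>j<i. indicator (A j) x :: complex) = 1"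
          by (rule eventually_sequentiallyI)
        then show ?thesis using True by (simp add: tendsto_eventually)
      next
        case False
        then show ?thesis by simp
      qed
      show "(norm ((\<Sum>j<i. indicator (A j) x :: complex) - indicator (\<Union> (range A)) x))\<^sup>2 \<le> 1" for i x
        unfolding sum by (auto simp: indicator_def)
      show "(\<integral>\<^sup>+x. ennreal 1 \<partial>haar_circle) < \<infinity>" by (rule haar_finite_const)
    qed simp
  qed (auto simp: Int_stable_def)
qed

lemma trig_approx_L2:
  assumes [measurable]: "f \<in> borel_measurable borel" and fin: "sqnorm f < \<infinity>"
  shows "trig_approx f"
proof -
  obtain F where F: "\<And>i. simple_function borel (F i)" "\<And>x. (\<lambda>i. F i x) \<longlonglongrightarrow> f x"
    "\<And>i x. norm (F i x) \<le> 2 * norm (f x)"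
    using borel_measurable_implies_sequence_metric[OF assms(1), of 0] by auto
  show ?thesis
  \<comment> \<open>The 9 is the square of 3: the simple functions are bounded by 2 |f|, so the
    error is at most 3 |f|.\<close>
  proof (rule trig_approx_limit[where g = F and w = "\<lambda>x. 9 * (norm (f x))\<^sup>2"])
    show "trig_approx (F i)" for i
    proof -
      have fin: "finite (range (F i))" using simple_functionD(1)[OF F(1)] by simp
      have "F i = (\<lambda>x. \<Sum>y\<in>range (F i). y * indicator (F i -` {y}) x)"
      proof
        fix x
        have "(\<Sum>y\<in>range (F i). y * indicator (F i -` {y}) x) = (\<Sum>y\<in>range (F i). if y = F i x then y else 0)"
          by (intro sum.cong) (auto simp: indicator_def)
        also have "\<dots> = F i x" using fin by simp
        finally show "F i x = (\<Sum>y\<in>range (F i). y * indicator (F i -` {y}) x)" by simp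
      qed
      moreover have "F i -` {y} \<in> sets borel" for y
        using simple_functionD(2)[OF F(1)[of i], of "{y}"] by simp
      then have "trig_approx (\<lambda>x. \<Sum>y\<in>range (F i). y * indicator (F i -` {y}) x)"
        by (intro trig_approx_sum trig_approx_cmult trig_approx_indicator)
      ultimately show ?thesis by simp
    qed
    show "(norm (F i x - f x))\<^sup>2 \<le> 9 * (norm (f x))\<^sup>2" for i x
    proof -
      have "norm (F i x - f x) \<le> 3 * norm (f x)" using F(3)[of i x] norm_triangle_ineq4[of "F i x" "f x"] by linarith
      then have "(norm (F i x - f x))\<^sup>2 \<le> (3 * norm (f x))\<^sup>2" by (intro power_mono) auto
      then show ?thesis by (simp add: power_mult_distrib)
    qed
    have "(\<integral>\<^sup>+x. ennreal (9 * (norm (f x))\<^sup>2) \<partial>haar_circle) = 9 * sqnorm f"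
      unfolding sqnorm_def by (simp add: ennreal_mult' nn_integral_cmult)
    then show "(\<integral>\<^sup>+x. ennreal (9 * (norm (f x))\<^sup>2) \<partial>haar_circle) < \<infinity>"
      using fin by (simp add: ennreal_mult_less_top)
  qed (use F in auto)
qed

section \<open>Marcinkiewicz interpolation\<close>

lemma nn_integral_powr_from_0:
  fixes q y :: real
  assumes "q > 0" "y \<ge> 0"
  shows "(\<integral>\<^sup>+t. (if 0 \<le> t \<and> t \<le> y then ennreal (q * t powr (q - 1)) else 0) \<partial>lborel) = ennreal (y powr q)"
proof -
  have "((\<lambda>t. q * t powr (q - 1)) has_integral (q * (y powr (q - 1 + 1) / (q - 1 + 1)))) {0..y}"
    using assms by (intro has_integral_mult_right has_integral_powr_from_0) auto
  then have "((\<lambda>t. q * t powr (q - 1)) has_integral (y powr q)) {0..y}" using assms(1) by simp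
  then have "(\<integral>\<^sup>+t. ennreal (q * t powr (q - 1)) * indicator {0..y} t \<partial>lborel) = ennreal (y powr q)"
    using assms by (intro nn_integral_has_integral_lebesgue') auto
  then show ?thesis
    by (subst nn_integral_cong[where v = "\<lambda>t. ennreal (q * t powr (q - 1)) * indicator {0..y} t"])
      (auto simp: indicator_def)
qed

lemma nn_integral_powr_to_infinity:
  fixes q y :: real
  assumes "q > 0" "y > 0"
  shows "(\<integral>\<^sup>+t. (if y \<le> t then ennreal (q * t powr (- q - 1)) else 0) \<partial>lborel) = ennreal (y powr (- q))"
proof -
  have "((\<lambda>t. q * t powr (- q - 1)) has_integral (q * (- (y powr (- q - 1 + 1)) / (- q - 1 + 1)))) {y..}"
    using assms by (intro has_integral_mult_right has_integral_powr_to_inf) auto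
  then have "((\<lambda>t. q * t powr (- q - 1)) has_integral (y powr (- q))) {y..}" using assms(1) by simp
  then have "(\<integral>\<^sup>+t. ennreal (q * t powr (- q - 1)) * indicator {y..} t \<partial>lborel) = ennreal (y powr (- q))"
    using assms by (intro nn_integral_has_integral_lebesgue') auto
  then show ?thesis
    by (subst nn_integral_cong[where v = "\<lambda>t. ennreal (q * t powr (- q - 1)) * indicator {y..} t"])
      (auto simp: indicator_def)
qed

interpretation haar_lborel: pair_sigma_finite haar_circle "lborel :: real measure" ..

lemma layer_cake:
  fixes g :: "circle \<Rightarrow> real"
  assumes [measurable]: "g \<in> borel_measurable borel" and "\<And>x. 0 \<le> g x" "p > 0"
  shows "(\<integral>\<^sup>+x. ennreal (g x powr p) \<partial>haar_circle)
    = (\<integral>\<^sup>+t. \<integral>\<^sup>+x. (if 0 \<le> t \<and> t \<le> g x then ennreal (p * t powr (p - 1)) else 0) \<partial>haar_circle \<partial>lborel)"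
proof -
  have "(\<integral>\<^sup>+x. ennreal (g x powr p) \<partial>haar_circle)
    = (\<integral>\<^sup>+x. \<integral>\<^sup>+t. (if 0 \<le> t \<and> t \<le> g x then ennreal (p * t powr (p - 1)) else 0) \<partial>lborel \<partial>haar_circle)"
    using assms(2,3) by (intro nn_integral_cong nn_integral_powr_from_0[symmetric]) auto
  also have "\<dots> = (\<integral>\<^sup>+t. \<integral>\<^sup>+x. (if 0 \<le> t \<and> t \<le> g x then ennreal (p * t powr (p - 1)) else 0) \<partial>haar_circle \<partial>lborel)"
    by (rule haar_lborel.Fubini'[symmetric]) measurable
  finally show ?thesis .
qed

lemma powr_div_square: "t > 0 \<Longrightarrow> t powr (p - 1) / t\<^sup>2 = t powr (p - 3)" for t p :: real
proof -
  assume "t > 0"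
  have "t powr (p - 3) = t powr ((p - 1) - 2)" by simp
  also have "\<dots> = t powr (p - 1) / t powr 2" by (rule powr_diff)
  also have "t powr 2 = t\<^sup>2" using \<open>t > 0\<close> by simp
  finally show ?thesis ..
qed

lemma chebyshev_square:
  assumes [measurable]: "h \<in> borel_measurable borel" and "t > 0"
  shows "(\<integral>\<^sup>+x. (if t / 2 \<le> norm (h x) then 1 else 0) \<partial>haar_circle) \<le> ennreal (4 / t\<^sup>2) * sqnorm h"
proof -
  have "(\<integral>\<^sup>+x. (if t / 2 \<le> norm (h x) then 1 else 0) \<partial>haar_circle)
    \<le> (\<integral>\<^sup>+x. ennreal (4 / t\<^sup>2) * ennreal ((norm (h x))\<^sup>2) \<partial>haar_circle)"
  proof (rule nn_integral_mono)
    fix x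
    have "(t / 2)\<^sup>2 \<le> (norm (h x))\<^sup>2" if "t / 2 \<le> norm (h x)" using that assms(2) by (intro power_mono) auto
    then have "1 \<le> 4 / t\<^sup>2 * (norm (h x))\<^sup>2" if "t / 2 \<le> norm (h x)"
      using that assms(2) by (simp add: power_divide field_simps)
    then show "(if t / 2 \<le> norm (h x) then 1 else 0) \<le> ennreal (4 / t\<^sup>2) * ennreal ((norm (h x))\<^sup>2)"
      by (auto simp: ennreal_mult'[symmetric] simp flip: ennreal_1 intro!: ennreal_leI)
  qed
  also have "\<dots> = ennreal (4 / t\<^sup>2) * sqnorm h"
    unfolding sqnorm_def by (rule nn_integral_cmult) simp
  finally show ?thesis .
qed

lemma chebyshev_linear:
  assumes [measurable]: "h \<in> borel_measurable borel" and "t > 0"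
  shows "(\<integral>\<^sup>+x. (if t / 2 \<le> norm (h x) then 1 else 0) \<partial>haar_circle)
    \<le> ennreal (2 / t) * (\<integral>\<^sup>+x. norm (h x) \<partial>haar_circle)"
proof -
  have "(\<integral>\<^sup>+x. (if t / 2 \<le> norm (h x) then 1 else 0) \<partial>haar_circle)
    \<le> (\<integral>\<^sup>+x. ennreal (2 / t) * ennreal (norm (h x)) \<partial>haar_circle)"
  proof (rule nn_integral_mono)
    fix x
    have "1 \<le> 2 / t * norm (h x)" if "t / 2 \<le> norm (h x)"
      using that assms(2) by (simp add: field_simps)
    then show "(if t / 2 \<le> norm (h x) then 1 else 0) \<le> ennreal (2 / t) * ennreal (norm (h x))"
      using assms(2) by (auto simp: ennreal_mult'[symmetric] simp flip: ennreal_1 intro!: ennreal_leI)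
  qed
  also have "\<dots> = ennreal (2 / t) * (\<integral>\<^sup>+x. norm (h x) \<partial>haar_circle)"
    by (rule nn_integral_cmult) simp
  finally show ?thesis .
qed

text \<open>Cutting a function in two uses subadditivity only, and only almost everywhere, because
  the convolution operator is additive only up to null sets.\<close>

locale sublinear_operator =
  fixes S :: "(circle \<Rightarrow> complex) \<Rightarrow> circle \<Rightarrow> complex"
  assumes measurable_S: "\<And>f. f \<in> borel_measurable borel \<Longrightarrow> S f \<in> borel_measurable borel"
    and subadditive: "\<And>f g. integrable haar_circle f \<Longrightarrow> integrable haar_circle g \<Longrightarrow>
      AE x in haar_circle. norm (S (\<lambda>x. f x + g x) x) \<le> norm (S f x) + norm (S g x)"
begin

lemma truncate_AE:
  assumes "integrable haar_circle f" and [measurable]: "P \<in> measurable borel (count_space UNIV)"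
  shows "AE x in haar_circle. norm (S f x)
    \<le> norm (S (\<lambda>x. if P x then f x else 0) x) + norm (S (\<lambda>x. if P x then 0 else f x) x)"
proof -
  have [measurable]: "f \<in> borel_measurable borel" using assms(1) by (simp add: integrable_iff_bounded)
  have "integrable haar_circle (\<lambda>x. if P x then f x else 0)" "integrable haar_circle (\<lambda>x. if P x then 0 else f x)"
    by (rule Bochner_Integration.integrable_bound[OF assms(1)]; auto)+
  from subadditive[OF this] show ?thesis by (simp add: if_distrib cong: if_cong)
qed

text \<open>At level t the function is cut at height t/(2B): the low part contributes at most t/2
  everywhere, so Chebyshev in \<open>L^2\<close> for the tall part suffices. The remaining integral
  of t^(p - 3) converges at 0 because p > 2.\<close>

lemma strong_type_above_2:
  assumes p: "p > 2" and A: "A > 0" and B: "B > 0"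
    and L2: "\<And>f. f \<in> borel_measurable borel \<Longrightarrow> sqnorm f < \<infinity> \<Longrightarrow> sqnorm (S f) \<le> ennreal A * sqnorm f"
    and Linf: "\<And>f K x. f \<in> borel_measurable borel \<Longrightarrow> (\<And>x. norm (f x) \<le> K) \<Longrightarrow> norm (S f x) \<le> B * K"
    and f: "integrable haar_circle f" "sqnorm f < \<infinity>"
  shows "(\<integral>\<^sup>+x. norm (S f x) powr p \<partial>haar_circle)
    \<le> ennreal (4 * A * p / (p - 2) * (2 * B) powr (p - 2)) * (\<integral>\<^sup>+x. norm (f x) powr p \<partial>haar_circle)"
proof -
  have [measurable]: "f \<in> borel_measurable borel" using f(1) by (simp add: integrable_iff_bounded)
  note [measurable] = measurable_S
  let ?R = "\<lambda>t x. if 0 \<le> t \<and> t \<le> 2 * B * norm (f x)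
    then ennreal (4 * A * p / (p - 2) * (norm (f x))\<^sup>2) * ennreal ((p - 2) * t powr (p - 2 - 1)) else 0"
  have level: "(\<integral>\<^sup>+x. (if 0 \<le> t \<and> t \<le> norm (S f x) then ennreal (p * t powr (p - 1)) else 0) \<partial>haar_circle)
      \<le> (\<integral>\<^sup>+x. ?R t x \<partial>haar_circle)" for t
  proof (cases "t > 0")
    case False
    then have "(\<integral>\<^sup>+x. (if 0 \<le> t \<and> t \<le> norm (S f x) then ennreal (p * t powr (p - 1)) else 0) \<partial>haar_circle)
      = (\<integral>\<^sup>+x. 0 \<partial>haar_circle)" by (intro nn_integral_cong) auto
    then show ?thesis by simp
  next
    case t: True
    let ?P = "\<lambda>x. t \<le> 2 * B * norm (f x)"
    let ?f1 = "\<lambda>x. if ?P x then f x else 0" and ?f2 = "\<lambda>x. if ?P x then 0 else f x"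
    have f2: "norm (S ?f2 x) \<le> t / 2" for x
    proof -
      have "norm (S ?f2 x) \<le> B * (t / (2 * B))"
        using B t by (intro Linf) (auto simp: field_simps)
      then show ?thesis using B by simp
    qed
    have sq1: "sqnorm ?f1 \<le> sqnorm f" unfolding sqnorm_def by (intro nn_integral_mono) auto
    have "(\<integral>\<^sup>+x. (if 0 \<le> t \<and> t \<le> norm (S f x) then ennreal (p * t powr (p - 1)) else 0) \<partial>haar_circle)
      \<le> (\<integral>\<^sup>+x. ennreal (p * t powr (p - 1)) * (if t / 2 \<le> norm (S ?f1 x) then 1 else 0) \<partial>haar_circle)"
    proof (rule nn_integral_mono_AE)
      have P: "?P \<in> measurable borel (count_space UNIV)" by measurable
      show "AE x in haar_circle. (if 0 \<le> t \<and> t \<le> norm (S f x) then ennreal (p * t powr (p - 1)) else 0)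
        \<le> ennreal (p * t powr (p - 1)) * (if t / 2 \<le> norm (S ?f1 x) then 1 else 0)"
        using truncate_AE[OF f(1) P]
      proof eventually_elim
        case (elim x)
        then have "t / 2 \<le> norm (S ?f1 x)" if "t \<le> norm (S f x)" using f2[of x] that by linarith
        then show ?case by auto
      qed
    qed
    also have "\<dots> = ennreal (p * t powr (p - 1)) * (\<integral>\<^sup>+x. (if t / 2 \<le> norm (S ?f1 x) then 1 else 0) \<partial>haar_circle)"
      by (rule nn_integral_cmult) measurable
    also have "\<dots> \<le> ennreal (p * t powr (p - 1)) * (ennreal (4 / t\<^sup>2) * (ennreal A * sqnorm ?f1))"
    proof (intro mult_left_mono order_trans[OF chebyshev_square] t L2)
      show "sqnorm ?f1 < \<infinity>" using sq1 f(2) by (rule le_less_trans)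
    qed measurable
    also have "\<dots> = (\<integral>\<^sup>+x. ennreal (p * t powr (p - 1)) * (ennreal (4 / t\<^sup>2) * (ennreal A * ennreal ((norm (?f1 x))\<^sup>2))) \<partial>haar_circle)"
      unfolding sqnorm_def by (simp add: nn_integral_cmult)
    also have "\<dots> = (\<integral>\<^sup>+x. ?R t x \<partial>haar_circle)"
    proof (rule nn_integral_cong)
      fix x
      have "ennreal (p * t powr (p - 1)) * (ennreal (4 / t\<^sup>2) * (ennreal A * ennreal ((norm (f x))\<^sup>2)))
        = ennreal (4 * A * p * (norm (f x))\<^sup>2 * (t powr (p - 1) / t\<^sup>2))"
        using p A t by (simp add: ennreal_mult'[symmetric] mult_ac)
      also have "\<dots> = ennreal (4 * A * p / (p - 2) * (norm (f x))\<^sup>2) * ennreal ((p - 2) * t powr (p - 2 - 1))"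
        unfolding powr_div_square[OF t] using p A by (subst ennreal_mult'[symmetric]) auto
      finally show "ennreal (p * t powr (p - 1)) * (ennreal (4 / t\<^sup>2) * (ennreal A * ennreal ((norm (?f1 x))\<^sup>2))) = ?R t x"
        using t by simp
    qed
    finally show ?thesis .
  qed
  have "(\<integral>\<^sup>+x. norm (S f x) powr p \<partial>haar_circle) \<le> (\<integral>\<^sup>+t. \<integral>\<^sup>+x. ?R t x \<partial>haar_circle \<partial>lborel)"
    using p by (subst layer_cake) (auto intro!: nn_integral_mono level)
  also have "\<dots> = (\<integral>\<^sup>+x. \<integral>\<^sup>+t. ?R t x \<partial>lborel \<partial>haar_circle)"
    by (rule haar_lborel.Fubini') measurable
  also have "\<dots> = (\<integral>\<^sup>+x. ennreal (4 * A * p / (p - 2) * (2 * B) powr (p - 2)) * ennreal (norm (f x) powr p) \<partial>haar_circle)"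
  proof (rule nn_integral_cong)
    fix x
    let ?c = "4 * A * p / (p - 2) * (norm (f x))\<^sup>2"
    have "(\<integral>\<^sup>+t. ?R t x \<partial>lborel) = (\<integral>\<^sup>+t. ennreal ?c *
      (if 0 \<le> t \<and> t \<le> 2 * B * norm (f x) then ennreal ((p - 2) * t powr (p - 2 - 1)) else 0) \<partial>lborel)"
      by (intro nn_integral_cong) auto
    also have "\<dots> = ennreal ?c * ennreal ((2 * B * norm (f x)) powr (p - 2))"
      using p B by (subst nn_integral_cmult) (auto simp: nn_integral_powr_from_0)
    also have "\<dots> = ennreal (?c * (2 * B * norm (f x)) powr (p - 2))"
      using p A by (intro ennreal_mult'[symmetric]) auto
    also have "?c * (2 * B * norm (f x)) powr (p - 2)
      = 4 * A * p / (p - 2) * (2 * B) powr (p - 2) * ((norm (f x))\<^sup>2 * norm (f x) powr (p - 2))"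
      using B by (simp add: powr_mult)
    also have "(norm (f x))\<^sup>2 * norm (f x) powr (p - 2) = norm (f x) powr p"
      using p by (cases "f x = 0") (simp_all add: powr_diff)
    also have "ennreal (4 * A * p / (p - 2) * (2 * B) powr (p - 2) * norm (f x) powr p)
      = ennreal (4 * A * p / (p - 2) * (2 * B) powr (p - 2)) * ennreal (norm (f x) powr p)"
      using p A B by (intro ennreal_mult') auto
    finally show "(\<integral>\<^sup>+t. ?R t x \<partial>lborel) = \<dots>" .
  qed
  also have "\<dots> = ennreal (4 * A * p / (p - 2) * (2 * B) powr (p - 2)) * (\<integral>\<^sup>+x. norm (f x) powr p \<partial>haar_circle)"
    by (rule nn_integral_cmult) measurable
  finally show ?thesis .
qed

text \<open>The cut is at height c t. The tall part is treated in \<open>L^1\<close>, with an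
  integral over t that converges at 0 because p > 1; the low part in \<open>L^2\<close>, with one
  that converges at infinity because p < 2. The parameter \<open>c\<close> stays free so that the
  two terms can be balanced later.\<close>

lemma strong_type_below_2:
  assumes p: "1 < p" "p < 2" and A: "A > 0" and B: "B > 0" and c: "c > 0"
    and L2: "\<And>f. f \<in> borel_measurable borel \<Longrightarrow> sqnorm f < \<infinity> \<Longrightarrow> sqnorm (S f) \<le> ennreal A * sqnorm f"
    and L1: "\<And>f. f \<in> borel_measurable borel \<Longrightarrow>
      (\<integral>\<^sup>+x. norm (S f x) \<partial>haar_circle) \<le> ennreal B * (\<integral>\<^sup>+x. norm (f x) \<partial>haar_circle)"
    and f: "integrable haar_circle f"
  shows "(\<integral>\<^sup>+x. norm (S f x) powr p \<partial>haar_circle)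
    \<le> ennreal (2 * B * p / (p - 1) * c powr (1 - p) + 4 * A * p / (2 - p) * c powr (2 - p))
      * (\<integral>\<^sup>+x. norm (f x) powr p \<partial>haar_circle)"
proof -
  have [measurable]: "f \<in> borel_measurable borel" using f by (simp add: integrable_iff_bounded)
  note [measurable] = measurable_S
  let ?R1 = "\<lambda>t x. if 0 \<le> t \<and> t \<le> norm (f x) / c
    then ennreal (2 * B * p / (p - 1) * norm (f x)) * ennreal ((p - 1) * t powr (p - 1 - 1)) else 0"
  let ?R2 = "\<lambda>t x. if norm (f x) / c \<le> t \<and> 0 < t
    then ennreal (4 * A * p / (2 - p) * (norm (f x))\<^sup>2) * ennreal ((2 - p) * t powr (- (2 - p) - 1)) else 0"
  have level: "(\<integral>\<^sup>+x. (if 0 \<le> t \<and> t \<le> norm (S f x) then ennreal (p * t powr (p - 1)) else 0) \<partial>haar_circle)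
      \<le> (\<integral>\<^sup>+x. ?R1 t x \<partial>haar_circle) + (\<integral>\<^sup>+x. ?R2 t x \<partial>haar_circle)" for t
  proof (cases "t > 0")
    case False
    then have "(\<integral>\<^sup>+x. (if 0 \<le> t \<and> t \<le> norm (S f x) then ennreal (p * t powr (p - 1)) else 0) \<partial>haar_circle)
      = (\<integral>\<^sup>+x. 0 \<partial>haar_circle)" by (intro nn_integral_cong) auto
    then show ?thesis by simp
  next
    case t: True
    let ?P = "\<lambda>x. c * t < norm (f x)"
    let ?f1 = "\<lambda>x. if ?P x then f x else 0" and ?f2 = "\<lambda>x. if ?P x then 0 else f x"
    let ?w = "ennreal (p * t powr (p - 1))"
    let ?I1 = "\<lambda>x. if t / 2 \<le> norm (S ?f1 x) then 1 else 0 :: ennreal"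
    let ?I2 = "\<lambda>x. if t / 2 \<le> norm (S ?f2 x) then 1 else 0 :: ennreal"
    have fin2: "sqnorm ?f2 < \<infinity>"
    proof -
      have "sqnorm ?f2 \<le> (\<integral>\<^sup>+x. ennreal ((c * t)\<^sup>2) \<partial>haar_circle)"
        unfolding sqnorm_def using c t by (intro nn_integral_mono ennreal_leI power_mono) auto
      also have "\<dots> < \<infinity>" by (rule haar_finite_const)
      finally show ?thesis .
    qed
    have "(\<integral>\<^sup>+x. (if 0 \<le> t \<and> t \<le> norm (S f x) then ?w else 0) \<partial>haar_circle)
      \<le> (\<integral>\<^sup>+x. ?w * ?I1 x + ?w * ?I2 x \<partial>haar_circle)"
    proof (rule nn_integral_mono_AE)
      have P: "?P \<in> measurable borel (count_space UNIV)" by measurable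
      show "AE x in haar_circle. (if 0 \<le> t \<and> t \<le> norm (S f x) then ?w else 0) \<le> ?w * ?I1 x + ?w * ?I2 x"
        using truncate_AE[OF f P]
      proof eventually_elim
        case (elim x)
        then have "t / 2 \<le> norm (S ?f1 x) \<or> t / 2 \<le> norm (S ?f2 x)" if "t \<le> norm (S f x)" using that by linarith
        then show ?case by auto
      qed
    qed
    also have "\<dots> = ?w * (\<integral>\<^sup>+x. ?I1 x \<partial>haar_circle) + ?w * (\<integral>\<^sup>+x. ?I2 x \<partial>haar_circle)"
      by (simp add: nn_integral_add nn_integral_cmult)
    also have "\<dots> \<le> ?w * (ennreal (2 / t) * (ennreal B * (\<integral>\<^sup>+x. norm (?f1 x) \<partial>haar_circle)))
        + ?w * (ennreal (4 / t\<^sup>2) * (ennreal A * sqnorm ?f2))"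
    proof (rule add_mono)
      have 1: "(\<integral>\<^sup>+x. ?I1 x \<partial>haar_circle) \<le> ennreal (2 / t) * (\<integral>\<^sup>+x. norm (S ?f1 x) \<partial>haar_circle)"
        by (rule chebyshev_linear[OF _ t]) measurable
      have 2: "(\<integral>\<^sup>+x. norm (S ?f1 x) \<partial>haar_circle) \<le> ennreal B * (\<integral>\<^sup>+x. norm (?f1 x) \<partial>haar_circle)"
        by (rule L1) measurable
      show "?w * (\<integral>\<^sup>+x. ?I1 x \<partial>haar_circle) \<le> ?w * (ennreal (2 / t) * (ennreal B * (\<integral>\<^sup>+x. norm (?f1 x) \<partial>haar_circle)))"
        by (rule mult_left_mono[OF order_trans[OF 1 mult_left_mono[OF 2]]]) auto
      have 3: "(\<integral>\<^sup>+x. ?I2 x \<partial>haar_circle) \<le> ennreal (4 / t\<^sup>2) * sqnorm (S ?f2)"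
        by (rule chebyshev_square[OF _ t]) measurable
      have 4: "sqnorm (S ?f2) \<le> ennreal A * sqnorm ?f2" by (rule L2[OF _ fin2]) measurable
      show "?w * (\<integral>\<^sup>+x. ?I2 x \<partial>haar_circle) \<le> ?w * (ennreal (4 / t\<^sup>2) * (ennreal A * sqnorm ?f2))"
        by (rule mult_left_mono[OF order_trans[OF 3 mult_left_mono[OF 4]]]) auto
    qed
    also have "?w * (ennreal (2 / t) * (ennreal B * (\<integral>\<^sup>+x. norm (?f1 x) \<partial>haar_circle)))
      = (\<integral>\<^sup>+x. ?w * (ennreal (2 / t) * (ennreal B * ennreal (norm (?f1 x)))) \<partial>haar_circle)"
      by (simp add: nn_integral_cmult)
    also have "\<dots> \<le> (\<integral>\<^sup>+x. ?R1 t x \<partial>haar_circle)"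
    proof (rule nn_integral_mono)
      fix x
      have "?w * (ennreal (2 / t) * (ennreal B * ennreal (norm (f x))))
        = ennreal (2 * B * p * norm (f x) * (t powr (p - 1) / t))"
        using p B t by (simp add: ennreal_mult'[symmetric] mult_ac)
      also have "t powr (p - 1) / t = t powr (p - 1 - 1)" using t by (simp add: powr_diff power2_eq_square)
      also have "ennreal (2 * B * p * norm (f x) * t powr (p - 1 - 1))
        = ennreal (2 * B * p / (p - 1) * norm (f x)) * ennreal ((p - 1) * t powr (p - 1 - 1))"
        using p B by (subst ennreal_mult'[symmetric]) auto
      finally show "?w * (ennreal (2 / t) * (ennreal B * ennreal (norm (?f1 x)))) \<le> ?R1 t x"
        using t c by (auto simp: field_simps)
    qed
    also have "?w * (ennreal (4 / t\<^sup>2) * (ennreal A * sqnorm ?f2))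
      = (\<integral>\<^sup>+x. ?w * (ennreal (4 / t\<^sup>2) * (ennreal A * ennreal ((norm (?f2 x))\<^sup>2))) \<partial>haar_circle)"
      unfolding sqnorm_def by (simp add: nn_integral_cmult)
    also have "\<dots> \<le> (\<integral>\<^sup>+x. ?R2 t x \<partial>haar_circle)"
    proof (rule nn_integral_mono)
      fix x
      have "?w * (ennreal (4 / t\<^sup>2) * (ennreal A * ennreal ((norm (f x))\<^sup>2)))
        = ennreal (4 * A * p * (norm (f x))\<^sup>2 * (t powr (p - 1) / t\<^sup>2))"
        using p A t by (simp add: ennreal_mult'[symmetric] mult_ac)
      also have "\<dots> = ennreal (4 * A * p / (2 - p) * (norm (f x))\<^sup>2) * ennreal ((2 - p) * t powr (p - 3))"
        unfolding powr_div_square[OF t] using p A by (subst ennreal_mult'[symmetric]) auto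
      also have "p - 3 = - (2 - p) - 1" by simp
      finally show "?w * (ennreal (4 / t\<^sup>2) * (ennreal A * ennreal ((norm (?f2 x))\<^sup>2))) \<le> ?R2 t x"
        using t c by (auto simp: field_simps)
    qed
    finally show ?thesis by (simp add: add_mono)
  qed
  have "(\<integral>\<^sup>+x. norm (S f x) powr p \<partial>haar_circle)
    \<le> (\<integral>\<^sup>+t. (\<integral>\<^sup>+x. ?R1 t x \<partial>haar_circle) + (\<integral>\<^sup>+x. ?R2 t x \<partial>haar_circle) \<partial>lborel)"
    using p by (subst layer_cake) (auto intro!: nn_integral_mono level)
  also have "\<dots> = (\<integral>\<^sup>+t. \<integral>\<^sup>+x. ?R1 t x \<partial>haar_circle \<partial>lborel) + (\<integral>\<^sup>+t. \<integral>\<^sup>+x. ?R2 t x \<partial>haar_circle \<partial>lborel)"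
    by (rule nn_integral_add) measurable
  also have "(\<integral>\<^sup>+t. \<integral>\<^sup>+x. ?R1 t x \<partial>haar_circle \<partial>lborel) = (\<integral>\<^sup>+x. \<integral>\<^sup>+t. ?R1 t x \<partial>lborel \<partial>haar_circle)"
    by (rule haar_lborel.Fubini') measurable
  also have "\<dots> = (\<integral>\<^sup>+x. ennreal (2 * B * p / (p - 1) * c powr (1 - p)) * ennreal (norm (f x) powr p) \<partial>haar_circle)"
  proof (rule nn_integral_cong)
    fix x
    let ?d = "2 * B * p / (p - 1) * norm (f x)"
    have "(\<integral>\<^sup>+t. ?R1 t x \<partial>lborel) = (\<integral>\<^sup>+t. ennreal ?d *
      (if 0 \<le> t \<and> t \<le> norm (f x) / c then ennreal ((p - 1) * t powr (p - 1 - 1)) else 0) \<partial>lborel)"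
      by (intro nn_integral_cong) auto
    also have "\<dots> = ennreal ?d * ennreal ((norm (f x) / c) powr (p - 1))"
      using p c by (subst nn_integral_cmult) (auto simp: nn_integral_powr_from_0)
    also have "\<dots> = ennreal (?d * (norm (f x) / c) powr (p - 1))"
      using p B by (intro ennreal_mult'[symmetric]) auto
    also have "?d * (norm (f x) / c) powr (p - 1)
      = 2 * B * p / (p - 1) * c powr (1 - p) * (norm (f x) * norm (f x) powr (p - 1))"
      using c by (simp add: powr_divide powr_diff)
    also have "norm (f x) * norm (f x) powr (p - 1) = norm (f x) powr p"
      using p by (cases "f x = 0") (simp_all add: powr_diff)
    also have "ennreal (2 * B * p / (p - 1) * c powr (1 - p) * norm (f x) powr p)
      = ennreal (2 * B * p / (p - 1) * c powr (1 - p)) * ennreal (norm (f x) powr p)"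
      using p B by (intro ennreal_mult') auto
    finally show "(\<integral>\<^sup>+t. ?R1 t x \<partial>lborel) = \<dots>" .
  qed
  also have "(\<integral>\<^sup>+t. \<integral>\<^sup>+x. ?R2 t x \<partial>haar_circle \<partial>lborel) = (\<integral>\<^sup>+x. \<integral>\<^sup>+t. ?R2 t x \<partial>lborel \<partial>haar_circle)"
    by (rule haar_lborel.Fubini') measurable
  also have "\<dots> = (\<integral>\<^sup>+x. ennreal (4 * A * p / (2 - p) * c powr (2 - p)) * ennreal (norm (f x) powr p) \<partial>haar_circle)"
  proof (rule nn_integral_cong)
    fix x
    let ?d = "4 * A * p / (2 - p) * (norm (f x))\<^sup>2"
    show "(\<integral>\<^sup>+t. ?R2 t x \<partial>lborel) = ennreal (4 * A * p / (2 - p) * c powr (2 - p)) * ennreal (norm (f x) powr p)"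
    proof (cases "f x = 0")
      case True
      have "(\<integral>\<^sup>+t. ?R2 t x \<partial>lborel) = integral\<^sup>N lborel (\<lambda>t :: real. 0)"
        by (intro nn_integral_cong) (simp add: True)
      then show ?thesis using p True by simp
    next
      case False
      then have pos: "0 < norm (f x) / c" using c by simp
      have "(\<integral>\<^sup>+t. ?R2 t x \<partial>lborel) = (\<integral>\<^sup>+t. ennreal ?d *
        (if norm (f x) / c \<le> t then ennreal ((2 - p) * t powr (- (2 - p) - 1)) else 0) \<partial>lborel)"
        using pos by (intro nn_integral_cong) auto
      also have "\<dots> = ennreal ?d * ennreal ((norm (f x) / c) powr (- (2 - p)))"
        using p nn_integral_powr_to_infinity[OF _ pos, of "2 - p"] by (subst nn_integral_cmult) auto
      also have "\<dots> = ennreal (?d * (norm (f x) / c) powr (- (2 - p)))"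
        using p A by (intro ennreal_mult'[symmetric]) auto
      also have "?d * (norm (f x) / c) powr (- (2 - p))
        = 4 * A * p / (2 - p) * c powr (2 - p) * ((norm (f x))\<^sup>2 * norm (f x) powr (p - 2))"
      proof -
        have "(norm (f x) / c) powr (- (2 - p)) = c powr (2 - p) * norm (f x) powr (p - 2)"
          using c False by (simp add: powr_divide powr_diff)
        then show ?thesis by simp
      qed
      also have "(norm (f x))\<^sup>2 * norm (f x) powr (p - 2) = norm (f x) powr p"
        using False by (simp add: powr_diff)
      also have "ennreal (4 * A * p / (2 - p) * c powr (2 - p) * norm (f x) powr p)
        = ennreal (4 * A * p / (2 - p) * c powr (2 - p)) * ennreal (norm (f x) powr p)"
        using p A by (intro ennreal_mult') auto
      finally show ?thesis .
    qed
  qed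
  also have "(\<integral>\<^sup>+x. ennreal (2 * B * p / (p - 1) * c powr (1 - p)) * ennreal (norm (f x) powr p) \<partial>haar_circle)
      + (\<integral>\<^sup>+x. ennreal (4 * A * p / (2 - p) * c powr (2 - p)) * ennreal (norm (f x) powr p) \<partial>haar_circle)
    = ennreal (2 * B * p / (p - 1) * c powr (1 - p)) * (\<integral>\<^sup>+x. norm (f x) powr p \<partial>haar_circle)
      + ennreal (4 * A * p / (2 - p) * c powr (2 - p)) * (\<integral>\<^sup>+x. norm (f x) powr p \<partial>haar_circle)"
    by (simp add: nn_integral_cmult)
  also have "\<dots> = ennreal (2 * B * p / (p - 1) * c powr (1 - p) + 4 * A * p / (2 - p) * c powr (2 - p))
      * (\<integral>\<^sup>+x. norm (f x) powr p \<partial>haar_circle)"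
    unfolding distrib_right[symmetric] using p A B by (subst ennreal_plus) auto
  finally show ?thesis .
qed

end

section \<open>Newton polynomials of the convolution operator\<close>

text \<open>The product of the operators T - x_i applied to f. It acts on representatives, so
  linearity and commutation with T hold only almost everywhere.\<close>

primrec newton_iter :: "circle measure \<Rightarrow> (nat \<Rightarrow> complex) \<Rightarrow> nat \<Rightarrow> (circle \<Rightarrow> complex) \<Rightarrow> circle \<Rightarrow> complex" where
  "newton_iter \<nu> x 0 f = f"
| "newton_iter \<nu> x (Suc k) f = (\<lambda>y. conv_op \<nu> (newton_iter \<nu> x k f) y - x k * newton_iter \<nu> x k f y)"

definition newton_poly :: "(nat \<Rightarrow> complex) \<Rightarrow> nat \<Rightarrow> complex \<Rightarrow> complex" where
  "newton_poly x k w = (\<Prod>i<k. w - x i)"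

lemma integrable_if_sqnorm:
  assumes [measurable]: "f \<in> borel_measurable borel" and "sqnorm f < \<infinity>"
  shows "integrable haar_circle f"
proof -
  have "(\<integral>\<^sup>+x. norm (f x) \<partial>haar_circle) \<le> (\<integral>\<^sup>+x. 1 + ennreal ((norm (f x))\<^sup>2) \<partial>haar_circle)"
  proof (rule nn_integral_mono)
    fix x
    have "2 * norm (f x) \<le> 1 + (norm (f x))\<^sup>2"
      using zero_le_power2[of "norm (f x) - 1"] by (simp add: power2_diff)
    then have "norm (f x) \<le> 1 + (norm (f x))\<^sup>2" using norm_ge_zero[of "f x"] by linarith
    then have "ennreal (norm (f x)) \<le> ennreal (1 + (norm (f x))\<^sup>2)" by (rule ennreal_leI)
    then show "ennreal (norm (f x)) \<le> 1 + ennreal ((norm (f x))\<^sup>2)" by (simp add: ennreal_plus)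
  qed
  also have "\<dots> = 1 + sqnorm f"
    unfolding sqnorm_def using haar.emeasure_space_1 by (subst nn_integral_add) auto
  also have "\<dots> < \<infinity>" using assms(2) by simp
  finally show ?thesis by (simp add: integrable_iff_bounded)
qed

context circle_measure
begin

lemma measurable_newton_iter:
  "f \<in> borel_measurable borel \<Longrightarrow> newton_iter \<nu> x k f \<in> borel_measurable borel"
proof (induction k)
  case (Suc k)
  then have [measurable]: "newton_iter \<nu> x k f \<in> borel_measurable borel" by simp
  show ?case unfolding newton_iter.simps by measurable
qed simp

lemma integrable_newton_iter:
  assumes "integrable haar_circle f"
  shows "integrable haar_circle (newton_iter \<nu> x k f)"
proof (induction k)
  case (Suc k)
  then show ?case unfolding newton_iter.simps
    by (intro Bochner_Integration.integrable_diff integrable_conv_op integrable_mult_right)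
qed (simp add: assms)

text \<open>T is a contraction and |x_k| is at most 1, so every factor has norm at most 2; the
  supremum bound below has the same reason.\<close>

lemma newton_iter_L1:
  assumes [measurable]: "f \<in> borel_measurable borel" and x: "\<And>k. norm (x k) \<le> 1"
  shows "(\<integral>\<^sup>+y. norm (newton_iter \<nu> x k f y) \<partial>haar_circle) \<le> ennreal (2 ^ k) * (\<integral>\<^sup>+y. norm (f y) \<partial>haar_circle)"
proof (induction k)
  case (Suc k)
  let ?g = "newton_iter \<nu> x k f"
  have [measurable]: "?g \<in> borel_measurable borel" by (rule measurable_newton_iter) measurable
  have "(\<integral>\<^sup>+y. norm (newton_iter \<nu> x (Suc k) f y) \<partial>haar_circle)
    \<le> (\<integral>\<^sup>+y. ennreal (norm (conv_op \<nu> ?g y)) + ennreal (norm (?g y)) \<partial>haar_circle)"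
  proof (rule nn_integral_mono)
    fix y
    have "norm (newton_iter \<nu> x (Suc k) f y) \<le> norm (conv_op \<nu> ?g y) + norm (x k * ?g y)"
      by (simp add: norm_triangle_ineq4)
    also have "norm (x k * ?g y) \<le> norm (?g y)"
      unfolding norm_mult using x[of k] by (intro mult_left_le_one_le) auto
    finally have "ennreal (norm (newton_iter \<nu> x (Suc k) f y)) \<le> ennreal (norm (conv_op \<nu> ?g y) + norm (?g y))"
      by (intro ennreal_leI) simp
    then show "ennreal (norm (newton_iter \<nu> x (Suc k) f y)) \<le> ennreal (norm (conv_op \<nu> ?g y)) + ennreal (norm (?g y))"
      by (simp add: ennreal_plus)
  qed
  also have "\<dots> = (\<integral>\<^sup>+y. norm (conv_op \<nu> ?g y) \<partial>haar_circle) + (\<integral>\<^sup>+y. norm (?g y) \<partial>haar_circle)"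
    by (rule nn_integral_add) measurable
  also have "\<dots> \<le> (\<integral>\<^sup>+y. norm (?g y) \<partial>haar_circle) + (\<integral>\<^sup>+y. norm (?g y) \<partial>haar_circle)"
    by (intro add_right_mono conv_op_L1) measurable
  also have "\<dots> = 2 * (\<integral>\<^sup>+y. norm (?g y) \<partial>haar_circle)" by (simp add: mult_2)
  also have "\<dots> \<le> 2 * (ennreal (2 ^ k) * (\<integral>\<^sup>+y. norm (f y) \<partial>haar_circle))"
    by (intro mult_left_mono Suc) simp
  also have "\<dots> = ennreal (2 ^ Suc k) * (\<integral>\<^sup>+y. norm (f y) \<partial>haar_circle)"
    by (simp add: ennreal_mult' mult.assoc)
  finally show ?case .
qed simp

lemma newton_iter_bounded:
  assumes "\<And>y. norm (f y) \<le> K" and x: "\<And>k. norm (x k) \<le> 1"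
  shows "norm (newton_iter \<nu> x k f y) \<le> 2 ^ k * K"
proof (induction k arbitrary: y)
  case (Suc k)
  let ?g = "newton_iter \<nu> x k f"
  have "norm (newton_iter \<nu> x (Suc k) f y) \<le> norm (conv_op \<nu> ?g y) + norm (x k * ?g y)"
    by (simp add: norm_triangle_ineq4)
  also have "norm (x k * ?g y) \<le> norm (?g y)"
    unfolding norm_mult using x[of k] by (intro mult_left_le_one_le) auto
  also have "norm (?g y) \<le> 2 ^ k * K" by (rule Suc)
  also have "norm (conv_op \<nu> ?g y) \<le> 2 ^ k * K" by (rule conv_op_bounded) (rule Suc)
  finally show ?case by (simp add: algebra_simps)
qed (simp add: assms)

text \<open>Exponentially weak, but for fixed \<open>k\<close> it controls what an approximating
  trigonometric polynomial leaves over.\<close>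

lemma newton_iter_L2_crude:
  assumes [measurable]: "f \<in> borel_measurable borel" and x: "\<And>k. norm (x k) \<le> 1"
  shows "sqnorm (newton_iter \<nu> x k f) \<le> ennreal (4 ^ k) * sqnorm f"
proof (induction k)
  case (Suc k)
  let ?g = "newton_iter \<nu> x k f"
  have [measurable]: "?g \<in> borel_measurable borel" by (rule measurable_newton_iter) measurable
  have "sqnorm (newton_iter \<nu> x (Suc k) f) \<le> 2 * sqnorm (conv_op \<nu> ?g) + 2 * sqnorm (\<lambda>y. - x k * ?g y)"
    by (rule sqnorm_add_le) auto
  also have "\<dots> \<le> 2 * sqnorm ?g + 2 * sqnorm ?g"
  proof (intro add_mono mult_left_mono)
    show "sqnorm (conv_op \<nu> ?g) \<le> sqnorm ?g" unfolding sqnorm_def by (rule conv_op_L2) measurable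
    have le: "ennreal ((norm (- x k))\<^sup>2) \<le> 1" using x[of k] by (simp add: power_le_one flip: ennreal_1)
    have "sqnorm (\<lambda>y. - x k * ?g y) = ennreal ((norm (- x k))\<^sup>2) * sqnorm ?g"
      by (rule sqnorm_cmult) measurable
    also have "\<dots> \<le> 1 * sqnorm ?g" by (rule mult_right_mono[OF le]) simp
    finally show "sqnorm (\<lambda>y. - x k * ?g y) \<le> sqnorm ?g" by simp
  qed auto
  also have "\<dots> = 4 * sqnorm ?g" by (simp add: distrib_right[symmetric])
  also have "\<dots> \<le> 4 * (ennreal (4 ^ k) * sqnorm f)" by (intro mult_left_mono Suc) simp
  also have "\<dots> = ennreal (4 ^ Suc k) * sqnorm f" by (simp add: ennreal_mult' mult.assoc)
  finally show ?case .
qed simp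

lemma newton_iter_add_AE:
  assumes f: "integrable haar_circle f" and g: "integrable haar_circle g"
  shows "AE y in haar_circle. newton_iter \<nu> x k (\<lambda>y. f y + g y) y = newton_iter \<nu> x k f y + newton_iter \<nu> x k g y"
proof (induction k)
  case (Suc k)
  let ?F = "newton_iter \<nu> x k f" and ?G = "newton_iter \<nu> x k g" and ?H = "newton_iter \<nu> x k (\<lambda>y. f y + g y)"
  have F: "integrable haar_circle ?F" and G: "integrable haar_circle ?G" and H: "integrable haar_circle ?H"
    using f g by (auto intro: integrable_newton_iter)
  have [measurable]: "?F \<in> borel_measurable borel" "?G \<in> borel_measurable borel" "?H \<in> borel_measurable borel"
    using F G H by (simp_all add: integrable_iff_bounded)
  have "AE y in haar_circle. conv_op \<nu> ?H y = conv_op \<nu> (\<lambda>y. ?F y + ?G y) y"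
    by (rule conv_op_cong_AE[OF _ _ Suc]) measurable
  then show ?case using conv_op_add_AE[OF F G] Suc
    by eventually_elim (simp add: algebra_simps)
qed simp

lemma newton_iter_cmult: "newton_iter \<nu> x k (\<lambda>y. a * f y) = (\<lambda>y. a * newton_iter \<nu> x k f y)"
  by (induction k) (simp_all add: conv_op_cmult right_diff_distrib mult.left_commute)

lemma newton_iter_conv_op_AE:
  assumes f: "integrable haar_circle f"
  shows "AE y in haar_circle. newton_iter \<nu> x k (\<lambda>y. conv_op \<nu> f y - z * f y) y
    = conv_op \<nu> (newton_iter \<nu> x k f) y - z * newton_iter \<nu> x k f y"
proof (induction k)
  case (Suc k)
  let ?F = "newton_iter \<nu> x k f" and ?H = "newton_iter \<nu> x k (\<lambda>y. conv_op \<nu> f y - z * f y)"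
  have F: "integrable haar_circle ?F" and TF: "integrable haar_circle (conv_op \<nu> ?F)" and H: "integrable haar_circle ?H"
    using f by (auto intro!: integrable_newton_iter integrable_conv_op Bochner_Integration.integrable_diff)
  have [measurable]: "?F \<in> borel_measurable borel" "conv_op \<nu> ?F \<in> borel_measurable borel" "?H \<in> borel_measurable borel"
    using F TF H by (simp_all add: integrable_iff_bounded)
  have 1: "AE y in haar_circle. conv_op \<nu> ?H y = conv_op \<nu> (\<lambda>y. conv_op \<nu> ?F y - z * ?F y) y"
    by (rule conv_op_cong_AE[OF _ _ Suc]) measurable
  have lin: "AE y in haar_circle. conv_op \<nu> (\<lambda>y. conv_op \<nu> ?F y - a * ?F y) y
      = conv_op \<nu> (conv_op \<nu> ?F) y - a * conv_op \<nu> ?F y" for a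
    using conv_op_add_AE[OF TF, of "\<lambda>y. - a * ?F y"] F conv_op_cmult[of "- a" ?F] by simp
  show ?case using 1 lin[of z] lin[of "x k"] Suc
  proof eventually_elim
    case (elim y)
    show ?case unfolding newton_iter.simps elim by (simp add: algebra_simps)
  qed
qed simp

lemma newton_iter_trig_poly:
  assumes "finite F"
  shows "newton_iter \<nu> x k (\<lambda>y. \<Sum>n\<in>F. a n * circle_char n y)
    = (\<lambda>y. \<Sum>n\<in>F. (newton_poly x k (fourier_coeff \<nu> n) * a n) * circle_char n y)"
proof (induction k)
  case (Suc k)
  have int: "integrable \<nu> (\<lambda>y. circle_char n (z - y))" for n z
    by (rule integrable_const_bound[of _ 1]) auto
  have conv: "conv_op \<nu> (\<lambda>y. \<Sum>n\<in>F. b n * circle_char n y) y = (\<Sum>n\<in>F. b n * (fourier_coeff \<nu> n * circle_char n y))" for b y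
    unfolding conv_op_circle_char[symmetric] unfolding conv_op_def using int by (subst Bochner_Integration.integral_sum) auto
  show ?case
    unfolding newton_iter.simps Suc conv sum_distrib_left sum_subtractf[symmetric] newton_poly_def prod.lessThan_Suc
    by (intro ext sum.cong refl) (simp add: algebra_simps)
qed (simp add: newton_poly_def)

text \<open>On trigonometric polynomials the operator multiplies coefficients, so Parseval gives the
  factor A^2; density extends this, and the 4 comes from using the doubling inequality
  twice.\<close>

lemma newton_iter_L2:
  assumes [measurable]: "f \<in> borel_measurable borel" and fin: "sqnorm f < \<infinity>"
    and x: "\<And>k. norm (x k) \<le> 1" and A: "A \<ge> 0" "\<And>n. norm (newton_poly x k (fourier_coeff \<nu> n)) \<le> A"
  shows "sqnorm (newton_iter \<nu> x k f) \<le> ennreal (4 * A\<^sup>2) * sqnorm f"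
proof (rule ennreal_le_epsilon)
  fix e :: real assume e: "e > 0"
  \<comment> \<open>The total coefficient that the squared norm of \<open>f - P\<close> collects
    below; the tolerance is divided by it.\<close>
  let ?c = "4 * A\<^sup>2 + 2 * 4 ^ k"
  have c: "?c > 0" by (intro add_nonneg_pos) auto
  have f: "integrable haar_circle f" by (rule integrable_if_sqnorm) (use fin in auto)
  obtain P where P: "P \<in> trig_polys" "sqnorm (\<lambda>x. f x - P x) < ennreal (e / ?c)"
    using trig_approxD[OF trig_approx_L2[OF assms(1) fin], of "e / ?c"] e c by auto
  note [measurable] = measurable_trig_polys[OF P(1)]
  obtain F a where Fa: "P = (\<lambda>y. \<Sum>n\<in>F. a n * circle_char n y)" "finite F" using P(1) by (auto simp: trig_polys_def)
  let ?d = "\<lambda>y. f y - P y"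
  have P_int: "integrable haar_circle P"
  proof (rule integrable_if_sqnorm)
    show "sqnorm P < \<infinity>" unfolding Fa(1) sqnorm_trig_poly[OF Fa(2)] by simp
  qed simp
  have "AE y in haar_circle. newton_iter \<nu> x k (\<lambda>y. P y + ?d y) y = newton_iter \<nu> x k P y + newton_iter \<nu> x k ?d y"
    by (rule newton_iter_add_AE[OF P_int Bochner_Integration.integrable_diff[OF f P_int]])
  then have "AE y in haar_circle. newton_iter \<nu> x k f y = newton_iter \<nu> x k P y + newton_iter \<nu> x k ?d y" by simp
  then have "sqnorm (newton_iter \<nu> x k f) \<le> 2 * sqnorm (newton_iter \<nu> x k P) + 2 * sqnorm (newton_iter \<nu> x k ?d)"
    by (intro sqnorm_add_le measurable_newton_iter) auto
  also have "\<dots> \<le> 2 * (ennreal (A\<^sup>2) * sqnorm P) + 2 * (ennreal (4 ^ k) * sqnorm ?d)"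
  proof (intro add_mono mult_left_mono newton_iter_L2_crude x)
    have "(\<Sum>n\<in>F. (norm (newton_poly x k (fourier_coeff \<nu> n) * a n))\<^sup>2) \<le> (\<Sum>n\<in>F. A\<^sup>2 * (norm (a n))\<^sup>2)"
      unfolding norm_mult power_mult_distrib using A by (intro sum_mono mult_right_mono power_mono) auto
    then show "sqnorm (newton_iter \<nu> x k P) \<le> ennreal (A\<^sup>2) * sqnorm P"
      unfolding Fa(1) newton_iter_trig_poly[OF Fa(2)] sqnorm_trig_poly[OF Fa(2)]
      by (subst ennreal_mult[symmetric]) (auto intro!: ennreal_leI sum_nonneg simp: sum_distrib_left)
  qed auto
  also have "\<dots> \<le> 2 * (ennreal (A\<^sup>2) * (2 * sqnorm f + 2 * sqnorm ?d)) + 2 * (ennreal (4 ^ k) * sqnorm ?d)"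
  proof (intro add_mono mult_left_mono order_refl)
    have "sqnorm P \<le> 2 * sqnorm f + 2 * sqnorm (\<lambda>y. P y - f y)"
      by (rule sqnorm_add_le) auto
    also have "sqnorm (\<lambda>y. P y - f y) = sqnorm ?d" by (simp add: sqnorm_def norm_minus_commute)
    finally show "sqnorm P \<le> 2 * sqnorm f + 2 * sqnorm ?d" .
  qed auto
  also have "\<dots> = ennreal (4 * A\<^sup>2) * sqnorm f + ennreal ?c * sqnorm ?d"
  proof -
    have "ennreal ?c = 4 * ennreal (A\<^sup>2) + 2 * ennreal (4 ^ k)" by (simp add: ennreal_plus ennreal_mult')
    moreover have "ennreal (4 * A\<^sup>2) = 4 * ennreal (A\<^sup>2)" by (simp add: ennreal_mult')
    moreover have "(4 :: ennreal) = 2 * 2" by simp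
    ultimately show ?thesis by (simp only: distrib_left distrib_right mult_ac add_ac)
  qed
  also have "\<dots> \<le> ennreal (4 * A\<^sup>2) * sqnorm f + ennreal ?c * ennreal (e / ?c)"
    using P(2) by (intro add_mono mult_left_mono) auto
  also have "ennreal ?c * ennreal (e / ?c) = ennreal e" using c e by (subst ennreal_mult[symmetric]) auto
  finally show "sqnorm (newton_iter \<nu> x k f) \<le> ennreal (4 * A\<^sup>2) * sqnorm f + ennreal e" .
qed

end

text \<open>The value \<open>i\<close> of this ruler sequence occurs exactly at j + 1 = 2^i (2m +
  1), once in every block of length 2^(i+1).\<close>

lemma card_multiplicity_2_ge:
  "k div 2 ^ Suc i \<le> card {j. j < k \<and> multiplicity 2 (Suc j) = i}"
proof -
  define g where "g m = 2 ^ i * (2 * m + 1) - (1 :: nat)" for m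
  have g: "Suc (g m) = 2 ^ i * (2 * m + 1)" for m by (simp add: g_def)
  have "g ` {..<k div 2 ^ Suc i} \<subseteq> {j. j < k \<and> multiplicity 2 (Suc j) = i}"
  proof safe
    fix m assume m: "m < k div 2 ^ Suc i"
    have "Suc (g m) \<le> 2 ^ Suc i * Suc m" unfolding g by simp
    also have "\<dots> \<le> 2 ^ Suc i * (k div 2 ^ Suc i)" using m by (intro mult_le_mono2) simp
    also have "\<dots> \<le> k" by simp
    finally show "g m < k" by simp
    show "multiplicity 2 (Suc (g m)) = i" unfolding g
    proof (rule multiplicity_eqI)
      show "\<not> 2 ^ Suc i dvd 2 ^ i * (2 * m + 1)"
      proof
        assume "2 ^ Suc i dvd 2 ^ i * (2 * m + 1)"
        then have "2 ^ i = (0 :: nat) \<or> 2 dvd 2 * m + 1"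
          by (simp only: power_Suc2 nat_mult_dvd_cancel_disj)
        then show False by simp
      qed
    qed simp
  qed
  then have "card (g ` {..<k div 2 ^ Suc i}) \<le> card {j. j < k \<and> multiplicity 2 (Suc j) = i}"
    by (intro card_mono) auto
  moreover have "inj g"
  proof (rule injI)
    fix m m' assume "g m = g m'"
    then have "2 ^ i * (2 * m + 1) = 2 ^ i * (2 * m' + 1)" using g by metis
    then show "m = m'" by simp
  qed
  then have "card (g ` {..<k div 2 ^ Suc i}) = k div 2 ^ Suc i"
    by (subst card_image) (auto intro: inj_on_subset)
  ultimately show ?thesis by simp
qed

text \<open>The nodes visit the \<open>i\<close>-th point with
  frequency \<open>2\<^sup>-\<^sup>i\<^sup>-\<^sup>1\<close>, so close enough to that point they make the Newton polynomials
  smaller than any geometric rate; finitely many such neighbourhoods suffice.\<close>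

lemma newton_nodes_capacity_zero:
  assumes K: "compact K" "countable K" "K \<noteq> {}" "K \<subseteq> cball 0 1"
  obtains x where "\<And>k. x k \<in> K"
    and "\<And>\<epsilon>. \<epsilon> > 0 \<Longrightarrow> \<exists>C>0. \<forall>k. \<forall>w\<in>K. norm (newton_poly x k w) \<le> C * \<epsilon> ^ k"
proof -
  define y where "y = from_nat_into K"
  have y: "y i \<in> K" for i unfolding y_def by (rule from_nat_into[OF K(3)])
  have dist2: "norm (w - v) \<le> 2" if "w \<in> K" "v \<in> K" for w v
  proof -
    have "norm w \<le> 1" "norm v \<le> 1" using that K(4) by auto
    then show ?thesis using norm_triangle_ineq4[of w v] by linarith
  qed
  define x where "x k = y (multiplicity 2 (Suc k))" for k
  have "\<exists>C>0. \<forall>k. \<forall>w\<in>K. norm (newton_poly x k w) \<le> C * \<epsilon> ^ k" if \<epsilon>: "\<epsilon> > 0" for \<epsilon> :: real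
  proof -
    define e where "e = min \<epsilon> 1"
    have e: "0 < e" "e \<le> 1" "e \<le> \<epsilon>" using \<epsilon> by (auto simp: e_def)
    \<comment> \<open>The node \<open>y i\<close> recurs once in 2^(i+1) steps, so this radius
      amounts to e/2 per step; the other factors are at most 2, the diameter of the unit disc, and
      together e^k results.\<close>
    define r where "r i = (e / 2) ^ (2 ^ Suc i)" for i :: nat
    have r: "0 < r i" "r i \<le> 1" for i unfolding r_def using e by (auto intro!: power_le_one)
    have "K \<subseteq> (\<Union>i. ball (y i) (r i))"
    proof
      fix w assume "w \<in> K"
      then obtain i where "y i = w" unfolding y_def using from_nat_into_surj[OF K(2)] by blast
      then show "w \<in> (\<Union>i. ball (y i) (r i))" using r(1)[of i] by (intro UN_I[of i]) auto
    qed
    then obtain I where I: "finite I" "K \<subseteq> (\<Union>i\<in>I. ball (y i) (r i))"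
      using compactE_image[OF K(1), of UNIV "\<lambda>i. ball (y i) (r i)"] by (metis UNIV_I open_ball)
    define N where "N = Max (insert 0 I)"
    have N: "i \<le> N" if "i \<in> I" for i using I(1) that by (simp add: N_def)
    \<comment> \<open>Pays for the incomplete last block, of length below 2^(i+1), uniformly over
      the finite subcover.\<close>
    define C where "C = (2 / e) ^ (2 ^ Suc N)"
    have "norm (newton_poly x k w) \<le> C * \<epsilon> ^ k" if w: "w \<in> K" for k w
    proof -
      obtain i where i: "i \<in> I" "w \<in> ball (y i) (r i)" using I(2) w by blast
      define F where "F = {j. j < k \<and> multiplicity 2 (Suc j) = i}"
      let ?P = "2 ^ Suc i :: nat"
      let ?m = "k div ?P"
      have F: "F \<subseteq> {..<k}" "finite F" by (auto simp: F_def)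
      have cF: "?m \<le> card F" unfolding F_def by (rule card_multiplicity_2_ge)
      have "norm (newton_poly x k w) = (\<Prod>j<k. norm (w - x j))"
        by (simp add: newton_poly_def prod_norm)
      also have "\<dots> = (\<Prod>j\<in>{..<k} - F. norm (w - x j)) * (\<Prod>j\<in>F. norm (w - x j))"
        using F(1) by (intro prod.subset_diff) auto
      also have "\<dots> \<le> (\<Prod>j\<in>{..<k} - F. 2) * (\<Prod>j\<in>F. r i)"
      proof (intro mult_mono prod_mono conjI prod_nonneg)
        fix j assume "j \<in> F"
        then have "x j = y i" by (simp add: x_def F_def)
        then show "norm (w - x j) \<le> r i" using i(2) by (simp add: dist_norm norm_minus_commute)
      qed (auto simp: x_def intro!: dist2 w y)
      also have "\<dots> = 2 ^ (k - card F) * r i ^ card F"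
        using F by (simp add: card_Diff_subset)
      also have "\<dots> \<le> 2 ^ k * r i ^ ?m"
        using cF r[of i] by (intro mult_mono power_increasing power_decreasing) auto
      also have "r i ^ ?m = (e / 2) ^ (?P * ?m)" by (simp only: r_def power_mult)
      also have "2 ^ k * \<dots> \<le> 2 ^ k * ((e / 2) ^ k * (2 / e) ^ ?P)"
      proof (intro mult_left_mono)
        have "k < ?P * Suc ?m" using dividend_less_times_div[of ?P k] by simp
        then have le: "k \<le> ?P * ?m + ?P" by simp
        have "(e / 2) ^ (?P * ?m) = (e / 2) ^ (?P * ?m + ?P) * (2 / e) ^ ?P"
          using e by (simp add: power_add mult.assoc flip: power_mult_distrib)
        also have "\<dots> \<le> (e / 2) ^ k * (2 / e) ^ ?P"
          using e le by (intro mult_right_mono power_decreasing) auto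
        finally show "(e / 2) ^ (?P * ?m) \<le> (e / 2) ^ k * (2 / e) ^ ?P" .
      qed simp
      also have "\<dots> = e ^ k * (2 / e) ^ ?P" by (simp add: power_divide)
      also have "\<dots> \<le> \<epsilon> ^ k * C"
        unfolding C_def using e N[OF i(1)] by (intro mult_mono power_mono power_increasing) auto
      finally show ?thesis by (simp add: mult.commute)
    qed
    moreover have "C > 0" using e by (simp add: C_def)
    ultimately show ?thesis by blast
  qed
  moreover have "x k \<in> K" for k by (simp add: x_def y)
  ultimately show thesis using that by blast
qed

section \<open>Decay of the Newton polynomials of the operator on \<open>L^p\<close>\<close>

lemma power_powr: "b > 0 \<Longrightarrow> (b ^ k) powr q = (b powr q) ^ k" for b q :: real
  by (simp add: powr_realpow[symmetric] powr_powr mult.commute)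

lemma power_le_one_plus_powr: "0 \<le> y \<Longrightarrow> 1 \<le> q \<Longrightarrow> q \<le> p \<Longrightarrow> y powr q \<le> 1 + y powr p" for y q p :: real
proof (cases "y \<le> 1")
  case True
  assume "0 \<le> y" "1 \<le> q"
  then have "y powr q \<le> 1" using True by (intro powr_le1) auto
  then show ?thesis using powr_ge_zero[of y p] by linarith
next
  case False
  assume "q \<le> p"
  then have "y powr q \<le> y powr p" using False by (intro powr_mono) auto
  then show ?thesis by linarith
qed

lemma integrable_if_Lp:
  fixes f :: "circle \<Rightarrow> complex"
  assumes [measurable]: "f \<in> borel_measurable borel" and p: "1 \<le> p"
    and fin: "(\<integral>\<^sup>+y. norm (f y) powr p \<partial>haar_circle) < \<infinity>"
  shows "integrable haar_circle f"
proof -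
  have "(\<integral>\<^sup>+y. norm (f y) \<partial>haar_circle) \<le> (\<integral>\<^sup>+y. 1 + ennreal (norm (f y) powr p) \<partial>haar_circle)"
  proof (rule nn_integral_mono)
    fix y
    have "norm (f y) powr 1 \<le> 1 + norm (f y) powr p" using p by (intro power_le_one_plus_powr) auto
    then have "ennreal (norm (f y)) \<le> ennreal (1 + norm (f y) powr p)" by (intro ennreal_leI) simp
    then show "ennreal (norm (f y)) \<le> 1 + ennreal (norm (f y) powr p)" by (simp add: ennreal_plus)
  qed
  also have "\<dots> = 1 + (\<integral>\<^sup>+y. norm (f y) powr p \<partial>haar_circle)"
    using haar.emeasure_space_1 by (subst nn_integral_add) auto
  also have "\<dots> < \<infinity>" using fin by simp
  finally show ?thesis by (simp add: integrable_iff_bounded)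
qed

lemma sqnorm_finite_if_Lp:
  fixes f :: "circle \<Rightarrow> complex"
  assumes [measurable]: "f \<in> borel_measurable borel" and p: "2 \<le> p"
    and fin: "(\<integral>\<^sup>+y. norm (f y) powr p \<partial>haar_circle) < \<infinity>"
  shows "sqnorm f < \<infinity>"
proof -
  have "sqnorm f \<le> (\<integral>\<^sup>+y. 1 + ennreal (norm (f y) powr p) \<partial>haar_circle)"
    unfolding sqnorm_def
  proof (rule nn_integral_mono)
    fix y
    have "norm (f y) powr 2 \<le> 1 + norm (f y) powr p" using p by (intro power_le_one_plus_powr) auto
    then have "ennreal ((norm (f y))\<^sup>2) \<le> ennreal (1 + norm (f y) powr p)" by (intro ennreal_leI) simp
    then show "ennreal ((norm (f y))\<^sup>2) \<le> 1 + ennreal (norm (f y) powr p)" by (simp add: ennreal_plus)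
  qed
  also have "\<dots> = 1 + (\<integral>\<^sup>+y. norm (f y) powr p \<partial>haar_circle)"
    using haar.emeasure_space_1 by (subst nn_integral_add) auto
  also have "\<dots> < \<infinity>" using fin by simp
  finally show ?thesis .
qed

context circle_measure
begin

lemma sublinear_newton_iter: "sublinear_operator (newton_iter \<nu> x k)"
proof
  show "newton_iter \<nu> x k f \<in> borel_measurable borel" if "f \<in> borel_measurable borel" for f
    using that by (rule measurable_newton_iter)
  show "AE y in haar_circle. norm (newton_iter \<nu> x k (\<lambda>x. f x + g x) y)
      \<le> norm (newton_iter \<nu> x k f y) + norm (newton_iter \<nu> x k g y)"
    if "integrable haar_circle f" "integrable haar_circle g" for f g
    using newton_iter_add_AE[OF that, where x = x and k = k] by eventually_elim (simp add: norm_triangle_ineq)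
qed

text \<open>The rate on \<open>L^2\<close> is at free disposal, so after interpolation it can be
  chosen to beat the growth 2^k at the other endpoint.\<close>

lemma newton_iter_Lp_geometric:
  assumes x: "\<And>k. norm (x k) \<le> 1"
    and cap: "\<And>\<epsilon>. \<epsilon> > 0 \<Longrightarrow> \<exists>C>0. \<forall>k n. norm (newton_poly x k (fourier_coeff \<nu> n)) \<le> C * \<epsilon> ^ k"
    and p: "p > 1" and \<sigma>: "\<sigma> > 0"
  obtains K where "K > 0"
    and "\<And>k f. f \<in> borel_measurable borel \<Longrightarrow> (\<integral>\<^sup>+y. norm (f y) powr p \<partial>haar_circle) < \<infinity> \<Longrightarrow>
      (\<integral>\<^sup>+y. norm (newton_iter \<nu> x k f y) powr p \<partial>haar_circle)
        \<le> ennreal (K * \<sigma> ^ k) * (\<integral>\<^sup>+y. norm (f y) powr p \<partial>haar_circle)"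
proof -
  have L2: "\<exists>C>0. \<forall>k f. f \<in> borel_measurable borel \<longrightarrow> sqnorm f < \<infinity> \<longrightarrow>
      sqnorm (newton_iter \<nu> x k f) \<le> ennreal (C * \<epsilon> ^ k) * sqnorm f" if "\<epsilon> > 0" for \<epsilon> :: real
  proof -
    \<comment> \<open>The square root compensates for \<open>sqnorm\<close> being a squared
      norm.\<close>
    have "\<exists>C>0. \<forall>k n. norm (newton_poly x k (fourier_coeff \<nu> n)) \<le> C * sqrt \<epsilon> ^ k"
      using that by (intro cap) simp
    then obtain C where C: "C > 0" "\<And>k n. norm (newton_poly x k (fourier_coeff \<nu> n)) \<le> C * sqrt \<epsilon> ^ k"
      by blast
    have eq: "4 * (C * sqrt \<epsilon> ^ k)\<^sup>2 = 4 * C\<^sup>2 * \<epsilon> ^ k" for k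
    proof -
      have "(sqrt \<epsilon> ^ k)\<^sup>2 = ((sqrt \<epsilon>)\<^sup>2) ^ k" by (simp only: power_mult[symmetric] mult.commute)
      then show ?thesis using that by (simp add: power_mult_distrib)
    qed
    have "sqnorm (newton_iter \<nu> x k f) \<le> ennreal (4 * C\<^sup>2 * \<epsilon> ^ k) * sqnorm f"
      if "f \<in> borel_measurable borel" "sqnorm f < \<infinity>" for k f
      using newton_iter_L2[OF that x, where A = "C * sqrt \<epsilon> ^ k" and k = k] C \<open>\<epsilon> > 0\<close> unfolding eq by simp
    then show ?thesis using C(1) by (intro exI[of _ "4 * C\<^sup>2"]) auto
  qed
  consider "p = 2" | "p > 2" | "p < 2" by linarith
  then show thesis
  proof cases
    case 1
    obtain C where C: "C > 0" "\<And>k f. f \<in> borel_measurable borel \<Longrightarrow> sqnorm f < \<infinity> \<Longrightarrow>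
      sqnorm (newton_iter \<nu> x k f) \<le> ennreal (C * \<sigma> ^ k) * sqnorm f" using L2[OF \<sigma>] by blast
    have eq: "(\<integral>\<^sup>+y. norm (f y) powr p \<partial>haar_circle) = sqnorm f" for f :: "circle \<Rightarrow> complex"
      unfolding sqnorm_def 1 by (intro nn_integral_cong) simp
    show thesis using that[OF C(1)] C(2) unfolding eq by blast
  next
    case 2
    \<comment> \<open>The growth rate of (2B)^(p - 2) for B = 2^k, divided out of the rate requested
      on \<open>L^2\<close>.\<close>
    define b where "b = 2 powr (p - 2)"
    have b: "b > 0" by (simp add: b_def)
    obtain C where C: "C > 0" "\<And>k f. f \<in> borel_measurable borel \<Longrightarrow> sqnorm f < \<infinity> \<Longrightarrow>
      sqnorm (newton_iter \<nu> x k f) \<le> ennreal (C * (\<sigma> / b) ^ k) * sqnorm f"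
    proof -
      have "\<sigma> / b > 0" using \<sigma> b by simp
      from L2[OF this] show thesis using that by blast
    qed
    define K where "K = 4 * C * p / (p - 2) * b"
    show thesis
    proof (rule that[of K])
      show "K > 0" using C(1) 2 b by (simp add: K_def)
      fix k and f :: "circle \<Rightarrow> complex"
      assume f: "f \<in> borel_measurable borel" "(\<integral>\<^sup>+y. norm (f y) powr p \<partial>haar_circle) < \<infinity>"
      interpret sublinear_operator "newton_iter \<nu> x k" by (rule sublinear_newton_iter)
      have "(\<integral>\<^sup>+y. norm (newton_iter \<nu> x k f y) powr p \<partial>haar_circle)
        \<le> ennreal (4 * (C * (\<sigma> / b) ^ k) * p / (p - 2) * (2 * 2 ^ k) powr (p - 2)) * (\<integral>\<^sup>+y. norm (f y) powr p \<partial>haar_circle)"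
      proof (rule strong_type_above_2[OF 2])
        show "integrable haar_circle f" using f p by (intro integrable_if_Lp) auto
        show "sqnorm f < \<infinity>" using f 2 by (intro sqnorm_finite_if_Lp) auto
      qed (use C \<sigma> b newton_iter_bounded[OF _ x] in auto)
      also have "(2 * 2 ^ k) powr (p - 2) = b * b ^ k"
        by (simp add: powr_mult power_powr b_def)
      also have "4 * (C * (\<sigma> / b) ^ k) * p / (p - 2) * (b * b ^ k) = K * \<sigma> ^ k"
        using b by (simp add: K_def power_divide)
      finally show "(\<integral>\<^sup>+y. norm (newton_iter \<nu> x k f y) powr p \<partial>haar_circle)
        \<le> ennreal (K * \<sigma> ^ k) * (\<integral>\<^sup>+y. norm (f y) powr p \<partial>haar_circle)" .
    qed
  next
    case 3
    define b where "b = 2 powr (2 - p)"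
    have b: "b > 0" by (simp add: b_def)
    \<comment> \<open>Chosen so that e^(p - 1) b = \<sigma>, which is the rate of the balanced bound
      A^(p - 1) B^(2 - p).\<close>
    define e where "e = (\<sigma> / b) powr (1 / (p - 1))"
    have e: "e > 0" "e powr (p - 1) = \<sigma> / b" using \<sigma> b p by (simp_all add: e_def powr_powr)
    obtain C where C: "C > 0" "\<And>k f. f \<in> borel_measurable borel \<Longrightarrow> sqnorm f < \<infinity> \<Longrightarrow>
      sqnorm (newton_iter \<nu> x k f) \<le> ennreal (C * e ^ k) * sqnorm f"
      using L2[OF e(1)] by blast
    define K where "K = (2 * p / (p - 1) + 4 * p / (2 - p)) * C powr (p - 1)"
    show thesis
    proof (rule that[of K])
      show "K > 0" using C(1) 3 p by (simp add: K_def add_pos_pos)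
      fix k and f :: "circle \<Rightarrow> complex"
      assume f: "f \<in> borel_measurable borel" "(\<integral>\<^sup>+y. norm (f y) powr p \<partial>haar_circle) < \<infinity>"
      interpret sublinear_operator "newton_iter \<nu> x k" by (rule sublinear_newton_iter)
      define A where "A = C * e ^ k"
      define B where "B = (2 :: real) ^ k"
      have A: "A > 0" and B: "B > 0" using C(1) e(1) by (simp_all add: A_def B_def)
      have "(\<integral>\<^sup>+y. norm (newton_iter \<nu> x k f y) powr p \<partial>haar_circle)
        \<le> ennreal (2 * B * p / (p - 1) * (B / A) powr (1 - p) + 4 * A * p / (2 - p) * (B / A) powr (2 - p))
          * (\<integral>\<^sup>+y. norm (f y) powr p \<partial>haar_circle)"
      proof (rule strong_type_below_2[OF p 3 A B])
        show "integrable haar_circle f" using f p by (intro integrable_if_Lp) auto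
        show "sqnorm (newton_iter \<nu> x k g) \<le> ennreal A * sqnorm g"
          if "g \<in> borel_measurable borel" "sqnorm g < \<infinity>" for g unfolding A_def by (rule C(2)[OF that])
        show "(\<integral>\<^sup>+y. norm (newton_iter \<nu> x k g y) \<partial>haar_circle) \<le> ennreal B * (\<integral>\<^sup>+y. norm (g y) \<partial>haar_circle)"
          if "g \<in> borel_measurable borel" for g unfolding B_def by (rule newton_iter_L1[OF that x])
      qed (use A B in simp)
      \<comment> \<open>The choice c = B/A makes both terms multiples of the same quantity.\<close>
      also have "2 * B * p / (p - 1) * (B / A) powr (1 - p) + 4 * A * p / (2 - p) * (B / A) powr (2 - p)
        = (2 * p / (p - 1) + 4 * p / (2 - p)) * (A powr (p - 1) * B powr (2 - p))"
      proof -
        have 1: "B * (B / A) powr (1 - p) = A powr (p - 1) * B powr (2 - p)"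
          using A B by (simp add: powr_divide powr_diff power2_eq_square field_simps)
        have 2: "A * (B / A) powr (2 - p) = A powr (p - 1) * B powr (2 - p)"
          using A B by (simp add: powr_divide powr_diff power2_eq_square field_simps)
        have "2 * B * p / (p - 1) * (B / A) powr (1 - p) = 2 * p / (p - 1) * (B * (B / A) powr (1 - p))" by simp
        moreover have "4 * A * p / (2 - p) * (B / A) powr (2 - p) = 4 * p / (2 - p) * (A * (B / A) powr (2 - p))" by simp
        ultimately show ?thesis unfolding 1 2 by (simp only: distrib_right)
      qed
      also have "A powr (p - 1) * B powr (2 - p) = C powr (p - 1) * \<sigma> ^ k"
      proof -
        have "A powr (p - 1) = C powr (p - 1) * (\<sigma> / b) ^ k"
          unfolding A_def using C(1) e by (simp add: powr_mult power_powr)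
        moreover have "B powr (2 - p) = b ^ k" by (simp add: B_def b_def power_powr)
        ultimately show ?thesis using b by (simp add: power_divide)
      qed
      finally show "(\<integral>\<^sup>+y. norm (newton_iter \<nu> x k f y) powr p \<partial>haar_circle)
        \<le> ennreal (K * \<sigma> ^ k) * (\<integral>\<^sup>+y. norm (f y) powr p \<partial>haar_circle)"
        by (simp add: K_def mult.assoc)
    qed
  qed
qed

definition newton_term :: "(nat \<Rightarrow> complex) \<Rightarrow> complex \<Rightarrow> (circle \<Rightarrow> complex) \<Rightarrow> nat \<Rightarrow> circle \<Rightarrow> complex" where
  "newton_term x z f k y = newton_iter \<nu> x k f y / newton_poly x (Suc k) z"

text \<open>The series is summed pointwise on representatives; its convergence is established almost
  everywhere only.\<close>

definition resolvent :: "(nat \<Rightarrow> complex) \<Rightarrow> complex \<Rightarrow> (circle \<Rightarrow> complex) \<Rightarrow> circle \<Rightarrow> complex" where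
  "resolvent x z f y = - (\<Sum>k. newton_term x z f k y)"

lemma measurable_newton_term:
  "f \<in> borel_measurable borel \<Longrightarrow> newton_term x z f k \<in> borel_measurable borel"
proof -
  assume "f \<in> borel_measurable borel"
  then have [measurable]: "newton_iter \<nu> x k f \<in> borel_measurable borel" by (rule measurable_newton_iter)
  show ?thesis unfolding newton_term_def[abs_def] by measurable
qed

lemma measurable_resolvent:
  assumes "f \<in> borel_measurable borel"
  shows "resolvent x z f \<in> borel_measurable borel"
proof -
  note [measurable] = measurable_newton_term[OF assms]
  show ?thesis unfolding resolvent_def[abs_def] by measurable
qed

text \<open>The partial sums of the Newton series telescope: with \<open>a k = g k / N k\<close>, where \<open>g\<close> are the
  iterates and \<open>N\<close> the values of the Newton polynomials at \<open>z\<close>, applying \<open>T - z\<close> to the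
  \<open>k\<close>-th term gives \<open>a (k + 1) - a k\<close>.\<close>

lemma newton_term_telescope:
  assumes nz: "\<And>k. newton_poly x k z \<noteq> 0"
    and bounded: "\<And>k. norm (z - x k) \<le> M" and zero: "(\<lambda>k. newton_term x z f k y) \<longlonglongrightarrow> 0"
  shows "(\<lambda>k. (conv_op \<nu> (newton_iter \<nu> x k f) y - z * newton_iter \<nu> x k f y) / newton_poly x (Suc k) z) sums (- f y)"
proof -
  define a where "a k = newton_iter \<nu> x k f y / newton_poly x k z" for k
  have NS: "newton_poly x (Suc k) z = newton_poly x k z * (z - x k)" for k by (simp add: newton_poly_def)
  have nzx: "z - x k \<noteq> 0" for k using nz[of "Suc k"] NS[of k] by auto
  have a_eq: "a k = newton_term x z f k y * (z - x k)" for k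
    using nzx[of k] by (simp add: a_def newton_term_def NS)
  have "(\<lambda>k. newton_term x z f k y * (z - x k)) \<longlonglongrightarrow> 0"
  proof (rule Lim_null_comparison)
    have "norm (newton_term x z f k y * (z - x k)) \<le> norm (newton_term x z f k y) * M" for k
      unfolding norm_mult using bounded[of k] by (intro mult_left_mono) auto
    then show "\<forall>\<^sub>F k in sequentially. norm (newton_term x z f k y * (z - x k)) \<le> norm (newton_term x z f k y) * M"
      by simp
    show "(\<lambda>k. norm (newton_term x z f k y) * M) \<longlonglongrightarrow> 0"
      using tendsto_mult[OF tendsto_norm[OF zero] tendsto_const[of M]] by simp
  qed
  then have "a \<longlonglongrightarrow> 0" unfolding a_eq[abs_def] .
  from telescope_sums[OF this] have "(\<lambda>k. a (Suc k) - a k) sums (- a 0)" by simp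
  moreover have "a 0 = f y" by (simp add: a_def newton_poly_def)
  moreover have "a (Suc k) - a k = (conv_op \<nu> (newton_iter \<nu> x k f) y - z * newton_iter \<nu> x k f y) / newton_poly x (Suc k) z" for k
  proof -
    have "a (Suc k) - a k = (conv_op \<nu> (newton_iter \<nu> x k f) y - x k * newton_iter \<nu> x k f y - (z - x k) * newton_iter \<nu> x k f y) / newton_poly x (Suc k) z"
      using nzx[of k] nz[of k] by (simp add: a_def NS diff_divide_distrib)
    also have "conv_op \<nu> (newton_iter \<nu> x k f) y - x k * newton_iter \<nu> x k f y - (z - x k) * newton_iter \<nu> x k f y
      = conv_op \<nu> (newton_iter \<nu> x k f) y - z * newton_iter \<nu> x k f y" by (simp add: algebra_simps)
    finally show ?thesis .
  qed
  ultimately show ?thesis by simp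
qed

end

section \<open>The resolvent\<close>

text \<open>\<open>\<eta>\<close> separates z from the nodes, so |N_(k+1)(z)| is at least
  \<eta>^(k+1). With operator norms of rate \<eta>/4 the k-th term is of order 4^(-k), which leaves
  room for weights of order 2^k.\<close>

locale newton_resolvent = circle_measure +
  fixes x :: "nat \<Rightarrow> complex" and z :: complex and p \<eta> K :: real
  assumes x_le: "\<And>k. norm (x k) \<le> 1" and p: "p > 1" and \<eta>: "\<eta> > 0" and z_away: "\<And>k. \<eta> \<le> norm (z - x k)"
    and K: "K > 0"
    and geometric: "\<And>k f. f \<in> borel_measurable borel \<Longrightarrow> (\<integral>\<^sup>+y. norm (f y) powr p \<partial>haar_circle) < \<infinity> \<Longrightarrow>
      (\<integral>\<^sup>+y. norm (newton_iter \<nu> x k f y) powr p \<partial>haar_circle)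
        \<le> ennreal (K * ((\<eta> / 4) powr p) ^ k) * (\<integral>\<^sup>+y. norm (f y) powr p \<partial>haar_circle)"
begin

lemma newton_poly_ge: "\<eta> ^ k \<le> norm (newton_poly x k z)"
proof -
  have "(\<Prod>i<k. \<eta>) \<le> (\<Prod>i<k. norm (z - x i))" using \<eta> z_away by (intro prod_mono) auto
  then show ?thesis by (simp add: newton_poly_def prod_norm)
qed

lemma newton_poly_nonzero: "newton_poly x k z \<noteq> 0"
  using newton_poly_ge[of k] \<eta> by (metis norm_zero not_le zero_less_power)

lemma z_bounded: "norm (z - x k) \<le> norm z + 1"
  using norm_triangle_ineq4[of z "x k"] x_le[of k] by linarith

text \<open>One function that dominates the whole series: where it has a finite value W, the k-th
  term is at most 2^(-k-1) W^(1/p). This gives absolute convergence and |resolvent|^p at most W at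
  once, in place of Minkowski's inequality for the sum.\<close>

definition weight :: "(circle \<Rightarrow> complex) \<Rightarrow> circle \<Rightarrow> ennreal" where
  "weight f y = (\<Sum>k. ennreal ((2 ^ Suc k * norm (newton_term x z f k y)) powr p))"

definition weight_const :: real where
  "weight_const = K * (2 / \<eta>) powr p / (1 - (1 / 2) powr p)"

lemma half_powr: "0 < (1 / 2) powr p" "(1 / 2) powr p < (1 :: real)"
  using p powr_less_mono2[of p "1 / 2" 1] by auto

lemma weight_const_pos: "weight_const > 0"
  using K \<eta> half_powr by (simp add: weight_const_def)

lemma nn_integral_weight:
  assumes f [measurable]: "f \<in> borel_measurable borel" and fin: "(\<integral>\<^sup>+y. norm (f y) powr p \<partial>haar_circle) < \<infinity>"
  shows "(\<integral>\<^sup>+y. weight f y \<partial>haar_circle) \<le> ennreal weight_const * (\<integral>\<^sup>+y. norm (f y) powr p \<partial>haar_circle)"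
proof -
  let ?I = "\<integral>\<^sup>+y. norm (f y) powr p \<partial>haar_circle"
  note [measurable] = measurable_newton_term[OF f] measurable_newton_iter[OF f]
  have "(\<integral>\<^sup>+y. weight f y \<partial>haar_circle) = (\<Sum>k. \<integral>\<^sup>+y. ennreal ((2 ^ Suc k * norm (newton_term x z f k y)) powr p) \<partial>haar_circle)"
    unfolding weight_def by (rule nn_integral_suminf) measurable
  also have "\<dots> \<le> (\<Sum>k. ennreal (K * (2 / \<eta>) powr p * ((1 / 2) powr p) ^ k) * ?I)"
  proof (intro suminf_le summableI)
    fix k
    have "(\<integral>\<^sup>+y. ennreal ((2 ^ Suc k * norm (newton_term x z f k y)) powr p) \<partial>haar_circle)
      \<le> (\<integral>\<^sup>+y. ennreal ((2 / \<eta>) powr p * ((2 / \<eta>) powr p) ^ k) * ennreal (norm (newton_iter \<nu> x k f y) powr p) \<partial>haar_circle)"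
    proof (rule nn_integral_mono)
      fix y
      have "2 ^ Suc k * norm (newton_term x z f k y) = 2 ^ Suc k * norm (newton_iter \<nu> x k f y) / norm (newton_poly x (Suc k) z)"
        by (simp add: newton_term_def norm_divide)
      also have "\<dots> \<le> 2 ^ Suc k * norm (newton_iter \<nu> x k f y) / \<eta> ^ Suc k"
        using newton_poly_ge[of "Suc k"] \<eta> by (intro divide_left_mono) (auto intro!: mult_pos_pos simp: newton_poly_nonzero)
      also have "\<dots> = (2 / \<eta>) ^ Suc k * norm (newton_iter \<nu> x k f y)" by (simp add: power_divide)
      finally have "(2 ^ Suc k * norm (newton_term x z f k y)) powr p \<le> ((2 / \<eta>) ^ Suc k * norm (newton_iter \<nu> x k f y)) powr p"
        using p by (intro powr_mono2) auto
      also have "\<dots> = ((2 / \<eta>) powr p) ^ Suc k * norm (newton_iter \<nu> x k f y) powr p"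
      proof -
        have "((2 / \<eta>) ^ Suc k * norm (newton_iter \<nu> x k f y)) powr p
          = ((2 / \<eta>) ^ Suc k) powr p * norm (newton_iter \<nu> x k f y) powr p"
          by (rule powr_mult)
        also have "((2 / \<eta>) ^ Suc k) powr p = ((2 / \<eta>) powr p) ^ Suc k"
          using \<eta> by (intro power_powr) auto
        finally show ?thesis .
      qed
      finally show "ennreal ((2 ^ Suc k * norm (newton_term x z f k y)) powr p)
        \<le> ennreal ((2 / \<eta>) powr p * ((2 / \<eta>) powr p) ^ k) * ennreal (norm (newton_iter \<nu> x k f y) powr p)"
        by (subst ennreal_mult[symmetric]) (auto intro!: ennreal_leI)
    qed
    also have "\<dots> = ennreal ((2 / \<eta>) powr p * ((2 / \<eta>) powr p) ^ k) * (\<integral>\<^sup>+y. norm (newton_iter \<nu> x k f y) powr p \<partial>haar_circle)"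
      by (rule nn_integral_cmult) measurable
    also have "\<dots> \<le> ennreal ((2 / \<eta>) powr p * ((2 / \<eta>) powr p) ^ k) * (ennreal (K * ((\<eta> / 4) powr p) ^ k) * ?I)"
      by (intro mult_left_mono geometric f fin) simp
    also have "\<dots> = ennreal ((2 / \<eta>) powr p * ((2 / \<eta>) powr p) ^ k * (K * ((\<eta> / 4) powr p) ^ k)) * ?I"
      using K by (subst ennreal_mult) (auto simp: mult.assoc)
    also have "(2 / \<eta>) powr p * ((2 / \<eta>) powr p) ^ k * (K * ((\<eta> / 4) powr p) ^ k)
      = K * (2 / \<eta>) powr p * ((2 / \<eta>) powr p * (\<eta> / 4) powr p) ^ k" by (simp add: power_mult_distrib)
    also have "(2 / \<eta>) powr p * (\<eta> / 4) powr p = (1 / 2) powr p"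
      using \<eta> by (subst powr_mult[symmetric]) auto
    finally show "(\<integral>\<^sup>+y. ennreal ((2 ^ Suc k * norm (newton_term x z f k y)) powr p) \<partial>haar_circle)
      \<le> ennreal (K * (2 / \<eta>) powr p * ((1 / 2) powr p) ^ k) * ?I" .
  qed
  also have "\<dots> = (\<Sum>k. ennreal (K * (2 / \<eta>) powr p * ((1 / 2) powr p) ^ k)) * ?I"
    by (rule ennreal_suminf_multc)
  also have "(\<Sum>k. ennreal (K * (2 / \<eta>) powr p * ((1 / 2) powr p) ^ k)) = ennreal weight_const"
  proof (rule suminf_ennreal_eq)
    show "(\<lambda>k. K * (2 / \<eta>) powr p * ((1 / 2) powr p) ^ k) sums weight_const"
      using half_powr sums_mult[OF geometric_sums[of "(1 / 2) powr p"], of "K * (2 / \<eta>) powr p"]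
      by (simp add: weight_const_def)
  qed (use K in auto)
  finally show ?thesis .
qed

lemma AE_weight_finite:
  assumes "f \<in> borel_measurable borel" "(\<integral>\<^sup>+y. norm (f y) powr p \<partial>haar_circle) < \<infinity>"
  shows "AE y in haar_circle. weight f y < \<infinity>"
proof -
  note [measurable] = measurable_newton_term[OF assms(1)]
  have [measurable]: "weight f \<in> borel_measurable borel" unfolding weight_def[abs_def] by measurable
  have "(\<integral>\<^sup>+y. weight f y \<partial>haar_circle) < \<infinity>"
    using nn_integral_weight[OF assms] assms(2) by (auto intro: le_less_trans simp: ennreal_mult_less_top)
  then show ?thesis using nn_integral_PInf_AE[of "weight f" haar_circle] by (auto simp: less_top)
qed

lemma newton_term_le_weight:
  assumes "weight f y < \<infinity>"
  shows "norm (newton_term x z f k y) \<le> (1 / 2) ^ Suc k * enn2real (weight f y) powr (1 / p)"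
proof -
  let ?c = "2 ^ Suc k * norm (newton_term x z f k y)"
  let ?w = "\<lambda>k. ennreal ((2 ^ Suc k * norm (newton_term x z f k y)) powr p)"
  have "ennreal (?c powr p) = sum ?w {k}" by (simp only: sum.insert_remove finite.emptyI empty_Diff sum.empty add_0_right)
  also have "\<dots> \<le> (\<Sum>k. ?w k)" by (intro sum_le_suminf summableI) simp_all
  also have "\<dots> = weight f y" by (simp only: weight_def)
  also have "\<dots> = ennreal (enn2real (weight f y))" using assms by (simp add: less_top)
  finally have "?c powr p \<le> enn2real (weight f y)" by (simp add: enn2real_nonneg)
  then have "(?c powr p) powr (1 / p) \<le> enn2real (weight f y) powr (1 / p)" using p by (intro powr_mono2) auto
  then have "?c \<le> enn2real (weight f y) powr (1 / p)" using p by (simp add: powr_powr)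
  then show ?thesis by (simp add: power_divide field_simps)
qed

lemma half_sums: "(\<lambda>k. (1 / 2) ^ Suc k * c) sums c" for c :: real
  using sums_mult2[OF power_half_series, of c] by simp

lemma summable_newton_term:
  assumes "weight f y < \<infinity>"
  shows "summable (\<lambda>k. norm (newton_term x z f k y))"
  by (rule summable_comparison_test'[OF sums_summable[OF half_sums[of "enn2real (weight f y) powr (1 / p)"]], of 0])
    (use newton_term_le_weight[OF assms] in auto)

lemma resolvent_le_weight:
  assumes "weight f y < \<infinity>"
  shows "ennreal (norm (resolvent x z f y) powr p) \<le> weight f y"
proof -
  let ?W = "enn2real (weight f y)"
  have "norm (resolvent x z f y) \<le> (\<Sum>k. norm (newton_term x z f k y))"
    unfolding resolvent_def norm_minus_cancel by (rule summable_norm[OF summable_newton_term[OF assms]])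
  also have "\<dots> \<le> (\<Sum>k. (1 / 2) ^ Suc k * ?W powr (1 / p))"
    by (intro suminf_le newton_term_le_weight assms summable_newton_term sums_summable[OF half_sums])
  also have "\<dots> = ?W powr (1 / p)" by (rule sums_unique[OF half_sums, symmetric])
  finally have "norm (resolvent x z f y) powr p \<le> (?W powr (1 / p)) powr p" using p by (intro powr_mono2) auto
  also have "\<dots> = ?W" using p by (simp add: powr_powr)
  finally have "ennreal (norm (resolvent x z f y) powr p) \<le> ennreal ?W" by (rule ennreal_leI)
  also have "\<dots> = weight f y" using assms by (simp add: less_top)
  finally show ?thesis .
qed

lemma resolvent_Lp:
  assumes "f \<in> borel_measurable borel" "(\<integral>\<^sup>+y. norm (f y) powr p \<partial>haar_circle) < \<infinity>"
  shows "(\<integral>\<^sup>+y. norm (resolvent x z f y) powr p \<partial>haar_circle)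
    \<le> ennreal weight_const * (\<integral>\<^sup>+y. norm (f y) powr p \<partial>haar_circle)"
proof -
  have "(\<integral>\<^sup>+y. norm (resolvent x z f y) powr p \<partial>haar_circle) \<le> (\<integral>\<^sup>+y. weight f y \<partial>haar_circle)"
  proof (rule nn_integral_mono_AE)
    show "AE y in haar_circle. ennreal (norm (resolvent x z f y) powr p) \<le> weight f y"
      using AE_weight_finite[OF assms] by eventually_elim (rule resolvent_le_weight)
  qed
  also note nn_integral_weight[OF assms]
  finally show ?thesis .
qed

lemma newton_term_tendsto_0:
  assumes "weight f y < \<infinity>"
  shows "(\<lambda>k. newton_term x z f k y) \<longlonglongrightarrow> 0"
  by (rule tendsto_norm_zero_cancel, rule summable_LIMSEQ_zero, rule summable_newton_term[OF assms])

lemma resolvent_left_inverse: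
  assumes f: "f \<in> borel_measurable borel" "(\<integral>\<^sup>+y. norm (f y) powr p \<partial>haar_circle) < \<infinity>"
  shows "AE y in haar_circle. resolvent x z (\<lambda>y. conv_op \<nu> f y - z * f y) y = f y"
proof -
  have int: "integrable haar_circle f" using f p by (intro integrable_if_Lp) auto
  have "AE y in haar_circle. \<forall>k. newton_iter \<nu> x k (\<lambda>y. conv_op \<nu> f y - z * f y) y
      = conv_op \<nu> (newton_iter \<nu> x k f) y - z * newton_iter \<nu> x k f y"
    unfolding AE_all_countable using newton_iter_conv_op_AE[OF int] by blast
  then show ?thesis using AE_weight_finite[OF f]
  proof eventually_elim
    case (elim y)
    have "(\<lambda>k. newton_term x z (\<lambda>y. conv_op \<nu> f y - z * f y) k y) sums (- f y)"
      unfolding newton_term_def using elim(1)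
        newton_term_telescope[OF newton_poly_nonzero z_bounded newton_term_tendsto_0[OF elim(2)]] by simp
    then show ?case unfolding resolvent_def by (simp add: sums_unique[symmetric])
  qed
qed

text \<open>T must be exchanged with an infinite series. The sum \<open>U\<close> of the moduli is
  at most 1 + \<open>weight f\<close>, hence integrable, so its convolution is finite almost
  everywhere, and at such points the integral may be taken term by term.\<close>

lemma resolvent_right_inverse:
  assumes f: "f \<in> borel_measurable borel" "(\<integral>\<^sup>+y. norm (f y) powr p \<partial>haar_circle) < \<infinity>"
  shows "AE y in haar_circle. conv_op \<nu> (resolvent x z f) y - z * resolvent x z f y = f y"
proof -
  let ?r = "newton_term x z f"
  note [measurable] = measurable_newton_term[OF f(1)]
  have [measurable]: "weight f \<in> borel_measurable borel" unfolding weight_def[abs_def] by measurable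
  define U where "U y = (\<Sum>k. ennreal (norm (?r k y)))" for y
  have [measurable]: "U \<in> borel_measurable borel" unfolding U_def[abs_def] by measurable
  have "(\<integral>\<^sup>+y. U y \<partial>haar_circle) \<le> (\<integral>\<^sup>+y. 1 + weight f y \<partial>haar_circle)"
  proof (rule nn_integral_mono_AE, use AE_weight_finite[OF f] in eventually_elim)
    case (elim y)
    let ?W = "enn2real (weight f y)"
    have "U y \<le> (\<Sum>k. ennreal ((1 / 2) ^ Suc k * ?W powr (1 / p)))"
      unfolding U_def by (intro suminf_le summableI ennreal_leI newton_term_le_weight elim)
    also have "\<dots> = ennreal (?W powr (1 / p))"
      by (rule suminf_ennreal_eq[OF _ half_sums]) simp
    \<comment> \<open>The inequality s \<le> 1 + s^p with s = W^(1/p) passes from the p-th root back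
      to an integrable bound.\<close>
    also have "\<dots> \<le> ennreal (1 + ?W)"
    proof (rule ennreal_leI)
      have "(?W powr (1 / p)) powr 1 \<le> 1 + (?W powr (1 / p)) powr p"
        using p by (intro power_le_one_plus_powr) auto
      then show "?W powr (1 / p) \<le> 1 + ?W" using p by (simp add: powr_powr)
    qed
    also have "\<dots> = 1 + weight f y" using elim by (simp add: ennreal_plus less_top)
    finally show ?case .
  qed
  also have "\<dots> = 1 + (\<integral>\<^sup>+y. weight f y \<partial>haar_circle)"
    using haar.emeasure_space_1 by (subst nn_integral_add) auto
  also have "\<dots> < \<infinity>"
    using nn_integral_weight[OF f] f(2) by (auto intro: le_less_trans simp: ennreal_mult_less_top)
  finally have "AE y in haar_circle. (\<integral>\<^sup>+u. U (y - u) \<partial>\<nu>) < \<infinity>"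
    by (intro AE_finite_convolution) auto
  then show ?thesis using AE_weight_finite[OF f]
  proof eventually_elim
    case (elim y)
    have "(\<integral>\<^sup>+u. norm (?r k (y - u)) \<partial>\<nu>) < \<infinity>" for k
    proof -
      have "(\<integral>\<^sup>+u. norm (?r k (y - u)) \<partial>\<nu>) \<le> (\<integral>\<^sup>+u. U (y - u) \<partial>\<nu>)"
      proof (rule nn_integral_mono)
        fix u
        have "(\<Sum>j\<in>{k}. ennreal (norm (?r j (y - u)))) \<le> (\<Sum>j. ennreal (norm (?r j (y - u))))"
          by (intro sum_le_suminf summableI) simp_all
        then show "ennreal (norm (?r k (y - u))) \<le> U (y - u)" by (simp add: U_def)
      qed
      then show ?thesis using elim(1) by (rule le_less_trans)
    qed
    then have int: "integrable \<nu> (\<lambda>u. ?r k (y - u))" for k by (simp add: integrable_iff_bounded)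
    have "AE u in \<nu>. U (y - u) \<noteq> \<infinity>"
      using elim(1) by (intro nn_integral_PInf_AE) auto
    then have summ: "AE u in \<nu>. summable (\<lambda>k. norm (?r k (y - u)))"
      by eventually_elim (auto simp: U_def intro!: summable_suminf_not_top)
    have "(\<Sum>k. \<integral>\<^sup>+u. norm (?r k (y - u)) \<partial>\<nu>) = (\<integral>\<^sup>+u. U (y - u) \<partial>\<nu>)"
      unfolding U_def by (rule nn_integral_suminf[symmetric]) measurable
    then have "(\<Sum>k. ennreal (\<integral>u. norm (?r k (y - u)) \<partial>\<nu>)) \<noteq> top"
      using elim(1) int by (simp add: nn_integral_eq_integral less_top)
    then have sumi: "summable (\<lambda>k. \<integral>u. norm (?r k (y - u)) \<partial>\<nu>)"
      by (intro summable_suminf_not_top) auto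
    have "(\<lambda>k. conv_op \<nu> (?r k) y) sums (\<integral>u. (\<Sum>k. ?r k (y - u)) \<partial>\<nu>)"
      unfolding conv_op_def by (rule sums_integral[OF int summ sumi])
    moreover have "(\<integral>u. (\<Sum>k. ?r k (y - u)) \<partial>\<nu>) = - conv_op \<nu> (resolvent x z f) y"
      by (simp add: conv_op_def resolvent_def)
    moreover have "conv_op \<nu> (?r k) y = conv_op \<nu> (newton_iter \<nu> x k f) y / newton_poly x (Suc k) z" for k
      unfolding newton_term_def[abs_def] divide_inverse
      using conv_op_cmult[of "inverse (newton_poly x (Suc k) z)" "newton_iter \<nu> x k f" y] by (simp add: mult.commute)
    ultimately have 1: "(\<lambda>k. conv_op \<nu> (newton_iter \<nu> x k f) y / newton_poly x (Suc k) z) sums (- conv_op \<nu> (resolvent x z f) y)"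
      by simp
    have "(\<lambda>k. ?r k y) sums (- resolvent x z f y)"
      unfolding resolvent_def minus_minus by (intro summable_sums summable_norm_cancel[OF summable_newton_term[OF elim(2)]])
    from sums_diff[OF 1 sums_mult[OF this, of z]]
    have "(\<lambda>k. (conv_op \<nu> (newton_iter \<nu> x k f) y - z * newton_iter \<nu> x k f y) / newton_poly x (Suc k) z)
      sums (- conv_op \<nu> (resolvent x z f) y + z * resolvent x z f y)"
      by (simp add: newton_term_def diff_divide_distrib)
    moreover have "(\<lambda>k. (conv_op \<nu> (newton_iter \<nu> x k f) y - z * newton_iter \<nu> x k f y) / newton_poly x (Suc k) z) sums (- f y)"
      by (rule newton_term_telescope[OF newton_poly_nonzero z_bounded newton_term_tendsto_0[OF elim(2)]])
    ultimately have "- conv_op \<nu> (resolvent x z f) y + z * resolvent x z f y = - f y" by (rule sums_unique2)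
    then show ?case by (simp add: algebra_simps)
  qed
qed

lemma Lp_spaceD:
  assumes "f \<in> Lp_space p haar_circle"
  shows "f \<in> borel_measurable borel" "(\<integral>\<^sup>+y. norm (f y) powr p \<partial>haar_circle) < \<infinity>"
    "(\<integral>\<^sup>+y. norm (f y) powr p \<partial>haar_circle) = ennreal (\<integral>y. norm (f y) powr p \<partial>haar_circle)"
proof -
  show "f \<in> borel_measurable borel" using assms by (simp add: Lp_space_def)
  have "integrable haar_circle (\<lambda>y. norm (f y) powr p)" using assms by (simp add: Lp_space_def)
  then show "(\<integral>\<^sup>+y. norm (f y) powr p \<partial>haar_circle) = ennreal (\<integral>y. norm (f y) powr p \<partial>haar_circle)"
    by (intro nn_integral_eq_integral) auto
  then show "(\<integral>\<^sup>+y. norm (f y) powr p \<partial>haar_circle) < \<infinity>" by simp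
qed

lemma bounded_resolvent: "Lp_bounded_operator p haar_circle (resolvent x z)"
  unfolding Lp_bounded_operator_def
proof (intro conjI ballI allI)
  fix f assume f: "f \<in> Lp_space p haar_circle"
  note Lp = Lp_spaceD[OF f]
  have [measurable]: "resolvent x z f \<in> borel_measurable borel" using Lp(1) by (rule measurable_resolvent)
  have "(\<integral>\<^sup>+y. norm (resolvent x z f y) powr p \<partial>haar_circle) < \<infinity>"
    using resolvent_Lp[OF Lp(1,2)] Lp(2) by (auto intro: le_less_trans simp: ennreal_mult_less_top)
  then show "resolvent x z f \<in> Lp_space p haar_circle"
    by (simp add: Lp_space_def integrable_iff_bounded)
next
  fix f g assume f: "f \<in> Lp_space p haar_circle" and g: "g \<in> Lp_space p haar_circle"
  note Lf = Lp_spaceD[OF f] and Lg = Lp_spaceD[OF g]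
  have "integrable haar_circle f" "integrable haar_circle g"
    using integrable_if_Lp[OF Lf(1) _ Lf(2)] integrable_if_Lp[OF Lg(1) _ Lg(2)] p by simp_all
  then have "AE y in haar_circle. \<forall>k. newton_iter \<nu> x k (\<lambda>y. f y + g y) y = newton_iter \<nu> x k f y + newton_iter \<nu> x k g y"
    unfolding AE_all_countable using newton_iter_add_AE by blast
  then show "AE y in haar_circle. resolvent x z (\<lambda>y. f y + g y) y = resolvent x z f y + resolvent x z g y"
    using AE_weight_finite[OF Lf(1,2)] AE_weight_finite[OF Lg(1,2)]
  proof eventually_elim
    case (elim y)
    have "newton_term x z (\<lambda>y. f y + g y) k y = newton_term x z f k y + newton_term x z g k y" for k
      using elim(1) by (simp add: newton_term_def add_divide_distrib)
    moreover have "summable (\<lambda>k. newton_term x z f k y)" "summable (\<lambda>k. newton_term x z g k y)"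
      using elim(2,3) by (blast intro: summable_norm_cancel[OF summable_newton_term])+
    ultimately show ?case unfolding resolvent_def by (simp add: suminf_add[symmetric])
  qed
next
  fix c f assume f: "f \<in> Lp_space p haar_circle"
  show "AE y in haar_circle. resolvent x z (\<lambda>y. c * f y) y = c * resolvent x z f y"
    using AE_weight_finite[OF Lp_spaceD(1,2)[OF f]]
  proof eventually_elim
    case (elim y)
    have "newton_term x z (\<lambda>y. c * f y) k y = c * newton_term x z f k y" for k
      by (simp add: newton_term_def newton_iter_cmult)
    moreover have "summable (\<lambda>k. newton_term x z f k y)"
      by (rule summable_norm_cancel[OF summable_newton_term[OF elim]])
    ultimately show ?case unfolding resolvent_def by (simp add: suminf_mult)
  qed
next
  have "Lp_norm p haar_circle (resolvent x z f) \<le> weight_const powr (1 / p) * Lp_norm p haar_circle f"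
    if f: "f \<in> Lp_space p haar_circle" for f
  proof -
    note Lp = Lp_spaceD[OF f]
    let ?I = "\<integral>y. norm (f y) powr p \<partial>haar_circle" and ?J = "\<integral>y. norm (resolvent x z f y) powr p \<partial>haar_circle"
    have [measurable]: "resolvent x z f \<in> borel_measurable borel" using Lp(1) by (rule measurable_resolvent)
    have le: "(\<integral>\<^sup>+y. norm (resolvent x z f y) powr p \<partial>haar_circle) \<le> ennreal (weight_const * ?I)"
      using resolvent_Lp[OF Lp(1,2)] weight_const_pos unfolding Lp(3) by (subst ennreal_mult) auto
    have "ennreal ?J = (\<integral>\<^sup>+y. norm (resolvent x z f y) powr p \<partial>haar_circle)"
    proof (rule nn_integral_eq_integral[symmetric])
      show "integrable haar_circle (\<lambda>y. norm (resolvent x z f y) powr p)"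
        using le by (auto simp: integrable_iff_bounded intro: le_less_trans)
    qed auto
    then have "ennreal ?J \<le> ennreal (weight_const * ?I)" using le by simp
    then have "?J \<le> weight_const * ?I" using weight_const_pos by (subst (asm) ennreal_le_iff) auto
    then have "?J powr (1 / p) \<le> (weight_const * ?I) powr (1 / p)" using p by (intro powr_mono2) auto
    also have "\<dots> = weight_const powr (1 / p) * ?I powr (1 / p)"
      by (rule powr_mult)
    finally show ?thesis by (simp add: Lp_norm_def)
  qed
  then show "\<exists>C. \<forall>f\<in>Lp_space p haar_circle. Lp_norm p haar_circle (resolvent x z f) \<le> C * Lp_norm p haar_circle f"
    by blast
qed

lemma not_in_spectrum: "z \<notin> Lp_spectrum p haar_circle (conv_op \<nu>)"
  unfolding Lp_spectrum_def mem_Collect_eq not_not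
  using bounded_resolvent resolvent_left_inverse resolvent_right_inverse Lp_spaceD(1,2)
  by (intro exI[of _ "resolvent x z"] conjI ballI) blast+

end

section \<open>The spectrum as the closure of the Fourier coefficients\<close>

context circle_measure
begin

lemma circle_char_in_Lp: "circle_char n \<in> Lp_space p haar_circle"
  by (simp add: Lp_space_def haar.integrable_const)

lemma Lp_norm_circle_char: "Lp_norm p haar_circle (circle_char n) = 1"
  using haar.prob_space by (simp add: Lp_norm_def)

text \<open>Characters are eigenfunctions of norm 1, so an inverse of T - z would stretch the n-th
  one by the reciprocal of the distance from its eigenvalue to z, which is unbounded as the
  eigenvalues approach z.\<close>

lemma fourier_coeffs_in_spectrum:
  assumes z: "z \<in> closure (range (fourier_coeff \<nu>))" and p: "p > 0"
  shows "z \<in> Lp_spectrum p haar_circle (conv_op \<nu>)"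
  unfolding Lp_spectrum_def mem_Collect_eq
proof
  assume "\<exists>S. Lp_bounded_operator p haar_circle S \<and>
    (\<forall>f\<in>Lp_space p haar_circle. AE x in haar_circle. S (\<lambda>x. conv_op \<nu> f x - z * f x) x = f x) \<and>
    (\<forall>f\<in>Lp_space p haar_circle. AE x in haar_circle. conv_op \<nu> (S f) x - z * S f x = f x)"
  then obtain S where S: "Lp_bounded_operator p haar_circle S"
    and inv: "\<And>f. f \<in> Lp_space p haar_circle \<Longrightarrow> AE x in haar_circle. S (\<lambda>x. conv_op \<nu> f x - z * f x) x = f x"
    by blast
  obtain C where C: "\<And>f. f \<in> Lp_space p haar_circle \<Longrightarrow> Lp_norm p haar_circle (S f) \<le> C * Lp_norm p haar_circle f"
    using S unfolding Lp_bounded_operator_def by blast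
  \<comment> \<open>The added 1 keeps the denominator positive for every bound \<open>C\<close>,
    including 0.\<close>
  have "1 / (\<bar>C\<bar> + 1) > 0" by (simp add: add_nonneg_pos)
  then obtain w where "w \<in> range (fourier_coeff \<nu>)" "dist w z < 1 / (\<bar>C\<bar> + 1)"
    using z unfolding closure_approachable by blast
  then obtain n where n: "norm (fourier_coeff \<nu> n - z) < 1 / (\<bar>C\<bar> + 1)"
    unfolding dist_norm by blast
  let ?e = "circle_char n" and ?c = "fourier_coeff \<nu> n - z"
  have "(\<lambda>x. conv_op \<nu> ?e x - z * ?e x) = (\<lambda>x. ?c * ?e x)"
    by (simp add: conv_op_circle_char left_diff_distrib)
  then have "AE x in haar_circle. S (\<lambda>x. ?c * ?e x) x = ?e x" using inv[OF circle_char_in_Lp[of n]] by simp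
  moreover have "AE x in haar_circle. S (\<lambda>x. ?c * ?e x) x = ?c * S ?e x"
    using S circle_char_in_Lp[of n p] unfolding Lp_bounded_operator_def by blast
  ultimately have "AE x in haar_circle. norm (?c * S ?e x) powr p = 1"
    by eventually_elim (metis norm_circle_char powr_one_eq_one)
  moreover have [measurable]: "S ?e \<in> borel_measurable borel"
    using S circle_char_in_Lp[of n p] unfolding Lp_bounded_operator_def by (auto simp: Lp_space_def)
  ultimately have "(\<integral>x. norm (?c * S ?e x) powr p \<partial>haar_circle) = (\<integral>x. 1 \<partial>haar_circle)"
    by (intro integral_cong_AE) auto
  then have "norm ?c powr p * (\<integral>x. norm (S ?e x) powr p \<partial>haar_circle) = 1"
    using haar.prob_space by (simp add: norm_mult powr_mult)
  then have "(norm ?c powr p * (\<integral>x. norm (S ?e x) powr p \<partial>haar_circle)) powr (1 / p) = 1" by simp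
  then have "norm ?c * Lp_norm p haar_circle (S ?e) = 1"
    using p by (simp add: powr_mult powr_powr Lp_norm_def)
  moreover have "Lp_norm p haar_circle (S ?e) \<le> C"
    using C[OF circle_char_in_Lp[of n]] by (simp add: Lp_norm_circle_char)
  then have "norm ?c * Lp_norm p haar_circle (S ?e) \<le> norm ?c * (\<bar>C\<bar> + 1)" by (intro mult_left_mono) auto
  moreover have "norm ?c * (\<bar>C\<bar> + 1) < 1" using n by (simp add: field_simps)
  ultimately show False by linarith
qed

lemma norm_fourier_coeff_le: "norm (fourier_coeff \<nu> n) \<le> 1"
proof -
  have "norm (fourier_coeff \<nu> n) \<le> (\<integral>y. norm (cnj (circle_char n y)) \<partial>\<nu>)"
    unfolding fourier_coeff_def by (rule integral_norm_bound)
  then show ?thesis using prob_space by simp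
qed

lemma spectrum_eq_closure_fourier_coeffs:
  assumes count: "countable (closure (range (fourier_coeff \<nu>)))" and p: "p > 1"
  shows "Lp_spectrum p haar_circle (conv_op \<nu>) = closure (range (fourier_coeff \<nu>))"
proof (intro equalityI subsetI)
  fix z assume "z \<in> closure (range (fourier_coeff \<nu>))"
  then show "z \<in> Lp_spectrum p haar_circle (conv_op \<nu>)" using p by (intro fourier_coeffs_in_spectrum) auto
next
  fix z assume spec: "z \<in> Lp_spectrum p haar_circle (conv_op \<nu>)"
  let ?K = "closure (range (fourier_coeff \<nu>))"
  have sub: "?K \<subseteq> cball 0 1" by (rule closure_minimal) (auto simp: norm_fourier_coeff_le)
  have comp: "compact ?K" using sub by (meson bounded_cball bounded_subset closed_closure compact_eq_bounded_closed)
  have "?K \<noteq> {}" by simp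
  then obtain x where x: "\<And>k. x k \<in> ?K"
    and cap: "\<And>\<epsilon>. \<epsilon> > 0 \<Longrightarrow> \<exists>C>0. \<forall>k. \<forall>w\<in>?K. norm (newton_poly x k w) \<le> C * \<epsilon> ^ k"
    using newton_nodes_capacity_zero[OF comp count _ sub] by blast
  have x_le: "norm (x k) \<le> 1" for k using x[of k] sub by (auto simp: subset_iff)
  have cap': "\<exists>C>0. \<forall>k n. norm (newton_poly x k (fourier_coeff \<nu> n)) \<le> C * \<epsilon> ^ k" if "\<epsilon> > 0" for \<epsilon>
    using cap[OF that] closure_subset[of "range (fourier_coeff \<nu>)"] by (meson rangeI subsetD)
  show "z \<in> ?K"
  proof (rule ccontr)
    assume "z \<notin> ?K"
    then obtain \<eta> where \<eta>: "\<eta> > 0" "\<And>w. w \<in> ?K \<Longrightarrow> \<eta> \<le> dist z w"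
      using separate_point_closed[OF closed_closure] by blast
    \<comment> \<open>The rate is fixed only after z, through its distance from the closure; this is
      possible because the capacity estimate holds at every rate.\<close>
    have "(\<eta> / 4) powr p > 0" using \<eta>(1) by simp
    then obtain K where K: "K > 0" "\<And>k f. f \<in> borel_measurable borel \<Longrightarrow> (\<integral>\<^sup>+y. norm (f y) powr p \<partial>haar_circle) < \<infinity> \<Longrightarrow>
      (\<integral>\<^sup>+y. norm (newton_iter \<nu> x k f y) powr p \<partial>haar_circle)
        \<le> ennreal (K * ((\<eta> / 4) powr p) ^ k) * (\<integral>\<^sup>+y. norm (f y) powr p \<partial>haar_circle)"
      using newton_iter_Lp_geometric[OF x_le cap' p] by blast
    interpret newton_resolvent \<nu> x z p \<eta> K
    proof
      show "\<eta> \<le> norm (z - x k)" for k using \<eta>(2)[OF x[of k]] by (simp add: dist_norm)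
    qed (use x_le p \<eta> K in auto)
    show False using not_in_spectrum spec by contradiction
  qed
qed

end

lemma limit_points_subset_closure: "limit_points a \<subseteq> closure (range a)"
proof
  fix z assume z: "z \<in> limit_points a"
  show "z \<in> closure (range a)"
  proof (rule ccontr)
    assume "z \<notin> closure (range a)"
    then have "infinite {n. a n \<in> - closure (range a)}"
      using z unfolding limit_points_def by (blast intro: open_Compl closed_closure)
    moreover have "{n. a n \<in> - closure (range a)} = {}" using closure_subset[of "range a"] by auto
    ultimately show False by simp
  qed
qed

lemma closure_range_of_real:
  fixes \<phi> :: "'i \<Rightarrow> real"
  shows "closure (range (\<lambda>n. complex_of_real (\<phi> n))) \<subseteq> of_real ` closure (range \<phi>)"
proof (rule closure_minimal)
  show "range (\<lambda>n. complex_of_real (\<phi> n)) \<subseteq> of_real ` closure (range \<phi>)"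
    using closure_subset[of "range \<phi>"] by auto
  show "closed (complex_of_real ` closure (range \<phi>))"
    by (rule closed_injective_linear_image) (auto intro: linearI simp: scaleR_conv_of_real inj_on_def)
qed

theorem theorem1p1:
  fixes \<theta> :: real and \<mu> :: "real measure" and \<nu> :: "circle measure"
  assumes "pisot \<theta>" and "\<theta> \<notin> \<rat>"
    and "\<mu> = bernoulli_convolution \<theta>"
    and "\<nu> = distr \<mu> borel circle_of"
  shows "(countable (limit_points (\<lambda>n :: int. fourier_transform \<mu> (of_int n))) \<and>
          infinite (limit_points (\<lambda>n :: int. fourier_transform \<mu> (of_int n)))) \<and>
         (\<forall>p :: real. 1 < p \<longrightarrow>
            Lp_spectrum p haar_circle (conv_op \<nu>) = Lp_spectrum 2 haar_circle (conv_op \<nu>) \<and>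
            Lp_spectrum 2 haar_circle (conv_op \<nu>) = closure (range (fourier_coeff \<nu>)))"
proof -
  have th: "\<theta> > 1" using assms(1) by (simp add: pisot_def)
  obtain A B c C \<rho> where data: "coeff A 0 = 1" "map_poly of_int A = [:1, - \<theta>:] * B"
      "fps_of_poly B * Abs_fps c = 1" "0 < \<rho>" "\<rho> < 1" "1 / \<theta> \<le> \<rho>" "C > 0"
      "\<And>n. \<bar>c n\<bar> \<le> C * \<rho> ^ n" "\<And>j. j > 0 \<Longrightarrow> \<theta> ^ j \<notin> \<rat>"
    by (rule pisot_reciprocal_data[OF assms(1,2)], rule that)
  interpret pisot_recurrence \<theta> \<rho> C c A B
    by unfold_locales (fact th data)+
  obtain \<phi> where \<phi>: "\<And>t. fourier_transform \<mu> t = of_real (\<phi> t)"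
      "\<And>t. (\<lambda>n. \<Prod>k<n. cos (2 * pi * t / \<theta> ^ k)) \<longlonglongrightarrow> \<phi> t"
    by (rule fourier_transform_bernoulli_convolution[OF th, folded assms(3)], rule that)
  have "countable (closure (range (\<lambda>n :: int. \<phi> (of_int n))))"
    by (rule countable_closure_values[OF \<phi>(2)])
  then have count: "countable (closure (range (\<lambda>n :: int. fourier_transform \<mu> (of_int n))))"
    unfolding \<phi>(1) by (rule countable_subset[OF closure_range_of_real countable_image])
  interpret \<mu>: real_distribution \<mu>
    unfolding assms(3) by (rule bernoulli_convolution_welldef(1)[OF th])
  have coeff: "fourier_coeff \<nu> = (\<lambda>n. fourier_transform \<mu> (of_int n))"
    unfolding assms(4) by (rule ext, rule fourier_coeff_projection) simp
  interpret \<nu>: circle_measure \<nu>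
  proof (intro circle_measure.intro circle_measure_axioms.intro)
    show "prob_space \<nu>" unfolding assms(4) by (rule \<mu>.prob_space_distr) measurable
  qed (simp add: assms(4))
  have "infinite (limit_points (\<lambda>n :: int. fourier_transform \<mu> (of_int n)))"
    unfolding \<phi>(1) by (rule infinite_limit_points[OF \<phi>(2)])
  \<comment> \<open>Applied at the given exponent and at 2: both spectra equal one and the same
    closure.\<close>
  moreover have "Lp_spectrum p haar_circle (conv_op \<nu>) = closure (range (fourier_coeff \<nu>))" if "p > 1" for p
    by (rule \<nu>.spectrum_eq_closure_fourier_coeffs[OF _ that]) (use count coeff in simp)
  ultimately show ?thesis using countable_subset[OF limit_points_subset_closure count] by auto
qed

end
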